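(* There exist smooth bounded solutions $u$ of the translating soliton equation $$\operatorname{div}\left(\frac{\nabla u}{\sqrt{1+|\nabla u|^2}}\right)=-\frac{\partial_3u}{\sqrt{1+|\nabla u|^2}}$$ defined over the lower half-plane $\{(x_2,x_3): x_2\in\mathbb{R},\ x_3\le0\}$ for which $$\forall x_2\in\mathbb{R}:\quad \limsup_{x_3\searrow-\infty}u(x_2,x_3)-\liminf_{x_3\searrow-\infty}u(x_2,x_3)>0 .$$ In particular, for fixed $x_2$, $u(x_2,x_3)$ has no limit as $x_3\searrow-\infty$. Furthermore, given any interval $J=[\alpha,\beta]\subseteq\mathbb{R}$, there exists a bounded solution $u_J$ of the same equation over the lower half-plane such that for every $\gamma\in(\alpha,\beta)$ there exists a sequence $t_k^\gamma\nearrow+\infty$ with $$\operatorname{Graph}[u_J]+t_k^\gamma\,\mathbf{e}_3\longrightarrow\{x_1=\gamma\}$$ smoothly on compact subsets of $\mathbb{R}^3$.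
   Context: Coordinates $(x_1,x_2,x_3)$ on $\mathbb{R}^3$, with $\mathbf{e}_3=(0,0,1)$; functions $u$ depend on $(x_2,x_3)$, $\nabla u=(\partial_2u,\partial_3u)$, $\operatorname{div}$ is the divergence in $(x_2,x_3)$, and $\operatorname{Graph}[u]=\{(u(x_2,x_3),x_2,x_3)\}$. The equation says that $\operatorname{Graph}[u]$ is a translating soliton of mean curvature flow with velocity $\mathbf{e}_3$. *)

theory Defs
  imports "HOL-Analysis.Analysis"
begin

type_synonym plane = "real \<times> real"         (* (x2, x3) *)
type_synonym space = "real \<times> real \<times> real"  (* (x1, x2, x3) *)

definition e3 :: space where
  "e3 = (0, 0, 1)"

definition lower_half_plane :: "plane set" where
  "lower_half_plane = {(x2, x3). x3 \<le> 0}"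

text \<open>
  All derivatives are taken within the domain S, which is below always either open or the closed
  half-plane. On such sets the derivative within S is unique, so the choice operator hidden in
  \<^const>\<open>frechet_derivative\<close> is harmless; at boundary points it gives the one-sided derivative.
\<close>

definition dir_deriv ::
  "'a::real_normed_vector set \<Rightarrow> 'a \<Rightarrow> ('a \<Rightarrow> 'b::real_normed_vector) \<Rightarrow> 'a \<Rightarrow> 'b" where
  "dir_deriv S v f x = frechet_derivative f (at x within S) v"

primrec iter_deriv ::
  "'a::real_normed_vector set \<Rightarrow> 'a list \<Rightarrow> ('a \<Rightarrow> 'b::real_normed_vector) \<Rightarrow> 'a \<Rightarrow> 'b" where
  "iter_deriv S [] f = f"
| "iter_deriv S (v # vs) f = dir_deriv S v (iter_deriv S vs f)"

text \<open>
  Smoothness up to the boundary: every iterated derivative is (Frechet) differentiable within S,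
  hence also continuous on S.
\<close>

definition smooth_on ::
  "'a::real_normed_vector set \<Rightarrow> ('a \<Rightarrow> 'b::real_normed_vector) \<Rightarrow> bool" where
  "smooth_on S f \<longleftrightarrow> (\<forall>vs. iter_deriv S vs f differentiable_on S)"

definition gradient :: "plane set \<Rightarrow> (plane \<Rightarrow> real) \<Rightarrow> plane \<Rightarrow> plane" where
  "gradient S u p = (dir_deriv S (1, 0) u p, dir_deriv S (0, 1) u p)"

definition divergence :: "plane set \<Rightarrow> (plane \<Rightarrow> plane) \<Rightarrow> plane \<Rightarrow> real" where
  "divergence S F p =
     dir_deriv S (1, 0) (\<lambda>q. fst (F q)) p + dir_deriv S (0, 1) (\<lambda>q. snd (F q)) p"

definition translating_soliton_solution :: "plane set \<Rightarrow> (plane \<Rightarrow> real) \<Rightarrow> bool" where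
  "translating_soliton_solution S u \<longleftrightarrow>
     smooth_on S u \<and>
     (\<forall>p\<in>S.
        divergence S (\<lambda>q. gradient S u q /\<^sub>R sqrt (1 + (norm (gradient S u q))\<^sup>2)) p
        = - (dir_deriv S (0, 1) u p / sqrt (1 + (norm (gradient S u p))\<^sup>2)))"

definition Graph :: "plane set \<Rightarrow> (plane \<Rightarrow> real) \<Rightarrow> space set" where
  "Graph S u = {(u (x2, x3), x2, x3) | x2 x3. (x2, x3) \<in> S}"

definition smooth_uniform_limit ::
  "'a::real_normed_vector set \<Rightarrow> (nat \<Rightarrow> 'a \<Rightarrow> 'b::real_normed_vector) \<Rightarrow> ('a \<Rightarrow> 'b) \<Rightarrow> bool" where
  "smooth_uniform_limit S f g \<longleftrightarrow>
     (\<forall>vs. uniform_limit S (\<lambda>k. iter_deriv S vs (f k)) (iter_deriv S vs g) sequentially)"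

text \<open>
  Smooth convergence on compact subsets (with multiplicity one) of sets M k to a smooth surface N
  in 3-space. In a small cylinder around a point of N, whose axis and base are given by a rotated
  orthonormal frame Q, both N and, for all large k, M k are exactly the graphs of smooth functions
  over the base disc, and these functions converge uniformly with all derivatives. Points
  outside N have a neighbourhood which M k leaves eventually. As every compact set
  is covered by finitely many such neighbourhoods, the local condition at every point is the same
  as the condition on compact sets.
\<close>

definition cylinder :: "space \<Rightarrow> (space \<Rightarrow> space) \<Rightarrow> real \<Rightarrow> real \<Rightarrow> space set" where
  "cylinder p Q r h = {p + Q (s, y) | s y. \<bar>s\<bar> < h \<and> y \<in> ball 0 r}"

definition graph_in_frame ::
  "space \<Rightarrow> (space \<Rightarrow> space) \<Rightarrow> real \<Rightarrow> (plane \<Rightarrow> real) \<Rightarrow> space set" where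
  "graph_in_frame p Q r f = {p + Q (f y, y) | y. y \<in> ball 0 r}"

definition surfaces_converge_smoothly :: "(nat \<Rightarrow> space set) \<Rightarrow> space set \<Rightarrow> bool" where
  "surfaces_converge_smoothly M N \<longleftrightarrow>
     (\<forall>p. p \<notin> N \<longrightarrow> (\<exists>W. open W \<and> p \<in> W \<and> (\<forall>\<^sub>F k in sequentially. M k \<inter> W = {}))) \<and>
     (\<forall>p\<in>N. \<exists>Q r h f g.
        orthogonal_transformation Q \<and> r > 0 \<and> h > 0 \<and>
        smooth_on (ball 0 r) g \<and>
        N \<inter> cylinder p Q r h = graph_in_frame p Q r g \<and>
        (\<forall>\<^sub>F k in sequentially.
           smooth_on (ball 0 r) (f k) \<and> M k \<inter> cylinder p Q r h = graph_in_frame p Q r (f k)) \<and>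
        smooth_uniform_limit (ball 0 r) f g)"

end

theory Submission
  imports Defs
begin

text \<open>
  Put \<open>x = x2\<close> and \<open>t = 1 - x3\<close>. Multiplied out, the translating soliton equation becomes
  \<open>u\<^sub>x\<^sub>x + u\<^sub>t\<^sub>t - u\<^sub>t = N(u)\<close>, where every term of
  \<open>N(u) = u\<^sub>t (u\<^sub>x\<^sup>2 + u\<^sub>t\<^sup>2) - u\<^sub>t\<^sup>2 u\<^sub>x\<^sub>x + 2 u\<^sub>x u\<^sub>t u\<^sub>x\<^sub>t - u\<^sub>x\<^sup>2 u\<^sub>t\<^sub>t\<close>
  is at least cubic in the derivatives of \<open>u\<close>. For large \<open>t\<close> the linear part acts like the heat
  equation with time \<open>t\<close>. A bounded solution of the heat equation on the line averages its
  datum over windows of width \<open>sqrt t\<close>, so it has no limit if the datum oscillates in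
  \<open>ln \<bar>x\<bar>\<close>. Parabolic scaling gives \<open>u\<^sub>x ~ t powr (-1/2)\<close> and \<open>u\<^sub>t, u\<^sub>x\<^sub>x ~ 1/t\<close>, so that
  \<open>N(u) ~ t powr (-2)\<close> is integrable in time: the nonlinearity adds a correction that tends to
  zero, and the oscillation survives. All derivatives of \<open>u\<close> tend to zero, hence a translate
  by a time \<open>t\<close> at which \<open>u(0, t) = \<gamma>\<close> is close to the plane \<open>x1 = \<gamma>\<close>.

  The nonlinear problem is solved for the Fourier transform in \<open>x\<close>, which is bounded pointwise by
  multiples of \<open>mj r k = exp (- \<bar>k\<bar>) / (1 + k\<^sup>2 r\<^sup>2)\<close> with \<open>r\<^sup>2 = 1 + t/2\<close>. These
  majorants form an algebra under convolution (\<open>symbol_bound_conv\<close>), in which each product gains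
  a factor \<open>1/r\<close>. For a fixed frequency the linear problem is an ordinary differential equation;
  Duhamel's formula gains two derivatives without any loss (\<open>duh_bounds\<close>), because only absolute
  values at one frequency are compared. The unknown is the transform of \<open>N(u)\<close>, and it is the
  fixed point of a contraction (\<open>rhs_contraction\<close>, \<open>sol_eq\<close>). The solution of the linear problem is
  prescribed through the transform of \<open>u\<^sub>x\<close>. This function is small and bounded, although \<open>u\<close>
  itself has a transform with a singularity like \<open>1/\<bar>k\<bar>\<close> and oscillates with arbitrarily large
  amplitude (\<open>linear_asymptotics\<close>).

  The factor \<open>exp (- \<bar>k\<bar>)\<close> makes \<open>u\<close> and \<open>u\<^sub>t\<close> smooth in \<open>x\<close>. The equation expresses \<open>u\<^sub>t\<^sub>t\<close> by
  derivatives of lower order in \<open>t\<close>, so all derivatives of \<open>u\<close> lie in an algebra of functions that is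
  generated by the \<open>x\<close>-derivatives of \<open>u\<^sub>x\<close> and \<open>u\<^sub>t\<close> and one rational function of \<open>u\<^sub>x\<close>
  (\<open>dalg_has_derivative\<close>), all of whose elements tend to zero (\<open>dalg_tendsto\<close>).
\<close>

section \<open>The dispersion relation\<close>

text \<open>The characteristic roots of \<open>v'' - v' - k\<^sup>2 v = 0\<close>, the linearized equation at frequency \<open>k\<close>,
  are \<open>- lam k\<close> and \<open>1 + lam k\<close>. The rate is of order \<open>k\<^sup>2\<close> for low frequencies, as for the heat
  equation, and of order \<open>\<bar>k\<bar>\<close> for high ones.\<close>

definition lam :: "real \<Rightarrow> real" where
  "lam k = (sqrt (1 + 4 * k\<^sup>2) - 1) / 2"

lemma lam_nonneg [simp]: "0 \<le> lam k"
  by (simp add: lam_def)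

lemma lam_quadratic: "lam k * (1 + lam k) = k\<^sup>2"
proof -
  have "(sqrt (1 + 4 * k\<^sup>2))\<^sup>2 = 1 + 4 * k\<^sup>2"
    by (simp add: add_nonneg_nonneg)
  moreover have "4 * (lam k * (1 + lam k)) = (sqrt (1 + 4 * k\<^sup>2))\<^sup>2 - 1"
    by (simp add: lam_def field_simps power2_eq_square)
  ultimately show ?thesis by linarith
qed

lemma lam_zero [simp]: "lam 0 = 0"
  by (simp add: lam_def)

lemma lam_minus [simp]: "lam (- k) = lam k"
  by (simp add: lam_def)

lemma lam_le_square: "lam k \<le> k\<^sup>2"
  using lam_quadratic[of k] lam_nonneg[of k]
  by (metis add.commute add_increasing mult_left_le_one_le mult_le_cancel_left1 mult_left_mono
      mult.right_neutral le_add_same_cancel1)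

lemma lam_le_abs: "lam k \<le> \<bar>k\<bar>"
proof -
  have "(lam k)\<^sup>2 \<le> k\<^sup>2"
  proof -
    have "(lam k)\<^sup>2 = k\<^sup>2 - lam k"
      using lam_quadratic[of k] by (simp add: power2_eq_square algebra_simps)
    then show ?thesis using lam_nonneg[of k] by linarith
  qed
  then show ?thesis
    by (metis abs_le_square_iff abs_of_nonneg lam_nonneg)
qed

lemma square_le_lam: "k\<^sup>2 \<le> lam k * (1 + k\<^sup>2)"
proof -
  have "lam k * (1 + lam k) \<le> lam k * (1 + k\<^sup>2)"
    by (intro mult_left_mono add_left_mono lam_le_square) auto
  then show ?thesis by (simp add: lam_quadratic)
qed

lemma abs_le_lam: "2 * \<bar>k\<bar> \<le> 1 + 2 * lam k"
proof -
  have "sqrt ((2 * k)\<^sup>2) \<le> sqrt (1 + 4 * k\<^sup>2)"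
    by (rule real_sqrt_le_mono) (simp add: power2_eq_square)
  then have "\<bar>2 * k\<bar> \<le> sqrt (1 + 4 * k\<^sup>2)" by (simp only: real_sqrt_abs)
  then show ?thesis by (simp add: lam_def abs_mult field_simps)
qed

lemma lam_measurable [measurable]: "lam \<in> borel_measurable borel"
  unfolding lam_def[abs_def] by measurable

lemma lam_has_derivative:
  "(lam has_real_derivative 2 * k / (1 + 2 * lam k)) (at k)"
proof -
  have "1 + 4 * k\<^sup>2 > 0" by (simp add: add_pos_nonneg)
  then show ?thesis
    unfolding lam_def[abs_def]
    by (auto intro!: derivative_eq_intros simp: field_simps)
qed

section \<open>Symbols with Cauchy decay and their convolutions\<close>

lemma has_bochner_integral_cauchy:
  assumes "0 < r"
  shows "has_bochner_integral lborel (\<lambda>x::real. 1 / (1 + x\<^sup>2 * r\<^sup>2)) (pi / r)"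
proof -
  have cont: "isCont (\<lambda>x::real. 1 / (1 + x\<^sup>2)) x" for x
    by (intro continuous_intros) (metis add_pos_nonneg less_irrefl zero_le_power2 zero_less_one)
  have der: "(arctan has_real_derivative 1 / (1 + x\<^sup>2)) (at x)" for x
    using DERIV_arctan[of x] by (simp add: inverse_eq_divide)
  have 1: "((arctan \<circ> real_of_ereal) \<longlongrightarrow> - (pi/2)) (at_right (-\<infinity>))"
    using tendsto_arctan_at_bot by (simp add: ereal_tendsto_simps1)
  have 2: "((arctan \<circ> real_of_ereal) \<longlongrightarrow> pi/2) (at_left \<infinity>)"
    using tendsto_arctan_at_top by (simp add: ereal_tendsto_simps1)
  have "set_integrable lborel (einterval (-\<infinity>) \<infinity>) (\<lambda>x::real. 1 / (1 + x\<^sup>2))"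
       "(LBINT x=-\<infinity>..\<infinity>. 1 / (1 + x\<^sup>2)) = pi/2 - (- (pi/2))"
    using interval_integral_FTC_nonneg[of "-\<infinity>" "\<infinity>" arctan "\<lambda>x::real. 1 / (1 + x\<^sup>2)"
        "- (pi/2)" "pi/2", OF _ der cont _ 1 2]
    by auto
  then have "has_bochner_integral lborel (\<lambda>x::real. 1 / (1 + x\<^sup>2)) pi"
    by (simp add: interval_lebesgue_integral_def set_integrable_def set_lebesgue_integral_def
        einterval_def has_bochner_integral_iff)
  then have "has_bochner_integral lborel (\<lambda>x::real. 1 / (1 + (0 + r * x)\<^sup>2)) (pi /\<^sub>R \<bar>r\<bar>)"
    by (intro lborel_has_bochner_integral_real_affine_iff[THEN iffD1]) (use assms in auto)
  then show ?thesis
    using assms by (simp add: power_mult_distrib mult.commute divide_inverse)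
qed

lemma integrable_cauchy: "0 < r \<Longrightarrow> integrable lborel (\<lambda>x::real. 1 / (1 + x\<^sup>2 * r\<^sup>2))"
  using has_bochner_integral_cauchy by (rule integrable.intros)

lemma integral_cauchy:
  "0 < r \<Longrightarrow> integral\<^sup>L lborel (\<lambda>x::real. 1 / (1 + x\<^sup>2 * r\<^sup>2)) = pi / r"
  using has_bochner_integral_cauchy by (rule has_bochner_integral_integral_eq)

text \<open>The Cauchy factor is adapted to functions that vary on the scale \<open>r\<close>; the exponential factor is
  submultiplicative, so it passes through convolutions, and it dominates all powers of \<open>k\<close>.\<close>

definition mj :: "real \<Rightarrow> real \<Rightarrow> real" where
  "mj r k = exp (- \<bar>k\<bar>) / (1 + k\<^sup>2 * r\<^sup>2)"

lemma mj_pos: "0 < mj r k"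
  unfolding mj_def by (intro divide_pos_pos add_pos_nonneg mult_nonneg_nonneg) auto

lemma mj_nonneg [simp]: "0 \<le> mj r k"
  using mj_pos[of r k] by simp

lemma mj_le_cauchy: "mj r k \<le> 1 / (1 + k\<^sup>2 * r\<^sup>2)"
  unfolding mj_def by (intro divide_right_mono) auto

lemma mj_measurable [measurable]: "mj r \<in> borel_measurable borel"
  unfolding mj_def[abs_def] by measurable

lemma mj_antimono:
  assumes "0 \<le> r" "r \<le> s"
  shows "mj s k \<le> mj r k"
  unfolding mj_def using assms
  by (intro divide_left_mono add_left_mono mult_left_mono power_mono mult_pos_pos add_pos_nonneg) auto

text \<open>Since \<open>k = \<eta> + (k - \<eta>)\<close>, one of the two summands is at least half as large as \<open>k\<close>, so one of
  the two Cauchy factors can be traded for a factor at \<open>k\<close>.\<close>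

lemma mj_mult_le:
  "mj r \<eta> * mj r (k - \<eta>)
     \<le> 2 * mj r k * (1 / (1 + \<eta>\<^sup>2 * r\<^sup>2) + 1 / (1 + (k - \<eta>)\<^sup>2 * r\<^sup>2))"
proof -
  define P where "P = 1 + \<eta>\<^sup>2 * r\<^sup>2"
  define Q where "Q = 1 + (k - \<eta>)\<^sup>2 * r\<^sup>2"
  define Z where "Z = 1 + k\<^sup>2 * r\<^sup>2"
  have pos: "0 < P" "0 < Q" "0 < Z"
    by (auto simp: P_def Q_def Z_def intro!: add_pos_nonneg)
  have "2 * (P + Q) - Z = 3 + (2 * \<eta> - k)\<^sup>2 * r\<^sup>2"
    by (simp add: P_def Q_def Z_def power2_eq_square algebra_simps)
  moreover have "0 \<le> (2 * \<eta> - k)\<^sup>2 * r\<^sup>2" by simp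
  ultimately have "Z \<le> 2 * (P + Q)" by linarith
  then have "1 / (P * Q) \<le> 2 / Z * (1 / P + 1 / Q)"
    using pos by (simp add: field_simps)
  moreover have "exp (- \<bar>\<eta>\<bar>) * exp (- \<bar>k - \<eta>\<bar>) \<le> exp (- \<bar>k\<bar>)"
    unfolding exp_add[symmetric] by simp
  ultimately have "exp (- \<bar>\<eta>\<bar>) * exp (- \<bar>k - \<eta>\<bar>) * (1 / (P * Q))
      \<le> exp (- \<bar>k\<bar>) * (2 / Z * (1 / P + 1 / Q))"
    by (intro mult_mono) (use pos in auto)
  then show ?thesis
    by (simp add: mj_def P_def Q_def Z_def field_simps)
qed

definition symbol_bound :: "real \<Rightarrow> real \<Rightarrow> (real \<Rightarrow> real) \<Rightarrow> bool" where
  "symbol_bound K r g \<longleftrightarrow> g \<in> borel_measurable borel \<and> (\<forall>k. \<bar>g k\<bar> \<le> K * mj r k)"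

lemma symbol_boundD:
  assumes "symbol_bound K r g"
  shows "g \<in> borel_measurable borel" "\<bar>g k\<bar> \<le> K * mj r k"
  using assms by (auto simp: symbol_bound_def)

lemma symbol_bound_nonneg: "symbol_bound K r g \<Longrightarrow> 0 \<le> K"
  using mj_pos[of r 0] by (force simp: symbol_bound_def dest!: spec[of _ 0] intro: ccontr
      simp: mj_def)

lemma symbol_bound_mono: "symbol_bound K r g \<Longrightarrow> K \<le> L \<Longrightarrow> symbol_bound L r g"
  unfolding symbol_bound_def by (meson mult_right_mono mj_nonneg order_trans)

lemma integrable_le_cauchy:
  fixes g :: "real \<Rightarrow> 'a::{banach, second_countable_topology}"
  assumes "0 < r" "g \<in> borel_measurable borel" "\<And>k. norm (g k) \<le> K / (1 + k\<^sup>2 * r\<^sup>2)"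
  shows "integrable lborel g" "norm (integral\<^sup>L lborel g) \<le> K * pi / r"
proof -
  have i: "integrable lborel (\<lambda>k. K * (1 / (1 + k\<^sup>2 * r\<^sup>2)))"
    using integrable_cauchy[OF assms(1)] by (rule integrable_mult_right)
  show "integrable lborel g"
    by (rule Bochner_Integration.integrable_bound[OF i]) 
      (use assms(2,3) in \<open>auto intro!: AE_I2 order_trans[OF assms(3)] divide_right_mono
        simp: abs_of_nonneg add_nonneg_nonneg\<close>)
  then have "norm (integral\<^sup>L lborel g) \<le> integral\<^sup>L lborel (\<lambda>k. K * (1 / (1 + k\<^sup>2 * r\<^sup>2)))"
    by (intro order_trans[OF integral_norm_bound] integral_mono i integrable_norm)
      (use assms(3) in auto)
  also have "\<dots> = K * pi / r"
    unfolding integral_mult_right_zero integral_cauchy[OF assms(1)] by simp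
  finally show "norm (integral\<^sup>L lborel g) \<le> K * pi / r" .
qed

lemma symbol_bound_cauchy:
  assumes "symbol_bound K r g"
  shows "\<bar>g k\<bar> \<le> K / (1 + k\<^sup>2 * r\<^sup>2)"
proof -
  have "\<bar>g k\<bar> \<le> K * mj r k" using assms by (rule symbol_boundD)
  also have "\<dots> \<le> K * (1 / (1 + k\<^sup>2 * r\<^sup>2))"
    by (intro mult_left_mono mj_le_cauchy symbol_bound_nonneg[OF assms])
  finally show ?thesis by simp
qed

definition conv :: "(real \<Rightarrow> real) \<Rightarrow> (real \<Rightarrow> real) \<Rightarrow> real \<Rightarrow> real" where
  "conv g h k = integral\<^sup>L lborel (\<lambda>\<eta>. g \<eta> * h (k - \<eta>))"

lemma borel_measurable_conv [measurable]:
  assumes [measurable]: "g \<in> borel_measurable borel" "h \<in> borel_measurable borel"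
  shows "conv g h \<in> borel_measurable borel"
  unfolding conv_def[abs_def] by measurable

lemma integrable_conv:
  assumes "0 < r" "symbol_bound K r g" "symbol_bound L r h"
  shows "integrable lborel (\<lambda>\<eta>. g \<eta> * h (k - \<eta>))"
proof (rule integrable_le_cauchy(1)[OF assms(1), where K="K * L"])
  have [measurable]: "g \<in> borel_measurable borel" "h \<in> borel_measurable borel"
    using assms symbol_boundD by auto
  show "(\<lambda>\<eta>. g \<eta> * h (k - \<eta>)) \<in> borel_measurable borel" by measurable
  fix \<eta>
  have "\<bar>h (k - \<eta>)\<bar> \<le> L / (1 + (k - \<eta>)\<^sup>2 * r\<^sup>2)"
    using symbol_bound_cauchy[OF assms(3)] .
  also have "\<dots> \<le> L / 1"
    using symbol_bound_nonneg[OF assms(3)] by (intro divide_left_mono) (auto intro!: add_pos_nonneg)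
  finally have "\<bar>g \<eta>\<bar> * \<bar>h (k - \<eta>)\<bar> \<le> K / (1 + \<eta>\<^sup>2 * r\<^sup>2) * L"
    using symbol_bound_nonneg[OF assms(2)]
    by (intro mult_mono symbol_bound_cauchy[OF assms(2)]) auto
  then show "norm (g \<eta> * h (k - \<eta>)) \<le> K * L / (1 + \<eta>\<^sup>2 * r\<^sup>2)"
    by (simp add: abs_mult)
qed

lemma has_bochner_integral_cauchy_reflect:
  assumes "0 < r"
  shows "has_bochner_integral lborel (\<lambda>x::real. 1 / (1 + (k - x)\<^sup>2 * r\<^sup>2)) (pi / r)"
  using lborel_has_bochner_integral_real_affine_iff[of "-1" "\<lambda>x. 1 / (1 + x\<^sup>2 * r\<^sup>2)" "pi / r" k]
    has_bochner_integral_cauchy[OF assms] by simp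

text \<open>The gain \<open>1/r\<close> is the integral of the Cauchy factor that \<open>mj_mult_le\<close> leaves; \<open>13\<close> is an upper
  bound for \<open>4 * pi\<close>.\<close>

lemma symbol_bound_conv:
  assumes "0 < r" "symbol_bound K r g" "symbol_bound L r h"
  shows "symbol_bound (13 * K * L / r) r (conv g h)"
  unfolding symbol_bound_def
proof (intro conjI allI)
  have [measurable]: "g \<in> borel_measurable borel" "h \<in> borel_measurable borel"
    using assms symbol_boundD by auto
  show "conv g h \<in> borel_measurable borel" by measurable
  fix k
  have KL: "0 \<le> K" "0 \<le> L" using assms symbol_bound_nonneg by auto
  let ?c = "\<lambda>\<eta>. K * L * (2 * mj r k) * (1 / (1 + \<eta>\<^sup>2 * r\<^sup>2) + 1 / (1 + (k - \<eta>)\<^sup>2 * r\<^sup>2))"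
  have i: "has_bochner_integral lborel ?c (K * L * (2 * mj r k) * (pi / r + pi / r))"
    by (intro has_bochner_integral_mult_right has_bochner_integral_add
        has_bochner_integral_cauchy has_bochner_integral_cauchy_reflect assms)
  have "\<bar>conv g h k\<bar> \<le> integral\<^sup>L lborel ?c"
    unfolding conv_def real_norm_def[symmetric]
  proof (intro order_trans[OF integral_norm_bound] integral_mono integrable_norm)
    show "integrable lborel ?c" using i by (rule integrable.intros)
    show "integrable lborel (\<lambda>\<eta>. g \<eta> * h (k - \<eta>))" by (rule integrable_conv[OF assms])
    fix \<eta>
    have "norm (g \<eta> * h (k - \<eta>)) \<le> (K * mj r \<eta>) * (L * mj r (k - \<eta>))"
      unfolding real_norm_def abs_mult using KL
      by (intro mult_mono symbol_boundD(2)[OF assms(2)] symbol_boundD(2)[OF assms(3)]) auto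
    also have "\<dots> = K * L * (mj r \<eta> * mj r (k - \<eta>))" by simp
    also have "\<dots> \<le> ?c \<eta>"
      using mult_left_mono[OF mj_mult_le[of r \<eta> k], of "K * L"] KL by (simp add: mult.assoc)
    finally show "norm (g \<eta> * h (k - \<eta>)) \<le> ?c \<eta>" .
  qed
  also have "\<dots> = (4 * pi) * (K * L * mj r k / r)"
    using has_bochner_integral_integral_eq[OF i] by simp
  also have "\<dots> \<le> 13 * (K * L * mj r k / r)"
    using pi_less_4 pi_approx assms KL by (intro mult_right_mono) auto
  finally show "\<bar>conv g h k\<bar> \<le> 13 * K * L / r * mj r k" by simp
qed

lemma conv_diff_left:
  assumes "0 < r" "symbol_bound K r g" "symbol_bound K' r g'" "symbol_bound L r h"
  shows "conv g h k - conv g' h k = conv (\<lambda>\<eta>. g \<eta> - g' \<eta>) h k"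
  unfolding conv_def
  using integrable_conv[OF assms(1,2,4)] integrable_conv[OF assms(1,3,4)]
  by (subst Bochner_Integration.integral_diff[symmetric]) (auto simp: left_diff_distrib)

lemma conv_diff_right:
  assumes "0 < r" "symbol_bound K r g" "symbol_bound L r h" "symbol_bound L' r h'"
  shows "conv g h k - conv g h' k = conv g (\<lambda>\<eta>. h \<eta> - h' \<eta>) k"
  unfolding conv_def
  using integrable_conv[OF assms(1,2,3)] integrable_conv[OF assms(1,2,4)]
  by (subst Bochner_Integration.integral_diff[symmetric]) (auto simp: right_diff_distrib)

lemma symbol_bound_conv_diff:
  assumes r: "0 < r"
    and b: "symbol_bound K r g" "symbol_bound K r g'" "symbol_bound L r h" "symbol_bound L r h'"
    and d: "symbol_bound D r (\<lambda>\<eta>. g \<eta> - g' \<eta>)" "symbol_bound E r (\<lambda>\<eta>. h \<eta> - h' \<eta>)"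
  shows "symbol_bound (13 * (D * L + K * E) / r) r (\<lambda>k. conv g h k - conv g' h' k)"
proof -
  have "conv g h k - conv g' h' k
      = conv (\<lambda>\<eta>. g \<eta> - g' \<eta>) h k + conv g' (\<lambda>\<eta>. h \<eta> - h' \<eta>) k" for k
    using conv_diff_left[OF r b(1,2,3), of k] conv_diff_right[OF r b(2,3,4), of k] by simp
  moreover have "symbol_bound (13 * D * L / r + 13 * K * E / r) r
      (\<lambda>k. conv (\<lambda>\<eta>. g \<eta> - g' \<eta>) h k + conv g' (\<lambda>\<eta>. h \<eta> - h' \<eta>) k)"
    using symbol_bound_conv[OF r d(1) b(3)] symbol_bound_conv[OF r b(2) d(2)]
    unfolding symbol_bound_def
    by (auto simp: distrib_right intro!: order_trans[OF abs_triangle_ineq] add_mono)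
  ultimately show ?thesis
    by (simp add: add_divide_distrib distrib_left mult.assoc)
qed

text \<open>Used with \<open>s\<close> and \<open>s'\<close> equal to \<open>1\<close> for even and \<open>- 1\<close> for odd symbols.\<close>

lemma conv_even:
  assumes "\<And>k. g (- k) = s * g k" "\<And>k. h (- k) = s' * h k"
  shows "conv g h (- k) = s * s' * conv g h k"
proof -
  have "conv g h (- k) = integral\<^sup>L lborel (\<lambda>\<eta>. g (0 + - 1 * \<eta>) * h (- k - (0 + - 1 * \<eta>)))"
    unfolding conv_def by (subst lborel_integral_real_affine[where c="-1" and t=0]) auto
  also have "\<dots> = integral\<^sup>L lborel (\<lambda>\<eta>. (s * s') * (g \<eta> * h (k - \<eta>)))"
  proof (rule Bochner_Integration.integral_cong[OF refl])
    fix \<eta>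
    show "g (0 + - 1 * \<eta>) * h (- k - (0 + - 1 * \<eta>)) = (s * s') * (g \<eta> * h (k - \<eta>))"
      using assms(1)[of \<eta>] assms(2)[of "k - \<eta>"] by simp
  qed
  also have "\<dots> = s * s' * conv g h k"
    by (cases "s * s' = 0") (auto simp: conv_def)
  finally show ?thesis .
qed

section \<open>The Duhamel integrals of a single frequency\<close>

text \<open>Time integrals are estimated by exhibiting a primitive of a majorant.\<close>

lemma integral_abs_le_primitive:
  fixes g :: "real \<Rightarrow> real"
  assumes "a \<le> b" and g: "continuous_on {a..b} g"
    and le: "\<And>x. x \<in> {a..b} \<Longrightarrow> \<bar>g x\<bar> \<le> \<phi> x"
    and der: "\<And>x. x \<in> {a..b} \<Longrightarrow> (\<Phi> has_real_derivative \<phi> x) (at x within {a..b})"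
  shows "\<bar>integral {a..b} g\<bar> \<le> \<Phi> b - \<Phi> a"
proof -
  have "(\<phi> has_integral \<Phi> b - \<Phi> a) {a..b}"
    using der \<open>a \<le> b\<close> by (intro fundamental_theorem_of_calculus)
      (auto simp: has_real_derivative_iff_has_vector_derivative)
  moreover have "g integrable_on {a..b}"
    using g by (rule integrable_continuous_interval)
  ultimately have "norm (integral {a..b} g) \<le> integral {a..b} \<phi>"
    using le by (intro integral_norm_bound_integral) (auto intro: has_integral_integrable)
  with \<open>(\<phi> has_integral _) _\<close> show ?thesis by (simp add: integral_unique)
qed

text \<open>The parabolic length scale at time \<open>t\<close>.\<close>

definition rr :: "real \<Rightarrow> real" where
  "rr t = sqrt (1 + t / 2)"

lemma rr_square: "0 \<le> t \<Longrightarrow> (rr t)\<^sup>2 = 1 + t / 2"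
  by (simp add: rr_def)

lemma rr_ge_1: "0 \<le> t \<Longrightarrow> 1 \<le> rr t"
  by (simp add: rr_def)

lemma rr_pos: "0 \<le> t \<Longrightarrow> 0 < rr t"
  using rr_ge_1[of t] by simp

lemma rr_mono: "s \<le> t \<Longrightarrow> rr s \<le> rr t"
  by (simp add: rr_def)

lemma rr_has_derivative [derivative_intros]:
  assumes "0 \<le> t"
  shows "(rr has_real_derivative 1 / (4 * rr t)) (at t within S)"
  unfolding rr_def[abs_def] using assms
  by (auto intro!: derivative_eq_intros simp: field_simps)

lemma rr_measurable [measurable]: "rr \<in> borel_measurable borel"
  unfolding rr_def[abs_def] by measurable

text \<open>The majorants decay in time at most at half the rate of the linear flow, which leaves the other half
  for the convergence of Duhamel integrals. The factor \<open>1/2\<close> in \<open>rr\<close> is chosen for this purpose: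
  the logarithmic derivative of \<open>1 + k\<^sup>2 (1 + t/2)\<close> is at most
  \<open>k\<^sup>2 / (2 (1 + k\<^sup>2))\<close>, which \<open>square_le_lam\<close> bounds by \<open>lam k / 2\<close>.\<close>

lemma cauchy_growth:
  assumes "0 \<le> s" "s \<le> t"
  shows "1 + k\<^sup>2 * (rr t)\<^sup>2 \<le> exp (lam k * (t - s) / 2) * (1 + k\<^sup>2 * (rr s)\<^sup>2)"
proof -
  define D where "D = 1 + k\<^sup>2 * (1 + s / 2)"
  have "1 + k\<^sup>2 \<le> D" using assms by (simp add: D_def distrib_left)
  then have "lam k * (1 + k\<^sup>2) \<le> lam k * D" by (intro mult_left_mono) auto
  then have "k\<^sup>2 \<le> lam k * D" using square_le_lam[of k] by linarith
  then have "k\<^sup>2 * ((t - s) / 2) \<le> lam k * D * ((t - s) / 2)"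
    using assms by (intro mult_right_mono) auto
  then have "D + k\<^sup>2 * ((t - s) / 2) \<le> (1 + lam k * (t - s) / 2) * D"
    by (simp add: algebra_simps)
  also have "\<dots> \<le> exp (lam k * (t - s) / 2) * D"
    using \<open>1 + k\<^sup>2 \<le> D\<close> by (intro mult_right_mono exp_ge_add_one_self) (simp add: order_trans[OF _ \<open>1 + k\<^sup>2 \<le> D\<close>])
  finally have "D + k\<^sup>2 * ((t - s) / 2) \<le> exp (lam k * (t - s) / 2) * D" .
  moreover have "1 + k\<^sup>2 * (rr t)\<^sup>2 = D + k\<^sup>2 * ((t - s) / 2)"
    using assms by (simp add: rr_square D_def algebra_simps) (simp add: field_simps)
  moreover have "1 + k\<^sup>2 * (rr s)\<^sup>2 = D" using assms by (simp add: rr_square D_def)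
  ultimately show ?thesis by simp
qed

lemma mj_growth:
  assumes "0 \<le> s" "s \<le> t"
  shows "mj (rr s) k \<le> exp (lam k * (t - s) / 2) * mj (rr t) k"
proof -
  have p: "0 < 1 + k\<^sup>2 * (rr s)\<^sup>2" "0 < 1 + k\<^sup>2 * (rr t)\<^sup>2" by (auto intro!: add_pos_nonneg)
  have "exp (- \<bar>k\<bar>) * (1 + k\<^sup>2 * (rr t)\<^sup>2)
      \<le> exp (- \<bar>k\<bar>) * (exp (lam k * (t - s) / 2) * (1 + k\<^sup>2 * (rr s)\<^sup>2))"
    by (intro mult_left_mono cauchy_growth assms) auto
  then show ?thesis using p by (simp add: mj_def field_simps)
qed

text \<open>The size of the transform of \<open>N(u)\<close>: two convolutions and one derivative beyond \<open>u\<^sub>x\<close> each give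
  a factor \<open>1 / rr t\<close>. The power \<open>3\<close> makes it integrable in time.\<close>

definition wt :: "real \<Rightarrow> real \<Rightarrow> real" where
  "wt t k = mj (rr t) k / rr t ^ 3"

lemma wt_nonneg [simp]: "0 \<le> t \<Longrightarrow> 0 \<le> wt t k"
  using rr_pos[of t] by (simp add: wt_def)

lemma wt_antimono: "0 \<le> s \<Longrightarrow> s \<le> t \<Longrightarrow> wt t k \<le> wt s k"
  unfolding wt_def using rr_pos[of s] rr_mono[of s t]
  by (intro frac_le mj_antimono power_mono) auto

text \<open>Variation of constants for \<open>v'' - v' - k\<^sup>2 v = f\<close>: the decaying mode is driven by the past and
  the growing mode by the future, which yields a bounded solution.\<close>

definition fwd :: "real \<Rightarrow> (real \<Rightarrow> real) \<Rightarrow> real \<Rightarrow> real" where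
  "fwd l f t = (LINT s:{0..t}|lborel. exp (- l * (t - s)) * f s)"

definition bwd :: "real \<Rightarrow> (real \<Rightarrow> real) \<Rightarrow> real \<Rightarrow> real" where
  "bwd l f t = (LINT s:{t<..}|lborel. exp (- (1 + l) * (s - t)) * f s)"

lemma fwd_eq_integral:
  assumes "continuous_on {0..} f"
  shows "fwd l f t = integral {0..t} (\<lambda>s. exp (- l * (t - s)) * f s)"
proof -
  have "continuous_on {0..t} (\<lambda>s. exp (- l * (t - s)) * f s)"
    by (intro continuous_intros continuous_on_subset[OF assms]) auto
  then show ?thesis unfolding fwd_def
    by (intro set_borel_integral_eq_integral(2) borel_integrable_atLeastAtMost')
qed

lemma fwd_eq:
  assumes "continuous_on {0..} f"
  shows "fwd l f t = exp (- l * t) * integral {0..t} (\<lambda>s. exp (l * s) * f s)"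
proof -
  have "(\<lambda>s. exp (- l * (t - s)) * f s) = (\<lambda>s. exp (- l * t) * (exp (l * s) * f s))"
  proof
    fix s
    have "exp (- l * (t - s)) = exp (- l * t) * exp (l * s)"
      unfolding exp_add[symmetric] by (simp add: algebra_simps)
    then show "exp (- l * (t - s)) * f s = exp (- l * t) * (exp (l * s) * f s)"
      by simp
  qed
  then show ?thesis by (simp add: fwd_eq_integral[OF assms])
qed

lemma DERIV_integral_within:
  fixes g :: "real \<Rightarrow> real"
  assumes "continuous_on {0..} g" "0 \<le> t"
  shows "((\<lambda>t. integral {0..t} g) has_real_derivative g t) (at t within {0..})"
proof -
  have "((\<lambda>t. integral {0..t} g) has_real_derivative g t) (at t within {0..t+1})"
    unfolding has_real_derivative_iff_has_vector_derivative
    using assms by (intro integral_has_vector_derivative) (auto intro: continuous_on_subset)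
  moreover have "at t within {0..t+1} = at t within {0..}"
    by (rule at_within_nhd[of _ "{..<t+1}"]) auto
  ultimately show ?thesis by simp
qed

lemma fwd_has_derivative:
  assumes "continuous_on {0..} f" "0 \<le> t"
  shows "(fwd l f has_real_derivative f t - l * fwd l f t) (at t within {0..})"
proof -
  have *: "((\<lambda>t. integral {0..t} (\<lambda>s. exp (l * s) * f s)) has_real_derivative exp (l * t) * f t)
      (at t within {0..})"
    by (rule DERIV_integral_within) (auto intro!: continuous_intros assms)
  have e: "((\<lambda>t. exp (- l * t)) has_real_derivative - l * exp (- l * t)) (at t within {0..})"
    by (auto intro!: derivative_eq_intros)
  have "exp (- l * t) * exp (l * t) = 1" by (simp add: exp_minus)
  then have c: "exp (l * t) * f t * exp (- l * t) = f t"
    by (metis mult.assoc mult.commute mult_1_right)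
  show ?thesis
    unfolding fwd_eq[OF assms(1), abs_def]
    by (rule DERIV_mult[OF e *, THEN DERIV_cong]) (unfold c, simp)
qed

text \<open>The first bound uses that \<open>wt\<close> is integrable in time. The second one has to produce the
  additional decay \<open>1 / rr t\<close> at the price of a factor \<open>lam k\<close>: sources from the recent past carry
  this decay themselves, those from the remote past have been damped exponentially.\<close>

lemma fwd_abs_le:
  assumes f: "continuous_on {0..} f" and t: "0 \<le> t"
    and le: "\<And>s. 0 \<le> s \<Longrightarrow> s \<le> t \<Longrightarrow> \<bar>f s\<bar> \<le> \<delta> * wt s k"
    and \<delta>: "0 \<le> \<delta>"
  shows "\<bar>fwd (lam k) f t\<bar> \<le> 4 * \<delta> * mj (rr t) k"
    and "lam k * \<bar>fwd (lam k) f t\<bar> \<le> 3 * \<delta> * mj (rr t) k / rr t"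
proof -
  define l where "l = lam k"
  define g where "g s = exp (- l * (t - s)) * f s" for s
  define m where "m = \<delta> * mj (rr t) k"
  have m: "0 \<le> m" using \<delta> by (simp add: m_def)
  have l: "0 \<le> l" by (simp add: l_def)
  have fwd: "fwd l f t = integral {0..t} g"
    unfolding g_def by (rule fwd_eq_integral[OF f])
  have cont: "continuous_on {0..t} g" unfolding g_def
    by (intro continuous_intros continuous_on_subset[OF f]) auto
  have g_le: "\<bar>g s\<bar> \<le> m * exp (- (l * (t - s)) / 2) / rr s ^ 3" if "s \<in> {0..t}" for s
  proof -
    have "\<bar>g s\<bar> \<le> exp (- l * (t - s)) * (\<delta> * wt s k)"
      using le[of s] that by (simp add: g_def abs_mult)
    also have "\<dots> \<le> exp (- l * (t - s)) * (\<delta> * (exp (l * (t - s) / 2) * mj (rr t) k / rr s ^ 3))"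
      unfolding wt_def l_def using that \<delta> rr_pos[of s]
      by (intro mult_left_mono divide_right_mono mj_growth) auto
    also have "\<dots> = m * (exp (- l * (t - s)) * exp (l * (t - s) / 2)) / rr s ^ 3"
      by (simp add: m_def)
    also have "exp (- l * (t - s)) * exp (l * (t - s) / 2) = exp (- (l * (t - s)) / 2)"
      by (simp add: exp_add[symmetric] field_simps)
    finally show ?thesis .
  qed
  have "\<bar>integral {0..t} g\<bar> \<le> - (4 * m / rr t) - - (4 * m / rr 0)"
  proof (rule integral_abs_le_primitive[where \<phi> = "\<lambda>s. m / rr s ^ 3", OF t cont])
    fix s assume s: "s \<in> {0..t}"
    have "m * exp (- (l * (t - s)) / 2) \<le> m * 1" using s m l by (intro mult_left_mono) auto
    then show "\<bar>g s\<bar> \<le> m / rr s ^ 3"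
      using g_le[OF s] rr_pos[of s] s by (smt (verit) atLeastAtMost_iff divide_right_mono mult.right_neutral zero_le_power)
    show "((\<lambda>s. - (4 * m / rr s)) has_real_derivative m / rr s ^ 3) (at s within {0..t})"
      using s rr_pos[of s]
      by (auto intro!: derivative_eq_intros simp: field_simps power3_eq_cube power2_eq_square)
  qed
  also have "\<dots> \<le> 4 * m" using m rr_pos[OF t] by (simp add: rr_def)
  finally show "\<bar>fwd (lam k) f t\<bar> \<le> 4 * \<delta> * mj (rr t) k"
    using fwd by (simp add: l_def m_def)
  let ?\<Phi> = "\<lambda>s. m * (2 * exp (- (l * (t - s)) / 2) - 1 / (2 + s))"
  have "\<bar>integral {0..t} (\<lambda>s. rr t * l * g s)\<bar> \<le> ?\<Phi> t - ?\<Phi> 0"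
  proof (rule integral_abs_le_primitive[where \<phi> = "\<lambda>s. m * (l * exp (- (l * (t - s)) / 2) + 1 / (4 * rr s ^ 4))", OF t])
    show "continuous_on {0..t} (\<lambda>s. rr t * l * g s)" by (intro continuous_intros cont)
    fix s assume s: "s \<in> {0..t}"
    define \<tau> where "\<tau> = t - s"
    have \<tau>: "0 \<le> \<tau>" using s by (simp add: \<tau>_def)
    define r where "r = rr s"
    have r: "1 \<le> r" using s rr_ge_1 by (simp add: r_def)
    \<comment> \<open>The second summand grows linearly in the elapsed time; the exponential absorbs this growth.\<close>
    have "rr t \<le> r + \<tau> / (4 * r)"
    proof (rule power2_le_imp_le)
      have "(r + \<tau> / (4 * r))\<^sup>2 = r\<^sup>2 + \<tau> / 2 + (\<tau> / (4 * r))\<^sup>2"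
        using r by (simp add: power2_eq_square field_simps)
      moreover have "r\<^sup>2 + \<tau> / 2 = (rr t)\<^sup>2"
        using s t by (simp add: r_def rr_square \<tau>_def field_simps)
      ultimately show "(rr t)\<^sup>2 \<le> (r + \<tau> / (4 * r))\<^sup>2" by simp
    qed (use \<tau> r in auto)
    have x: "l * \<tau> * exp (- (l * \<tau>) / 2) \<le> 1"
    proof -
      have "l * \<tau> \<le> (1 + l * \<tau> / 4)\<^sup>2"
        using zero_le_power2[of "l * \<tau> / 4 - 1"] by (simp add: power2_eq_square algebra_simps)
      also have "\<dots> \<le> (exp (l * \<tau> / 4))\<^sup>2"
        using l \<tau> by (intro power_mono exp_ge_add_one_self) auto
      also have "\<dots> = exp (l * \<tau> / 2)" by (simp add: power2_eq_square exp_add[symmetric])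
      finally show ?thesis by (simp add: exp_minus field_simps)
    qed
    have "\<bar>rr t * l * g s\<bar> \<le> rr t * l * (m * exp (- (l * \<tau>) / 2) / r ^ 3)"
    proof -
      have "rr t * l * \<bar>g s\<bar> \<le> rr t * l * (m * exp (- (l * \<tau>) / 2) / r ^ 3)"
        unfolding r_def \<tau>_def using l rr_pos[OF t] by (intro mult_left_mono g_le[OF s]) auto
      then show ?thesis using l rr_pos[OF t] by (simp add: abs_mult)
    qed
    also have "\<dots> \<le> (r + \<tau> / (4 * r)) * l * (m * exp (- (l * \<tau>) / 2) / r ^ 3)"
      using \<open>rr t \<le> _\<close> l m r by (intro mult_right_mono) auto
    also have "\<dots> = m * (l * exp (- (l * \<tau>) / 2) / r\<^sup>2 + l * \<tau> * exp (- (l * \<tau>) / 2) / (4 * r ^ 4))"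
      using r by (simp add: field_simps power_numeral_reduce)
    also have "\<dots> \<le> m * (l * exp (- (l * \<tau>) / 2) / 1 + 1 / (4 * r ^ 4))"
      using x m l r by (intro mult_left_mono add_mono divide_left_mono divide_right_mono) auto
    finally show "\<bar>rr t * l * g s\<bar> \<le> m * (l * exp (- (l * (t - s)) / 2) + 1 / (4 * rr s ^ 4))"
      by (simp add: \<tau>_def r_def)
    have r4: "4 * rr s ^ 4 = (2 + s)\<^sup>2"
    proof -
      have "rr s ^ 4 = (rr s)\<^sup>2 * (rr s)\<^sup>2" unfolding power_add[symmetric] by simp
      also have "\<dots> = (1 + s / 2) * (1 + s / 2)" using s by (simp only: rr_square atLeastAtMost_iff)
      finally show ?thesis by (simp add: power2_eq_square field_simps)
    qed
    have 1: "((\<lambda>s. 2 * exp (- (l * (t - s)) / 2)) has_real_derivative l * exp (- (l * (t - s)) / 2))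
        (at s within {0..t})"
      by (auto intro!: derivative_eq_intros)
    have 2: "((\<lambda>s. 1 / (2 + s)) has_real_derivative - (1 / (2 + s)\<^sup>2)) (at s within {0..t})"
      using s by (auto intro!: derivative_eq_intros simp: power2_eq_square)
    show "(?\<Phi> has_real_derivative m * (l * exp (- (l * (t - s)) / 2) + 1 / (4 * rr s ^ 4)))
        (at s within {0..t})"
      unfolding r4 by (rule DERIV_cmult[OF DERIV_diff[OF 1 2], THEN DERIV_cong]) simp
  qed
  also have "\<dots> = m * (5/2 - (2 * exp (- (l * t) / 2) + 1 / (2 + t)))"
    by (simp add: algebra_simps)
  also have "\<dots> \<le> m * 3"
  proof (intro mult_left_mono m)
    have "0 \<le> 1 / (2 + t)" "0 \<le> 2 * exp (- (l * t) / 2)" using t by simp_all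
    then show "5/2 - (2 * exp (- (l * t) / 2) + 1 / (2 + t)) \<le> 3" by linarith
  qed
  finally have "rr t * (l * \<bar>fwd l f t\<bar>) \<le> m * 3"
    using l rr_pos[OF t] by (simp add: fwd abs_mult)
  then show "lam k * \<bar>fwd (lam k) f t\<bar> \<le> 3 * \<delta> * mj (rr t) k / rr t"
    using rr_pos[OF t] by (simp add: l_def m_def field_simps)
qed

lemma has_bochner_integral_exp_tail:
  fixes a t :: real
  assumes "0 < a"
  shows "has_bochner_integral lborel (\<lambda>s. indicator {t..} s * exp (- a * (s - t))) (1 / a)"
proof -
  have e: "(\<lambda>s. exp (- a * (s - t))) = (\<lambda>s. exp (a * t) * exp (- a * s))"
    by (auto simp: exp_add[symmetric] algebra_simps)
  have h: "((\<lambda>s. exp (- a * (s - t))) has_integral (exp (a * t) * (exp (- a * t) / a))) {t..}"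
    unfolding e by (intro has_integral_mult_right has_integral_exp_minus_to_infinity assms)
  have v: "exp (a * t) * (exp (- a * t) / a) = 1 / a"
    by (simp add: exp_minus)
  have "(\<lambda>s. exp (- a * (s - t))) absolutely_integrable_on {t..}"
    using h by (intro nonnegative_absolutely_integrable_1) auto
  moreover have "set_borel_measurable lborel {t..} (\<lambda>s. exp (- a * (s - t)))"
    unfolding set_borel_measurable_def by measurable
  ultimately have i: "set_integrable lborel {t..} (\<lambda>s. exp (- a * (s - t)))"
    unfolding set_integrable_def set_borel_measurable_def
    by (simp add: integrable_completion)
  show ?thesis
    using i set_borel_integral_eq_integral(2)[OF i] integral_unique[OF h] v
    by (simp add: has_bochner_integral_iff set_integrable_def set_lebesgue_integral_def)
qed

lemma bwd_integrable:
  assumes [measurable]: "f \<in> borel_measurable borel" and l: "0 \<le> l" and t: "0 \<le> t"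
    and le: "\<And>s. t \<le> s \<Longrightarrow> \<bar>f s\<bar> \<le> C"
  shows "set_integrable lborel {t<..} (\<lambda>s. exp (- (1 + l) * (s - t)) * f s)"
    and "\<bar>bwd l f t\<bar> \<le> C / (1 + l)"
proof -
  have C: "0 \<le> C" using le[of t] by simp
  have b: "has_bochner_integral lborel (\<lambda>s. C * (indicator {t..} s * exp (- (1 + l) * (s - t))))
      (C * (1 / (1 + l)))"
    using l by (intro has_bochner_integral_mult_right has_bochner_integral_exp_tail) auto
  note i = integrable.intros[OF b]
  have n: "norm (indicat_real {t<..} s *\<^sub>R (exp (- (1 + l) * (s - t)) * f s))
      \<le> C * (indicator {t..} s * exp (- (1 + l) * (s - t)))" for s
    using le[of s] by (auto simp: indicator_def abs_mult)
  show *: "set_integrable lborel {t<..} (\<lambda>s. exp (- (1 + l) * (s - t)) * f s)"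
    unfolding set_integrable_def
    by (rule Bochner_Integration.integrable_bound[OF i])
      (use n C in \<open>auto intro!: AE_I2 order_trans[OF n]\<close>)
  have "\<bar>bwd l f t\<bar> \<le> integral\<^sup>L lborel (\<lambda>s. C * (indicator {t..} s * exp (- (1 + l) * (s - t))))"
    unfolding bwd_def set_lebesgue_integral_def real_norm_def[symmetric]
    by (intro order_trans[OF integral_norm_bound] integral_mono integrable_norm i n)
      (use * in \<open>simp add: set_integrable_def\<close>)
  also have "\<dots> = C / (1 + l)" using has_bochner_integral_integral_eq[OF b] by simp
  finally show "\<bar>bwd l f t\<bar> \<le> C / (1 + l)" .
qed

text \<open>Writing the tail integral as a difference makes it accessible to the fundamental theorem of
  calculus.\<close>

lemma bwd_eq:
  assumes m: "f \<in> borel_measurable borel" and f: "continuous_on {0..} f"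
    and l: "0 \<le> l" and t: "0 \<le> t"
    and le: "\<And>s. 0 \<le> s \<Longrightarrow> \<bar>f s\<bar> \<le> C"
  shows "bwd l f t = exp ((1 + l) * t) *
    (bwd l f 0 - integral {0..t} (\<lambda>s. exp (- (1 + l) * s) * f s))"
proof -
  let ?g = "\<lambda>s. exp (- (1 + l) * s) * f s"
  have "continuous_on {0..t} ?g"
    by (intro continuous_intros continuous_on_subset[OF f]) auto
  then have i1: "set_integrable lborel {0<..t} ?g"
    by (rule set_integrable_subset[OF borel_integrable_atLeastAtMost']) auto
  have e: "(\<lambda>s. exp (- (1 + l) * (s - t)) * f s) = (\<lambda>s. exp ((1 + l) * t) * ?g s)"
  proof
    fix s
    have "exp (- (1 + l) * (s - t)) = exp ((1 + l) * t) * exp (- (1 + l) * s)"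
      unfolding exp_add[symmetric] by (simp add: algebra_simps)
    then show "exp (- (1 + l) * (s - t)) * f s = exp ((1 + l) * t) * ?g s"
      by (simp only: mult.assoc)
  qed
  have i2: "set_integrable lborel {t<..} ?g"
    by (rule set_integrable_subset[of _ "{0<..}"])
      (use bwd_integrable(1)[OF m l, of 0 C] le t in auto)
  have "bwd l f 0 = (LINT s:{0<..t} \<union> {t<..}|lborel. ?g s)"
    using t by (simp add: bwd_def ivl_disj_un)
  also have "\<dots> = (LINT s:{0<..t}|lborel. ?g s) + (LINT s:{t<..}|lborel. ?g s)"
    by (rule set_integral_Un[OF _ i1 i2]) auto
  also have "(LINT s:{0<..t}|lborel. ?g s) = integral {0<..t} ?g"
    by (rule set_borel_integral_eq_integral(2)[OF i1])
  also have "\<dots> = integral {0..t} ?g"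
    by (rule integral_spike_set; rule negligible_subset[of "{0}"]) auto
  finally have "(LINT s:{t<..}|lborel. ?g s) = bwd l f 0 - integral {0..t} ?g" by simp
  moreover have "bwd l f t = exp ((1 + l) * t) * (LINT s:{t<..}|lborel. ?g s)"
    unfolding bwd_def e by simp
  ultimately show ?thesis by simp
qed

lemma bwd_has_derivative:
  assumes m: "f \<in> borel_measurable borel" and f: "continuous_on {0..} f"
    and l: "0 \<le> l" and t: "0 \<le> t"
    and le: "\<And>s. 0 \<le> s \<Longrightarrow> \<bar>f s\<bar> \<le> C"
  shows "(bwd l f has_real_derivative (1 + l) * bwd l f t - f t) (at t within {0..})"
proof -
  let ?R = "\<lambda>t. exp ((1 + l) * t) * (bwd l f 0 - integral {0..t} (\<lambda>s. exp (- (1 + l) * s) * f s))"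
  have *: "((\<lambda>t. integral {0..t} (\<lambda>s. exp (- (1 + l) * s) * f s)) has_real_derivative
      exp (- (1 + l) * t) * f t) (at t within {0..})"
    by (rule DERIV_integral_within) (auto intro!: continuous_intros f t)
  have e: "((\<lambda>t. exp ((1 + l) * t)) has_real_derivative (1 + l) * exp ((1 + l) * t)) (at t within {0..})"
    by (auto intro!: derivative_eq_intros)
  have "exp ((1 + l) * t) * exp (- (1 + l) * t) = 1"
    unfolding exp_add[symmetric] by (simp add: algebra_simps)
  then have c: "exp (- (1 + l) * t) * f t * exp ((1 + l) * t) = f t"
    by (metis mult.assoc mult.commute mult_1_right)
  have eq: "?R t = bwd l f t" if "0 \<le> t" for t
    by (rule bwd_eq[OF m f l that, symmetric]) (rule le)
  have "(?R has_real_derivative (1 + l) * ?R t - f t) (at t within {0..})"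
    using DERIV_mult[OF e DERIV_diff[OF DERIV_const *]]
    by (rule DERIV_cong) (unfold diff_0 mult_minus_left[of "exp (- (1 + l) * t) * f t"] c, simp)
  then have "(?R has_real_derivative (1 + l) * bwd l f t - f t) (at t within {0..})"
    unfolding eq[OF t] .
  then show ?thesis
    by (rule has_field_derivative_transform_within[where d=1]) (use eq t in simp_all)
qed

section \<open>Time-dependent symbols\<close>

abbreviation jointly_measurable :: "(real \<Rightarrow> real \<Rightarrow> real) \<Rightarrow> bool" where
  "jointly_measurable g \<equiv> case_prod g \<in> borel_measurable (borel \<Otimes>\<^sub>M borel)"

text \<open>Continuity under the integral sign by dominated convergence.\<close>

lemma continuous_on_lebesgue_integral:
  fixes F :: "real \<Rightarrow> real \<Rightarrow> real"
  assumes m: "\<And>t. t \<in> S \<Longrightarrow> F t \<in> borel_measurable lborel"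
    and c: "\<And>x. continuous_on S (\<lambda>t. F t x)"
    and b: "\<And>t x. t \<in> S \<Longrightarrow> \<bar>F t x\<bar> \<le> w x"
    and w: "integrable lborel w"
  shows "continuous_on S (\<lambda>t. integral\<^sup>L lborel (F t))"
proof (rule continuous_on_sequentiallyI)
  fix u :: "nat \<Rightarrow> real" and a
  assume u: "\<forall>n. u n \<in> S" "a \<in> S" "u \<longlonglongrightarrow> a"
  show "(\<lambda>n. integral\<^sup>L lborel (F (u n))) \<longlonglongrightarrow> integral\<^sup>L lborel (F a)"
  proof (rule integral_dominated_convergence[where w=w])
    show "AE x in lborel. (\<lambda>n. F (u n) x) \<longlonglongrightarrow> F a x"
      using c u by (intro AE_I2) (auto simp: continuous_on_sequentially o_def)
  qed (use m u b w in auto)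
qed

definition symbol_family :: "real \<Rightarrow> (real \<Rightarrow> real \<Rightarrow> real) \<Rightarrow> bool" where
  "symbol_family K g \<longleftrightarrow>
     case_prod g \<in> borel_measurable (borel \<Otimes>\<^sub>M borel) \<and>
     (\<forall>k. continuous_on {0..} (g k)) \<and>
     (\<forall>t\<ge>0. symbol_bound K (rr t) (\<lambda>k. g k t))"

lemma symbol_familyD:
  assumes "symbol_family K g"
  shows "case_prod g \<in> borel_measurable (borel \<Otimes>\<^sub>M borel)"
    and "continuous_on {0..} (g k)"
    and "0 \<le> t \<Longrightarrow> symbol_bound K (rr t) (\<lambda>k. g k t)"
  using assms by (auto simp: symbol_family_def)

lemma symbol_family_cauchy:
  assumes "symbol_family K g" "0 \<le> t"
  shows "\<bar>g k t\<bar> \<le> K / (1 + k\<^sup>2 * 1\<^sup>2)" "\<bar>g k t\<bar> \<le> K"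
proof -
  have b: "symbol_bound K (rr t) (\<lambda>k. g k t)" using assms by (rule symbol_familyD)
  have "\<bar>g k t\<bar> \<le> K / (1 + k\<^sup>2 * (rr t)\<^sup>2)" using symbol_bound_cauchy[OF b] .
  also have "\<dots> \<le> K / (1 + k\<^sup>2 * 1\<^sup>2)"
    using rr_ge_1[OF assms(2)] symbol_bound_nonneg[OF b]
    by (intro divide_left_mono add_left_mono mult_left_mono power_mono mult_pos_pos add_pos_nonneg) auto
  finally show 1: "\<bar>g k t\<bar> \<le> K / (1 + k\<^sup>2 * 1\<^sup>2)" .
  also have "\<dots> \<le> K / 1"
    using symbol_bound_nonneg[OF b] by (intro divide_left_mono) (auto intro!: add_pos_nonneg)
  finally show "\<bar>g k t\<bar> \<le> K" by simp
qed

lemma symbol_family_conv: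
  assumes g: "symbol_family K g" and h: "symbol_family L h"
  shows "symbol_family (13 * K * L) (\<lambda>k t. conv (\<lambda>\<eta>. g \<eta> t) (\<lambda>\<eta>. h \<eta> t) k)"
  unfolding symbol_family_def
proof (intro conjI allI impI)
  have [measurable]: "case_prod g \<in> borel_measurable (borel \<Otimes>\<^sub>M borel)"
    "case_prod h \<in> borel_measurable (borel \<Otimes>\<^sub>M borel)"
    using g h by (auto dest: symbol_familyD(1))
  show "(\<lambda>(k, t). conv (\<lambda>\<eta>. g \<eta> t) (\<lambda>\<eta>. h \<eta> t) k) \<in> borel_measurable (borel \<Otimes>\<^sub>M borel)"
    unfolding conv_def by measurable
  show "continuous_on {0..} (\<lambda>t. conv (\<lambda>\<eta>. g \<eta> t) (\<lambda>\<eta>. h \<eta> t) k)" for k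
    unfolding conv_def
  proof (rule continuous_on_lebesgue_integral)
    show "integrable lborel (\<lambda>\<eta>. K * L * (1 / (1 + \<eta>\<^sup>2 * 1\<^sup>2)))"
      by (intro integrable_mult_right integrable_cauchy) auto
    show "continuous_on {0..} (\<lambda>t. g \<eta> t * h (k - \<eta>) t)" for \<eta>
      using symbol_familyD(2)[OF g] symbol_familyD(2)[OF h] by (intro continuous_intros)
    fix t \<eta> :: real assume "t \<in> {0..}"
    then have t: "0 \<le> t" by simp
    show "(\<lambda>\<eta>. g \<eta> t * h (k - \<eta>) t) \<in> borel_measurable lborel" by measurable
    have "\<bar>g \<eta> t * h (k - \<eta>) t\<bar> \<le> K / (1 + \<eta>\<^sup>2 * 1\<^sup>2) * L"
      unfolding abs_mult using symbol_family_cauchy(2)[OF g t, of 0]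
      by (intro mult_mono symbol_family_cauchy[OF g t] symbol_family_cauchy[OF h t])
       (auto intro!: divide_nonneg_pos add_pos_nonneg)
    then show "\<bar>g \<eta> t * h (k - \<eta>) t\<bar> \<le> K * L * (1 / (1 + \<eta>\<^sup>2 * 1\<^sup>2))" by simp
  qed
  fix t :: real assume t: "0 \<le> t"
  have KL: "0 \<le> 13 * K * L"
    using symbol_familyD(3)[OF g t] symbol_familyD(3)[OF h t] symbol_bound_nonneg by auto
  have "symbol_bound (13 * K * L / rr t) (rr t) (conv (\<lambda>\<eta>. g \<eta> t) (\<lambda>\<eta>. h \<eta> t))"
    by (intro symbol_bound_conv rr_pos symbol_familyD(3)[OF g] symbol_familyD(3)[OF h] t)
  then show "symbol_bound (13 * K * L) (rr t) (conv (\<lambda>\<eta>. g \<eta> t) (\<lambda>\<eta>. h \<eta> t))"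
    using rr_ge_1[OF t] KL
    by (elim symbol_bound_mono) (simp add: divide_le_eq mult_le_cancel_left1 mult_left_le)
qed

lemma symbol_family_cmult:
  assumes "symbol_family K g"
  shows "symbol_family (\<bar>c\<bar> * K) (\<lambda>k t. c * g k t)"
proof -
  have [measurable]: "case_prod g \<in> borel_measurable (borel \<Otimes>\<^sub>M borel)"
    using assms by (auto dest: symbol_familyD(1))
  have "(\<lambda>(k, t). c * g k t) \<in> borel_measurable (borel \<Otimes>\<^sub>M borel)" by measurable
  then show ?thesis using assms
    unfolding symbol_family_def symbol_bound_def
    by (auto simp: abs_mult mult.assoc intro!: mult_left_mono continuous_intros)
qed

lemma symbol_family_add:
  assumes "symbol_family K g" "symbol_family L h"
  shows "symbol_family (K + L) (\<lambda>k t. g k t + h k t)"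
proof -
  have [measurable]: "case_prod g \<in> borel_measurable (borel \<Otimes>\<^sub>M borel)"
     "case_prod h \<in> borel_measurable (borel \<Otimes>\<^sub>M borel)"
    using assms by (auto dest: symbol_familyD(1))
  have "(\<lambda>(k, t). g k t + h k t) \<in> borel_measurable (borel \<Otimes>\<^sub>M borel)" by measurable
  then show ?thesis using assms
    unfolding symbol_family_def symbol_bound_def
    by (auto simp: distrib_right intro!: continuous_intros order_trans[OF abs_triangle_ineq] add_mono)
qed

text \<open>Each cubic term of \<open>N(u)\<close> has a factor other than \<open>u\<^sub>x\<close>, whose bound carries an additional
  \<open>1/r\<close>; this factor is put first.\<close>

lemma symbol_bound_triple_diff:
  assumes r: "1 \<le> r"
    and g: "symbol_bound (K / r) r g" "symbol_bound (K / r) r g'"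
    and h: "symbol_bound K r h" "symbol_bound K r h'"
    and w: "symbol_bound K r w" "symbol_bound K r w'"
    and d: "symbol_bound (D / r) r (\<lambda>\<eta>. g \<eta> - g' \<eta>)" "symbol_bound D r (\<lambda>\<eta>. h \<eta> - h' \<eta>)"
      "symbol_bound D r (\<lambda>\<eta>. w \<eta> - w' \<eta>)"
  shows "symbol_bound (507 * K\<^sup>2 * D / r ^ 3) r (\<lambda>k. conv g (conv h w) k - conv g' (conv h' w') k)"
proof -
  have r0: "0 < r" using r by simp
  note 1 = symbol_bound_conv[OF r0 h(1) w(1)] symbol_bound_conv[OF r0 h(2) w(2)]
  note 2 = symbol_bound_conv_diff[OF r0 h w d(2,3)]
  have "13 * (D / r * (13 * K * K / r) + K / r * (13 * (D * K + K * D) / r)) / r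
      = 507 * K\<^sup>2 * D / r ^ 3"
    using r by (simp add: field_simps power2_eq_square power3_eq_cube)
  with symbol_bound_conv_diff[OF r0 g 1 d(1) 2] show ?thesis by simp
qed

lemma symbol_bound_triple:
  assumes r: "1 \<le> r"
    and "symbol_bound (K / r) r g" "symbol_bound K r h" "symbol_bound K r w"
  shows "symbol_bound (169 * K ^ 3 / r ^ 3) r (conv g (conv h w))"
proof -
  have r0: "0 < r" using r by simp
  have "13 * (K / r) * (13 * K * K / r) / r = 169 * K ^ 3 / r ^ 3"
    using r by (simp add: field_simps power3_eq_cube)
  with symbol_bound_conv[OF r0 assms(2) symbol_bound_conv[OF r0 assms(3,4)]]
  show ?thesis by simp
qed

section \<open>The nonlinear equation on the Fourier side\<close>

text \<open>Symbols of the Duhamel solution and of its time derivative. The denominator is the difference of the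
  two characteristic roots.\<close>

definition duh :: "(real \<Rightarrow> real \<Rightarrow> real) \<Rightarrow> real \<Rightarrow> real \<Rightarrow> real" where
  "duh f k t = - (fwd (lam k) (f k) t + bwd (lam k) (f k) t) / (1 + 2 * lam k)"

definition duh_t :: "(real \<Rightarrow> real \<Rightarrow> real) \<Rightarrow> real \<Rightarrow> real \<Rightarrow> real" where
  "duh_t f k t =
     (lam k * fwd (lam k) (f k) t - (1 + lam k) * bwd (lam k) (f k) t) / (1 + 2 * lam k)"

definition source_bound :: "real \<Rightarrow> (real \<Rightarrow> real \<Rightarrow> real) \<Rightarrow> bool" where
  "source_bound C f \<longleftrightarrow>
     case_prod f \<in> borel_measurable (borel \<Otimes>\<^sub>M borel) \<and>
     (\<forall>k. continuous_on {0..} (f k)) \<and>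
     (\<forall>k t. 0 \<le> t \<longrightarrow> \<bar>f k t\<bar> \<le> C * wt t k)"

lemma source_boundD:
  assumes "source_bound C f"
  shows "case_prod f \<in> borel_measurable (borel \<Otimes>\<^sub>M borel)"
    and "continuous_on {0..} (f k)"
    and "0 \<le> t \<Longrightarrow> \<bar>f k t\<bar> \<le> C * wt t k"
    and "f k \<in> borel_measurable borel"
    and "0 \<le> C"
proof -
  show m: "case_prod f \<in> borel_measurable (borel \<Otimes>\<^sub>M borel)"
    and "continuous_on {0..} (f k)"
    and b: "0 \<le> t \<Longrightarrow> \<bar>f k t\<bar> \<le> C * wt t k" for k t
    using assms by (auto simp: source_bound_def)
  show "f k \<in> borel_measurable borel"
    using measurable_Pair_compose_split[OF m measurable_const measurable_ident, of k] by simp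
  have "0 \<le> C * wt 0 0" using b[of 0 0] by linarith
  moreover have "wt 0 0 = 1" by (simp add: wt_def mj_def rr_def)
  ultimately show "0 \<le> C" by simp
qed

lemma wt_le:
  assumes "0 \<le> t"
  shows "wt t k \<le> mj (rr t) k" "wt t k \<le> mj (rr t) k / rr t" "wt t k \<le> 1"
proof -
  have r: "1 \<le> rr t" using assms by (rule rr_ge_1)
  have "rr t ^ 1 \<le> rr t ^ 3" by (intro power_increasing r) auto
  then show 1: "wt t k \<le> mj (rr t) k / rr t"
    unfolding wt_def using r by (intro divide_left_mono) auto
  also have "\<dots> \<le> mj (rr t) k / 1" using r by (intro divide_left_mono) auto
  finally show 2: "wt t k \<le> mj (rr t) k" by simp
  also have "\<dots> \<le> 1 / (1 + k\<^sup>2 * (rr t)\<^sup>2)" by (rule mj_le_cauchy)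
  also have "\<dots> \<le> 1" by (simp add: divide_le_eq_1 add_pos_nonneg)
  finally show "wt t k \<le> 1" .
qed

lemma source_bound_le:
  assumes "source_bound C f" "0 \<le> t"
  shows "\<bar>f k t\<bar> \<le> C"
  using source_boundD(3)[OF assms, of k] wt_le(3)[OF assms(2), of k] source_boundD(5)[OF assms(1)]
  by (meson mult_left_le order_trans)

lemma bwd_abs_le:
  assumes "source_bound C f" "0 \<le> t"
  shows "\<bar>bwd (lam k) (f k) t\<bar> \<le> C * wt t k / (1 + lam k)"
proof (rule bwd_integrable(2)[OF source_boundD(4)[OF assms(1)] lam_nonneg assms(2)])
  fix s assume "t \<le> s"
  then have "\<bar>f k s\<bar> \<le> C * wt s k" using assms by (intro source_boundD(3)[OF assms(1)]) auto
  also have "\<dots> \<le> C * wt t k"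
    using assms \<open>t \<le> s\<close> by (intro mult_left_mono wt_antimono source_boundD(5)[OF assms(1)])
  finally show "\<bar>f k s\<bar> \<le> C * wt t k" .
qed

lemma duh_measurable [measurable]:
  assumes [measurable]: "case_prod f \<in> borel_measurable (borel \<Otimes>\<^sub>M borel)"
  shows "case_prod (duh f) \<in> borel_measurable (borel \<Otimes>\<^sub>M borel)"
    and "case_prod (duh_t f) \<in> borel_measurable (borel \<Otimes>\<^sub>M borel)"
proof -
  have i: "indicat_real {0..t} s = (if 0 \<le> s \<and> s \<le> t then 1 else 0)"
    "indicat_real {t<..} s = (if t < s then 1 else 0)" for s t
    by (auto simp: indicator_def)
  have [measurable]: "(\<lambda>p. fwd (lam (fst p)) (f (fst p)) (snd p)) \<in> borel_measurable (borel \<Otimes>\<^sub>M borel)"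
    unfolding fwd_def set_lebesgue_integral_def i by measurable
  have [measurable]: "(\<lambda>p. bwd (lam (fst p)) (f (fst p)) (snd p)) \<in> borel_measurable (borel \<Otimes>\<^sub>M borel)"
    unfolding bwd_def set_lebesgue_integral_def i by measurable
  show "case_prod (duh f) \<in> borel_measurable (borel \<Otimes>\<^sub>M borel)"
    unfolding duh_def[abs_def] case_prod_beta by measurable
  show "case_prod (duh_t f) \<in> borel_measurable (borel \<Otimes>\<^sub>M borel)"
    unfolding duh_t_def[abs_def] case_prod_beta by measurable
qed

lemma duh_has_derivative:
  assumes f: "source_bound C f" and t: "0 \<le> t"
  shows "(duh f k has_real_derivative duh_t f k t) (at t within {0..})"
    and "(duh_t f k has_real_derivative duh_t f k t + k\<^sup>2 * duh f k t + f k t) (at t within {0..})"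
proof -
  let ?l = "lam k"
  have w: "1 + 2 * ?l \<noteq> 0" using lam_nonneg[of k] by linarith
  note A = fwd_has_derivative[OF source_boundD(2)[OF f] t, of ?l k]
  have B: "(bwd ?l (f k) has_real_derivative (1 + ?l) * bwd ?l (f k) t - f k t) (at t within {0..})"
    by (rule bwd_has_derivative[OF source_boundD(4,2)[OF f] lam_nonneg t])
      (rule source_bound_le[OF f])
  show "(duh f k has_real_derivative duh_t f k t) (at t within {0..})"
    unfolding duh_def[abs_def] duh_t_def
    by (rule DERIV_cdivide[OF DERIV_minus[OF DERIV_add[OF A B]], THEN DERIV_cong])
      (intro arg_cong2[where f="(/)"], simp_all)
  have e: "(?l * (f k t - ?l * a) - (1 + ?l) * ((1 + ?l) * b - f k t)) / (1 + 2 * ?l)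
    = (?l * a - (1 + ?l) * b) / (1 + 2 * ?l) + k\<^sup>2 * (- (a + b) / (1 + 2 * ?l)) + f k t" for a b
  proof -
    have "?l * (f k t - ?l * a) - (1 + ?l) * ((1 + ?l) * b - f k t)
      = (?l * a - (1 + ?l) * b) + ?l * (1 + ?l) * (- (a + b)) + f k t * (1 + 2 * ?l)"
      by (simp add: algebra_simps)
    then show ?thesis
      unfolding lam_quadratic[symmetric] using w by (simp only: add_divide_distrib) simp
  qed
  show "(duh_t f k has_real_derivative duh_t f k t + k\<^sup>2 * duh f k t + f k t) (at t within {0..})"
    unfolding duh_def[abs_def] duh_t_def[abs_def]
    by (rule DERIV_cdivide[OF DERIV_diff[OF DERIV_cmult[OF A] DERIV_cmult[OF B]], THEN DERIV_cong])
      (rule e)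
qed

text \<open>Ellipticity, frequency by frequency: \<open>\<bar>k\<bar>\<close> is at most half the denominator \<open>1 + 2 * lam k\<close>, and
  \<open>k\<^sup>2 = lam k * (1 + lam k)\<close> is matched by \<open>fwd_abs_le\<close> on the past and by the factor
  \<open>1 / (1 + lam k)\<close> on the future.\<close>

lemma duh_bounds:
  fixes k t C :: real
  assumes f: "source_bound C f" and t: "0 \<le> t"
  defines "M \<equiv> C * mj (rr t) k"
  shows "\<bar>duh f k t\<bar> \<le> 5 * M"
    and "\<bar>k * duh f k t\<bar> \<le> 3 * M"
    and "\<bar>k\<^sup>2 * duh f k t\<bar> \<le> 4 * M / rr t"
    and "\<bar>duh_t f k t\<bar> \<le> 4 * M / rr t"
    and "\<bar>k * duh_t f k t\<bar> \<le> 2 * M / rr t"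
proof -
  define l where "l = lam k"
  define A where "A = fwd l (f k) t"
  define B where "B = bwd l (f k) t"
  define w where "w = 1 + 2 * l"
  have l: "0 \<le> l" by (simp add: l_def)
  have w: "1 \<le> w" using l by (simp add: w_def)
  have C: "0 \<le> C" using f by (rule source_boundD)
  have M: "0 \<le> M" using C by (simp add: M_def)
  have r: "1 \<le> rr t" using t by (rule rr_ge_1)
  have A1: "\<bar>A\<bar> \<le> 4 * M" and A2: "l * \<bar>A\<bar> \<le> 3 * M / rr t"
    using fwd_abs_le[OF source_boundD(2)[OF f] t source_boundD(3)[OF f] C, where k=k]
    by (auto simp: A_def l_def M_def mult.assoc)
  have Cw: "C * wt t k \<le> M" "C * wt t k \<le> M / rr t"
    using mult_left_mono[OF wt_le(1)[OF t] C] mult_left_mono[OF wt_le(2)[OF t] C]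
    by (auto simp: M_def)
  have B0: "(1 + l) * \<bar>B\<bar> \<le> C * wt t k"
  proof -
    have "0 < 1 + l" using l by simp
    then show ?thesis
      using bwd_abs_le[OF f t, of k] unfolding l_def[symmetric] B_def[symmetric]
      by (simp add: pos_le_divide_eq mult.commute)
  qed
  have "\<bar>B\<bar> \<le> (1 + l) * \<bar>B\<bar>" using l by (simp add: distrib_right)
  then have B1: "\<bar>B\<bar> \<le> M" and B2: "(1 + l) * \<bar>B\<bar> \<le> M / rr t" and B3: "\<bar>B\<bar> \<le> M / rr t"
    using B0 Cw by linarith+
  have x1: "\<bar>k\<bar> \<le> w / 2" using abs_le_lam[of k] by (simp add: w_def l_def)
  have x2: "k\<^sup>2 = l * (1 + l)" by (simp add: l_def lam_quadratic)
  have duh: "duh f k t = - ((A + B) / w)" "duh_t f k t = (l * A - (1 + l) * B) / w"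
    by (simp_all add: duh_def duh_t_def A_def B_def w_def l_def minus_divide_left)
  have AB: "\<bar>A + B\<bar> \<le> 5 * M" using A1 B1 by linarith
  have div: "\<bar>x / w\<bar> \<le> \<bar>x\<bar>" for x
    using w by (simp add: abs_divide divide_le_eq mult_le_cancel_left1)
  show "\<bar>duh f k t\<bar> \<le> 5 * M" using div[of "A + B"] AB by (simp add: duh)
  have "\<bar>k\<bar> * \<bar>A + B\<bar> \<le> w / 2 * (5 * M)" by (intro mult_mono x1 AB) (use w in auto)
  then have "\<bar>k * duh f k t\<bar> \<le> 5 / 2 * M"
    using w by (simp add: duh abs_mult abs_divide divide_le_eq mult.commute mult.left_commute)
  then show "\<bar>k * duh f k t\<bar> \<le> 3 * M" using M by linarith
  have "\<bar>k\<^sup>2 * (A + B)\<bar> \<le> (1 + l) * (l * \<bar>A\<bar>) + l * ((1 + l) * \<bar>B\<bar>)"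
  proof -
    have "\<bar>k\<^sup>2 * (A + B)\<bar> \<le> l * (1 + l) * (\<bar>A\<bar> + \<bar>B\<bar>)"
      unfolding x2 abs_mult using l by (intro mult_mono) auto
    then show ?thesis by (simp add: algebra_simps)
  qed
  also have "\<dots> \<le> w * (3 * M / rr t) + w * (M / rr t)"
    using l M r by (intro add_mono mult_mono A2 B2) (auto simp: w_def)
  also have "\<dots> = w * (4 * M / rr t)" by (simp add: algebra_simps add_divide_distrib[symmetric])
  finally show "\<bar>k\<^sup>2 * duh f k t\<bar> \<le> 4 * M / rr t"
    using w by (simp add: duh abs_mult abs_divide divide_le_eq mult.commute)
  have t1: "\<bar>l * A - (1 + l) * B\<bar> \<le> 4 * M / rr t"
  proof -
    have "\<bar>l * A - (1 + l) * B\<bar> \<le> l * \<bar>A\<bar> + (1 + l) * \<bar>B\<bar>"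
      using l by (intro order_trans[OF abs_triangle_ineq4]) (simp add: abs_mult)
    also have "\<dots> \<le> 3 * M / rr t + M / rr t" by (intro add_mono A2 B2)
    finally show ?thesis by (simp add: add_divide_distrib[symmetric])
  qed
  then show "\<bar>duh_t f k t\<bar> \<le> 4 * M / rr t"
    using div[of "l * A - (1 + l) * B"] by (simp add: duh)
  have "\<bar>k\<bar> * \<bar>l * A - (1 + l) * B\<bar> \<le> w / 2 * (4 * M / rr t)"
    by (intro mult_mono x1 t1) (use w in auto)
  then show "\<bar>k * duh_t f k t\<bar> \<le> 2 * M / rr t"
    using w by (simp add: duh abs_mult abs_divide divide_le_eq mult.commute mult.left_commute)
qed

lemma duh_diff:
  assumes f: "source_bound C f" and g: "source_bound C' g" and t: "0 \<le> t"
  shows "duh f k t - duh g k t = duh (\<lambda>k t. f k t - g k t) k t"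
    and "duh_t f k t - duh_t g k t = duh_t (\<lambda>k t. f k t - g k t) k t"
proof -
  let ?l = "lam k"
  have i: "(\<lambda>s. exp (- ?l * (t - s)) * f k s) integrable_on {0..t}" if f: "source_bound C f" for f C
    by (intro integrable_continuous_interval continuous_intros
        continuous_on_subset[OF source_boundD(2)[OF f]]) auto
  have c: "continuous_on {0..} (\<lambda>t. f k t - g k t)"
    by (intro continuous_intros source_boundD(2)[OF f] source_boundD(2)[OF g])
  have 1: "fwd ?l (f k) t - fwd ?l (g k) t = fwd ?l (\<lambda>t. f k t - g k t) t"
    unfolding fwd_eq_integral[OF source_boundD(2)[OF f]] fwd_eq_integral[OF source_boundD(2)[OF g]]
      fwd_eq_integral[OF c]
    using i[OF f] i[OF g] by (simp add: Henstock_Kurzweil_Integration.integral_diff right_diff_distrib)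
  have j: "set_integrable lborel {t<..} (\<lambda>s. exp (- (1 + ?l) * (s - t)) * f k s)"
    if f: "source_bound C f" for f C
    by (rule bwd_integrable(1)[OF source_boundD(4)[OF f] lam_nonneg t source_bound_le[OF f]])
      (use t in auto)
  have 2: "bwd ?l (f k) t - bwd ?l (g k) t = bwd ?l (\<lambda>t. f k t - g k t) t"
    unfolding bwd_def using set_integral_diff(2)[OF j[OF f] j[OF g]]
    by (simp add: right_diff_distrib)
  show "duh f k t - duh g k t = duh (\<lambda>k t. f k t - g k t) k t"
    unfolding duh_def 1[symmetric] 2[symmetric] diff_divide_distrib[symmetric]
    by (simp add: algebra_simps)
  show "duh_t f k t - duh_t g k t = duh_t (\<lambda>k t. f k t - g k t) k t"
    unfolding duh_t_def 1[symmetric] 2[symmetric] diff_divide_distrib[symmetric]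
    by (simp add: algebra_simps)
qed

text \<open>The function \<open>\<alpha>\<close> is \<open>k\<close> times the transform of the boundary datum of the linear solution. It is
  required to be bounded near \<open>0\<close>, so the transform of the datum itself may be as singular as
  \<open>1/\<bar>k\<bar>\<close>. Oddness of \<open>\<alpha>\<close> makes the datum real and even.\<close>

locale profile =
  fixes \<alpha> :: "real \<Rightarrow> real" and \<epsilon> :: real
  assumes profile_measurable [measurable]: "\<alpha> \<in> borel_measurable borel"
    and profile_odd: "\<alpha> (- k) = - \<alpha> k"
    and profile_bound: "\<bar>\<alpha> k\<bar> \<le> \<epsilon> * (exp (- \<bar>k\<bar>) / (1 + k\<^sup>2)\<^sup>2)"
    and profile_small: "0 \<le> \<epsilon>" "\<epsilon> \<le> 1 / 10000"
begin

text \<open>Up to powers of the imaginary unit, \<open>sx\<close>, \<open>st\<close> and \<open>stt\<close> are the transforms of \<open>u\<^sub>x\<close>,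
  \<open>u\<^sub>t\<close> and \<open>u\<^sub>t\<^sub>t\<close>, where \<open>u\<close> is the linear solution with datum \<open>\<alpha>\<close> plus the Duhamel solution
  with source \<open>f\<close>. They stay bounded at \<open>k = 0\<close>, unlike the transform of \<open>u\<close>.\<close>

definition sx :: "(real \<Rightarrow> real \<Rightarrow> real) \<Rightarrow> real \<Rightarrow> real \<Rightarrow> real" where
  "sx f k t = \<alpha> k * exp (- lam k * t) + k * duh f k t"

definition st :: "(real \<Rightarrow> real \<Rightarrow> real) \<Rightarrow> real \<Rightarrow> real \<Rightarrow> real" where
  "st f k t = - (lam k / k) * \<alpha> k * exp (- lam k * t) + duh_t f k t"

definition stt :: "(real \<Rightarrow> real \<Rightarrow> real) \<Rightarrow> real \<Rightarrow> real \<Rightarrow> real" where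
  "stt f k t = st f k t + k * sx f k t + f k t"

text \<open>The transform of \<open>N(u)\<close>. The signs differ from those in \<open>N(u)\<close> because \<open>u\<^sub>x\<close>, \<open>u\<^sub>x\<^sub>t\<close> have the
  transforms \<open>\<i> sx\<close>, \<open>\<i> k st\<close>, and \<open>u\<^sub>x\<^sub>x\<close> has the transform \<open>- k sx\<close>.\<close>

definition rhs :: "(real \<Rightarrow> real \<Rightarrow> real) \<Rightarrow> real \<Rightarrow> real \<Rightarrow> real" where
  "rhs f k t =
    (let a = (\<lambda>k. sx f k t); b = (\<lambda>k. st f k t); d = (\<lambda>k. stt f k t)
     in conv b (conv b b) k - conv b (conv a a) k + conv b (conv b (\<lambda>k. k * a k)) k
        - 2 * conv b (conv a (\<lambda>k. k * b k)) k + conv d (conv a a) k)"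

text \<open>The second Cauchy factor in the bound on \<open>\<alpha>\<close> pays for the multiplication by \<open>k\<close>, which must gain
  \<open>1 / rr t\<close>.\<close>

lemma linear_decay:
  assumes t: "0 \<le> t"
  shows "\<bar>\<alpha> k * exp (- lam k * t)\<bar> \<le> \<epsilon> * mj (rr t) k"
    and "\<bar>k * (\<alpha> k * exp (- lam k * t))\<bar> \<le> \<epsilon> * mj (rr t) k / rr t"
proof -
  define P where "P = 1 + k\<^sup>2"
  define Q where "Q = 1 + k\<^sup>2 * (rr t)\<^sup>2"
  define E where "E = exp (lam k * t / 2)"
  define e where "e = exp (- \<bar>k\<bar>)"
  have r: "1 \<le> rr t" using t by (rule rr_ge_1)
  have P: "0 < P" and Q: "1 \<le> Q" and E: "0 < E" and e: "0 < e"
    by (simp_all add: P_def Q_def E_def e_def add_pos_nonneg)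
  have "Q \<le> E * P" using cauchy_growth[of 0 t k] t by (simp add: P_def Q_def E_def rr_def)
  then have "Q\<^sup>2 \<le> (E * P)\<^sup>2" using Q by (intro power_mono) auto
  then have 1: "1 / (P\<^sup>2 * E\<^sup>2) \<le> 1 / Q\<^sup>2"
    using P Q E by (intro divide_left_mono) (auto simp: power_mult_distrib mult.commute)
  have E2: "exp (- lam k * t) = 1 / E\<^sup>2"
  proof -
    have "E\<^sup>2 = exp (lam k * t)" by (simp add: E_def power2_eq_square exp_add[symmetric])
    then show ?thesis by (simp add: exp_minus inverse_eq_divide)
  qed
  have m: "mj (rr t) k = e / Q" by (simp add: mj_def Q_def e_def)
  have "\<bar>\<alpha> k * exp (- lam k * t)\<bar> \<le> \<epsilon> * (e / P\<^sup>2) * (1 / E\<^sup>2)"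
    using profile_bound[of k] unfolding abs_mult E2 P_def e_def by (intro mult_mono) auto
  also have "\<dots> = \<epsilon> * e * (1 / (P\<^sup>2 * E\<^sup>2))" by simp
  also have "\<dots> \<le> \<epsilon> * e * (1 / Q\<^sup>2)" using profile_small e by (intro mult_left_mono 1) auto
  also have "\<dots> = \<epsilon> * mj (rr t) k * (1 / Q)" by (simp add: m power2_eq_square)
  finally have *: "\<bar>\<alpha> k * exp (- lam k * t)\<bar> \<le> \<epsilon> * mj (rr t) k * (1 / Q)" .
  also have "\<dots> \<le> \<epsilon> * mj (rr t) k * 1"
    using Q profile_small by (intro mult_left_mono) auto
  finally show "\<bar>\<alpha> k * exp (- lam k * t)\<bar> \<le> \<epsilon> * mj (rr t) k" by simp
  have x: "\<bar>k\<bar> * (1 / Q) \<le> 1 / rr t"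
  proof -
    have "0 \<le> (\<bar>k\<bar> * rr t - 1)\<^sup>2 + \<bar>k\<bar> * rr t" using r by (intro add_nonneg_nonneg) auto
    then have "\<bar>k\<bar> * rr t \<le> Q" by (simp add: Q_def power2_eq_square algebra_simps)
    then show ?thesis using Q r by (simp add: field_simps)
  qed
  have "\<bar>k * (\<alpha> k * exp (- lam k * t))\<bar> \<le> \<bar>k\<bar> * (\<epsilon> * mj (rr t) k * (1 / Q))"
    unfolding abs_mult[of k] by (intro mult_left_mono *) auto
  also have "\<dots> = \<epsilon> * mj (rr t) k * (\<bar>k\<bar> * (1 / Q))" by simp
  also have "\<dots> \<le> \<epsilon> * mj (rr t) k * (1 / rr t)"
    using profile_small by (intro mult_left_mono x) auto
  finally show "\<bar>k * (\<alpha> k * exp (- lam k * t))\<bar> \<le> \<epsilon> * mj (rr t) k / rr t" by simp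
qed

lemma linear_decay_t:
  assumes t: "0 \<le> t"
  shows "\<bar>lam k / k * \<alpha> k * exp (- lam k * t)\<bar> \<le> \<epsilon> * mj (rr t) k / rr t"
    and "\<bar>k * (lam k / k * \<alpha> k * exp (- lam k * t))\<bar> \<le> \<epsilon> * mj (rr t) k / rr t"
proof -
  let ?x = "\<alpha> k * exp (- lam k * t)"
  have 1: "\<bar>lam k / k\<bar> \<le> \<bar>k\<bar>"
  proof (cases "k = 0")
    case False
    then show ?thesis using lam_le_square[of k]
      by (simp add: abs_divide divide_le_eq power2_eq_square abs_mult[symmetric])
  qed auto
  have 2: "\<bar>k * (lam k / k)\<bar> \<le> \<bar>k\<bar>" using lam_le_abs[of k] by (cases "k = 0") auto
  have "\<bar>lam k / k * \<alpha> k * exp (- lam k * t)\<bar> = \<bar>lam k / k\<bar> * \<bar>?x\<bar>" by (simp add: abs_mult)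
  also have "\<dots> \<le> \<bar>k\<bar> * \<bar>?x\<bar>" by (intro mult_right_mono 1) auto
  also have "\<dots> = \<bar>k * ?x\<bar>" by (simp add: abs_mult)
  also have "\<dots> \<le> \<epsilon> * mj (rr t) k / rr t" by (rule linear_decay(2)[OF t])
  finally show "\<bar>lam k / k * \<alpha> k * exp (- lam k * t)\<bar> \<le> \<epsilon> * mj (rr t) k / rr t" .
  have "\<bar>k * (lam k / k * \<alpha> k * exp (- lam k * t))\<bar> = \<bar>k * (lam k / k)\<bar> * \<bar>?x\<bar>"
    by (simp add: abs_mult)
  also have "\<dots> \<le> \<bar>k\<bar> * \<bar>?x\<bar>" by (intro mult_right_mono 2) auto
  also have "\<dots> = \<bar>k * ?x\<bar>" by (simp add: abs_mult)
  also have "\<dots> \<le> \<epsilon> * mj (rr t) k / rr t" by (rule linear_decay(2)[OF t])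
  finally show "\<bar>k * (lam k / k * \<alpha> k * exp (- lam k * t))\<bar> \<le> \<epsilon> * mj (rr t) k / rr t" .
qed

lemma state_measurable [measurable]:
  assumes [measurable]: "case_prod f \<in> borel_measurable (borel \<Otimes>\<^sub>M borel)"
  shows "case_prod (sx f) \<in> borel_measurable (borel \<Otimes>\<^sub>M borel)"
    and "case_prod (st f) \<in> borel_measurable (borel \<Otimes>\<^sub>M borel)"
    and "case_prod (stt f) \<in> borel_measurable (borel \<Otimes>\<^sub>M borel)"
proof -
  note duh_measurable[OF assms, measurable]
  show 1[measurable]: "case_prod (sx f) \<in> borel_measurable (borel \<Otimes>\<^sub>M borel)"
    unfolding sx_def[abs_def] by measurable
  show 2[measurable]: "case_prod (st f) \<in> borel_measurable (borel \<Otimes>\<^sub>M borel)"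
    unfolding st_def[abs_def] by measurable
  show "case_prod (stt f) \<in> borel_measurable (borel \<Otimes>\<^sub>M borel)"
    unfolding stt_def[abs_def] by measurable
qed

lemma measurable_at:
  assumes m: "case_prod f \<in> borel_measurable (borel \<Otimes>\<^sub>M borel)"
  shows "(\<lambda>k. f k (t::real)) \<in> borel_measurable (borel :: real measure)"
  using measurable_Pair_compose_split[OF m measurable_ident measurable_const, of t] by simp

lemma symbol_boundI:
  assumes g: "g \<in> borel_measurable borel" and n: "c \<le> c'" and C: "0 \<le> C" and r: "1 \<le> r"
  shows "(\<And>k. \<bar>g k\<bar> \<le> c * (C * mj r k)) \<Longrightarrow> symbol_bound (c' * C) r g"
    and "(\<And>k. \<bar>g k\<bar> \<le> c * (C * mj r k / r)) \<Longrightarrow> symbol_bound (c' * C / r) r g"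
proof -
  have "c * (C * mj r k) \<le> c' * C * mj r k" "c * (C * mj r k / r) \<le> c' * C / r * mj r k" for k
    using mult_right_mono[OF n, of "C * mj r k"] mult_right_mono[OF n, of "C * mj r k / r"] C r
    by (simp_all add: mult.assoc)
  then show "(\<And>k. \<bar>g k\<bar> \<le> c * (C * mj r k)) \<Longrightarrow> symbol_bound (c' * C) r g"
    and "(\<And>k. \<bar>g k\<bar> \<le> c * (C * mj r k / r)) \<Longrightarrow> symbol_bound (c' * C / r) r g"
    using g unfolding symbol_bound_def by (meson order_trans)+
qed

lemma state_bounds:
  assumes f: "source_bound \<epsilon> f" and t: "0 \<le> t"
  defines "K \<equiv> 11 * \<epsilon>"
  shows "symbol_bound K (rr t) (\<lambda>k. sx f k t)"
    and "symbol_bound (K / rr t) (rr t) (\<lambda>k. k * sx f k t)"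
    and "symbol_bound (K / rr t) (rr t) (\<lambda>k. st f k t)"
    and "symbol_bound (K / rr t) (rr t) (\<lambda>k. k * st f k t)"
    and "symbol_bound (K / rr t) (rr t) (\<lambda>k. stt f k t)"
proof -
  note m = state_measurable[OF source_boundD(1)[OF f], THEN measurable_at, of t]
  note [measurable] = m
  have r: "1 \<le> rr t" using t by (rule rr_ge_1)
  have e: "0 \<le> \<epsilon> * mj (rr t) k" "0 \<le> \<epsilon> * mj (rr t) k / rr t" for k
    using profile_small r by auto
  note l = linear_decay[OF t] linear_decay_t[OF t]
  note d = duh_bounds[OF f t]
  have 1: "\<bar>sx f k t\<bar> \<le> 4 * (\<epsilon> * mj (rr t) k)" for k
    using l(1)[of k] d(2)[of k] unfolding sx_def by linarith
  have 2: "\<bar>k * sx f k t\<bar> \<le> 5 * (\<epsilon> * mj (rr t) k / rr t)" for k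
  proof -
    have "k * sx f k t = k * (\<alpha> k * exp (- lam k * t)) + k\<^sup>2 * duh f k t"
      by (simp add: sx_def power2_eq_square algebra_simps)
    then show ?thesis using l(2)[of k] d(3)[of k] by linarith
  qed
  have 3: "\<bar>st f k t\<bar> \<le> 5 * (\<epsilon> * mj (rr t) k / rr t)" for k
    using l(3)[of k] d(4)[of k] unfolding st_def mult_minus_left by linarith
  have 4: "\<bar>k * st f k t\<bar> \<le> 5 * (\<epsilon> * mj (rr t) k / rr t)" for k
  proof -
    have "k * st f k t = k * duh_t f k t - k * (lam k / k * \<alpha> k * exp (- lam k * t))"
      by (simp add: st_def algebra_simps)
    then have "\<bar>k * st f k t\<bar> \<le> \<bar>k * duh_t f k t\<bar> + \<bar>k * (lam k / k * \<alpha> k * exp (- lam k * t))\<bar>"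
      by (simp only: abs_triangle_ineq4)
    then show ?thesis using l(4)[of k] d(5)[of k] e(2)[of k] by simp
  qed
  have 5: "\<bar>stt f k t\<bar> \<le> 11 * (\<epsilon> * mj (rr t) k / rr t)" for k
  proof -
    have "\<bar>f k t\<bar> \<le> \<epsilon> * (mj (rr t) k / rr t)"
      by (rule order_trans[OF source_boundD(3)[OF f t]])
        (intro mult_left_mono wt_le t profile_small)
    then show ?thesis using 2[of k] 3[of k] unfolding stt_def by simp
  qed
  note I = symbol_boundI[OF _ _ profile_small(1) r]
  show "symbol_bound K (rr t) (\<lambda>k. sx f k t)"
    and "symbol_bound (K / rr t) (rr t) (\<lambda>k. k * sx f k t)"
    and "symbol_bound (K / rr t) (rr t) (\<lambda>k. st f k t)"
    and "symbol_bound (K / rr t) (rr t) (\<lambda>k. k * st f k t)"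
    and "symbol_bound (K / rr t) (rr t) (\<lambda>k. stt f k t)"
    unfolding K_def by (rule I(1)[OF _ _ 1] I(2)[OF _ _ 2] I(2)[OF _ _ 3] I(2)[OF _ _ 4] I(2)[OF _ _ 5]; measurable; simp)+
qed

lemma state_diff_bounds:
  assumes f: "source_bound \<epsilon> f" and g: "source_bound \<epsilon> g"
    and fg: "source_bound C (\<lambda>k t. f k t - g k t)" and t: "0 \<le> t"
  shows "symbol_bound (9 * C) (rr t) (\<lambda>k. sx f k t - sx g k t)"
    and "symbol_bound (9 * C / rr t) (rr t) (\<lambda>k. k * sx f k t - k * sx g k t)"
    and "symbol_bound (9 * C / rr t) (rr t) (\<lambda>k. st f k t - st g k t)"
    and "symbol_bound (9 * C / rr t) (rr t) (\<lambda>k. k * st f k t - k * st g k t)"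
    and "symbol_bound (9 * C / rr t) (rr t) (\<lambda>k. stt f k t - stt g k t)"
proof -
  let ?h = "\<lambda>k t. f k t - g k t"
  note [measurable] = state_measurable[OF source_boundD(1)[OF f], THEN measurable_at, of t]
  note [measurable] = state_measurable[OF source_boundD(1)[OF g], THEN measurable_at, of t]
  have r: "1 \<le> rr t" using t by (rule rr_ge_1)
  have C: "0 \<le> C" using fg by (rule source_boundD)
  note d = duh_bounds[OF fg t]
  have x: "sx f k t - sx g k t = k * duh ?h k t" for k
    unfolding duh_diff(1)[OF f g t, symmetric] by (simp add: sx_def algebra_simps)
  have y: "st f k t - st g k t = duh_t ?h k t" for k
    unfolding duh_diff(2)[OF f g t, symmetric] by (simp add: st_def algebra_simps)
  have z: "stt f k t - stt g k t = duh_t ?h k t + k\<^sup>2 * duh ?h k t + ?h k t" for k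
  proof -
    have "stt f k t - stt g k t = (st f k t - st g k t) + k * (sx f k t - sx g k t) + ?h k t"
      by (simp add: stt_def algebra_simps)
    then show ?thesis unfolding x y by (simp add: power2_eq_square)
  qed
  have h: "\<bar>?h k t\<bar> \<le> C * mj (rr t) k / rr t" for k
  proof -
    have "\<bar>?h k t\<bar> \<le> C * (mj (rr t) k / rr t)"
      by (rule order_trans[OF source_boundD(3)[OF fg t]])
        (intro mult_left_mono wt_le t C)
    then show ?thesis by simp
  qed
  have 1: "\<bar>sx f k t - sx g k t\<bar> \<le> 3 * (C * mj (rr t) k)" for k
    unfolding x by (rule d(2))
  have 2: "\<bar>k * sx f k t - k * sx g k t\<bar> \<le> 4 * (C * mj (rr t) k / rr t)" for k
    unfolding right_diff_distrib[symmetric] x using d(3)[of k] by (simp add: power2_eq_square mult.assoc)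
  have 3: "\<bar>st f k t - st g k t\<bar> \<le> 4 * (C * mj (rr t) k / rr t)" for k
    unfolding y using d(4)[of k] by simp
  have 4: "\<bar>k * st f k t - k * st g k t\<bar> \<le> 2 * (C * mj (rr t) k / rr t)" for k
    unfolding right_diff_distrib[symmetric] y using d(5)[of k] by simp
  have 5: "\<bar>stt f k t - stt g k t\<bar> \<le> 9 * (C * mj (rr t) k / rr t)" for k
    unfolding z using d(3)[of k] d(4)[of k] h[of k] by simp
  note I = symbol_boundI[OF _ _ C r]
  show "symbol_bound (9 * C) (rr t) (\<lambda>k. sx f k t - sx g k t)"
    and "symbol_bound (9 * C / rr t) (rr t) (\<lambda>k. k * sx f k t - k * sx g k t)"
    and "symbol_bound (9 * C / rr t) (rr t) (\<lambda>k. st f k t - st g k t)"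
    and "symbol_bound (9 * C / rr t) (rr t) (\<lambda>k. k * st f k t - k * st g k t)"
    and "symbol_bound (9 * C / rr t) (rr t) (\<lambda>k. stt f k t - stt g k t)"
    by (rule I(1)[OF _ _ 1] I(2)[OF _ _ 2] I(2)[OF _ _ 3] I(2)[OF _ _ 4] I(2)[OF _ _ 5]; measurable; simp)+
qed

lemma symbol_bound_weaken:
  assumes "1 \<le> r" "symbol_bound (K / r) r g"
  shows "symbol_bound K r g"
proof (rule symbol_bound_mono[OF assms(2)])
  have "0 \<le> K" using symbol_bound_nonneg[OF assms(2)] assms(1) by (simp add: zero_le_divide_iff)
  then show "K / r \<le> K" using assms(1) by (simp add: divide_le_eq mult_le_cancel_left1)
qed

lemma abs_sum5_le:
  fixes a b c d e :: real
  assumes "\<bar>a\<bar> \<le> M" "\<bar>b\<bar> \<le> M" "\<bar>c\<bar> \<le> M" "\<bar>d\<bar> \<le> M" "\<bar>e\<bar> \<le> M"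
  shows "\<bar>a - b + c - 2 * d + e\<bar> \<le> 6 * M"
  using assms by linarith

text \<open>Together with \<open>rhs_contraction\<close> this shows that \<open>rhs\<close> is a contraction of a ball of sources: the
  terms are cubic and each of their three factors is of size \<open>\<epsilon>\<close>.\<close>

lemma rhs_bound:
  assumes f: "source_bound \<epsilon> f" and t: "0 \<le> t"
  shows "\<bar>rhs f k t\<bar> \<le> \<epsilon> * wt t k"
proof -
  have r: "1 \<le> rr t" using t by (rule rr_ge_1)
  note s = state_bounds[OF f t]
  note w = symbol_bound_weaken[OF r s(2)] symbol_bound_weaken[OF r s(3)]
    symbol_bound_weaken[OF r s(4)]
  note T = symbol_bound_triple[OF r, THEN symbol_boundD(2), where k=k]
  have "\<bar>rhs f k t\<bar> \<le> 6 * (169 * (11 * \<epsilon>) ^ 3 / rr t ^ 3 * mj (rr t) k)"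
    unfolding rhs_def Let_def
    by (intro abs_sum5_le T s w)
  also have "\<dots> = (6 * 169 * 11 ^ 3 * \<epsilon>\<^sup>2) * (\<epsilon> * wt t k)"
    by (simp add: wt_def power3_eq_cube power2_eq_square)
  also have "\<dots> \<le> 1 * (\<epsilon> * wt t k)"
  proof (intro mult_right_mono)
    have "\<epsilon>\<^sup>2 \<le> (1 / 10000)\<^sup>2" using profile_small by (intro power_mono)
    then show "6 * 169 * 11 ^ 3 * \<epsilon>\<^sup>2 \<le> 1" by (simp add: power2_eq_square)
  qed (use profile_small t in auto)
  finally show ?thesis by simp
qed

lemma rhs_contraction:
  assumes f: "source_bound \<epsilon> f" and g: "source_bound \<epsilon> g"
    and fg: "source_bound C (\<lambda>k t. f k t - g k t)" and t: "0 \<le> t"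
  shows "\<bar>rhs f k t - rhs g k t\<bar> \<le> C / 2 * wt t k"
proof -
  have r: "1 \<le> rr t" using t by (rule rr_ge_1)
  note s = state_bounds[OF f t] and s' = state_bounds[OF g t]
  note w = symbol_bound_weaken[OF r s(2)] symbol_bound_weaken[OF r s(3)]
    symbol_bound_weaken[OF r s(4)]
  note w' = symbol_bound_weaken[OF r s'(2)] symbol_bound_weaken[OF r s'(3)]
    symbol_bound_weaken[OF r s'(4)]
  note d = state_diff_bounds[OF f g fg t]
  note v = symbol_bound_weaken[OF r d(2)] symbol_bound_weaken[OF r d(3)]
    symbol_bound_weaken[OF r d(4)]
  note T = symbol_bound_triple_diff[OF r, THEN symbol_boundD(2), where k=k]
  have C: "0 \<le> C" using fg by (rule source_boundD)
  have e: "(a1 - b1 + c1 - 2 * d1 + e1) - (a2 - b2 + c2 - 2 * d2 + e2)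
    = (a1 - a2) - (b1 - b2) + (c1 - c2) - 2 * (d1 - d2) + (e1 - e2)"
    for a1 a2 b1 b2 c1 c2 d1 d2 e1 e2 :: real by simp
  have "\<bar>rhs f k t - rhs g k t\<bar> \<le> 6 * (507 * (11 * \<epsilon>)\<^sup>2 * (9 * C) / rr t ^ 3 * mj (rr t) k)"
    unfolding rhs_def Let_def e
    by (intro abs_sum5_le T s s' w w' d v)
  also have "\<dots> = (6 * 507 * 11\<^sup>2 * 9 * \<epsilon>\<^sup>2) * (C * wt t k)"
    by (simp add: wt_def power_mult_distrib)
  also have "\<dots> \<le> 1 / 2 * (C * wt t k)"
  proof (intro mult_right_mono)
    have "\<epsilon>\<^sup>2 \<le> (1 / 10000)\<^sup>2" using profile_small by (intro power_mono)
    then show "6 * 507 * 11\<^sup>2 * 9 * \<epsilon>\<^sup>2 \<le> 1 / 2" by (simp add: power2_eq_square)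
  qed (use C t in auto)
  finally show ?thesis by simp
qed


lemma state_families:
  assumes f: "source_bound \<epsilon> f"
  defines "K \<equiv> 11 * \<epsilon>"
  shows "symbol_family K (sx f)" "symbol_family K (\<lambda>k t. k * sx f k t)"
    "symbol_family K (st f)" "symbol_family K (\<lambda>k t. k * st f k t)"
    "symbol_family K (stt f)"
proof -
  note [measurable] = state_measurable[OF source_boundD(1)[OF f]]
  have duh: "continuous_on {0..} (duh f k)" "continuous_on {0..} (duh_t f k)" for k
    using duh_has_derivative[OF f] by (auto intro!: DERIV_continuous_on)
  have x: "continuous_on {0..} (sx f k)" for k
    unfolding sx_def[abs_def] by (intro continuous_intros duh)
  have y: "continuous_on {0..} (st f k)" for k
    unfolding st_def[abs_def] by (intro continuous_intros duh)
  have z: "continuous_on {0..} (stt f k)" for k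
    unfolding stt_def[abs_def] by (intro continuous_intros x y source_boundD(2)[OF f])
  note s = state_bounds[OF f, folded K_def]
  note w = symbol_bound_weaken[OF rr_ge_1]
  show "symbol_family K (sx f)" unfolding symbol_family_def using x s(1) by auto
  show "symbol_family K (st f)" unfolding symbol_family_def using y w[OF _ s(3)] by auto
  show "symbol_family K (stt f)" unfolding symbol_family_def using z w[OF _ s(5)] by auto
  have [measurable]: "(\<lambda>(k, t). k * sx f k t) \<in> borel_measurable (borel \<Otimes>\<^sub>M borel)"
    "(\<lambda>(k, t). k * st f k t) \<in> borel_measurable (borel \<Otimes>\<^sub>M borel)" by measurable
  show "symbol_family K (\<lambda>k t. k * sx f k t)"
    unfolding symbol_family_def using x w[OF _ s(2)] by (auto intro!: continuous_intros)
  show "symbol_family K (\<lambda>k t. k * st f k t)"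
    unfolding symbol_family_def using y w[OF _ s(4)] by (auto intro!: continuous_intros)
qed

text \<open>Measurability and continuity in time pass to convolutions, so the iteration stays in the
  class of admissible sources.\<close>

lemma rhs_source_bound:
  assumes f: "source_bound \<epsilon> f"
  shows "source_bound \<epsilon> (rhs f)"
proof -
  note S = state_families[OF f]
  note c = symbol_family_conv
  note n = symbol_family_cmult
  note F = symbol_family_add[OF symbol_family_add[OF symbol_family_add[OF symbol_family_add[OF
    c[OF S(3) c[OF S(3) S(3)]] n[OF c[OF S(3) c[OF S(1) S(1)]], of "-1"]]
    c[OF S(3) c[OF S(3) S(2)]]] n[OF c[OF S(3) c[OF S(1) S(4)]], of "-2"]]
    c[OF S(5) c[OF S(1) S(1)]]]
  have "rhs f = (\<lambda>k t. conv (\<lambda>\<eta>. st f \<eta> t) (\<lambda>\<eta>. conv (\<lambda>\<eta>. st f \<eta> t) (\<lambda>\<eta>. st f \<eta> t) \<eta>) k +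
      - 1 * conv (\<lambda>\<eta>. st f \<eta> t) (\<lambda>\<eta>. conv (\<lambda>\<eta>. sx f \<eta> t) (\<lambda>\<eta>. sx f \<eta> t) \<eta>) k +
      conv (\<lambda>\<eta>. st f \<eta> t) (\<lambda>\<eta>. conv (\<lambda>\<eta>. st f \<eta> t) (\<lambda>\<eta>. \<eta> * sx f \<eta> t) \<eta>) k +
      - 2 * conv (\<lambda>\<eta>. st f \<eta> t) (\<lambda>\<eta>. conv (\<lambda>\<eta>. sx f \<eta> t) (\<lambda>\<eta>. \<eta> * st f \<eta> t) \<eta>) k +
      conv (\<lambda>\<eta>. stt f \<eta> t) (\<lambda>\<eta>. conv (\<lambda>\<eta>. sx f \<eta> t) (\<lambda>\<eta>. sx f \<eta> t) \<eta>) k)"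
    by (intro ext) (simp add: rhs_def Let_def)
  note F' = F[folded this]
  show ?thesis
    unfolding source_bound_def
    using symbol_familyD(1,2)[OF F'] rhs_bound[OF f] by blast
qed

lemma source_bound_diff:
  assumes f: "source_bound C f" and g: "source_bound C' g"
    and "\<And>k t. 0 \<le> t \<Longrightarrow> \<bar>f k t - g k t\<bar> \<le> D * wt t k"
  shows "source_bound D (\<lambda>k t. f k t - g k t)"
proof -
  note [measurable] = source_boundD(1)[OF f] source_boundD(1)[OF g]
  have "(\<lambda>(k, t). f k t - g k t) \<in> borel_measurable (borel \<Otimes>\<^sub>M borel)" by measurable
  then show ?thesis
    unfolding source_bound_def using assms
    by (auto intro!: continuous_intros source_boundD(2)[OF f] source_boundD(2)[OF g])
qed

primrec iter :: "nat \<Rightarrow> real \<Rightarrow> real \<Rightarrow> real" where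
  "iter 0 = (\<lambda>_ _. 0)"
| "iter (Suc n) = rhs (iter n)"

lemma iter_source_bound: "source_bound \<epsilon> (iter n)"
proof (induction n)
  case 0
  show ?case using profile_small by (auto simp: source_bound_def)
qed (simp add: rhs_source_bound)

lemma iter_step: "source_bound (\<epsilon> * (1/2) ^ n) (\<lambda>k t. iter (Suc n) k t - iter n k t)"
proof (induction n)
  case 0
  show ?case using rhs_bound[OF iter_source_bound[of 0]]
    by (intro source_bound_diff[OF iter_source_bound iter_source_bound]) simp
next
  case (Suc n)
  show ?case
    using rhs_contraction[OF iter_source_bound iter_source_bound Suc]
    by (intro source_bound_diff[OF iter_source_bound iter_source_bound]) simp
qed

definition sol :: "real \<Rightarrow> real \<Rightarrow> real" where
  "sol k t = lim (\<lambda>n. iter n k t)"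

lemma iter_dist:
  assumes "0 \<le> t"
  shows "\<bar>iter (n + j) k t - iter n k t\<bar> \<le> 2 * \<epsilon> * (1/2) ^ n * wt t k"
proof -
  have "\<bar>iter (n + j) k t - iter n k t\<bar> \<le> 2 * \<epsilon> * (1/2) ^ n * wt t k * (1 - (1/2) ^ j)"
  proof (induction j)
    case (Suc j)
    have "\<bar>iter (n + Suc j) k t - iter (n + j) k t\<bar> \<le> \<epsilon> * (1/2) ^ (n + j) * wt t k"
      using source_boundD(3)[OF iter_step[of "n + j"] assms] by simp
    then have "\<bar>iter (n + Suc j) k t - iter n k t\<bar>
      \<le> \<epsilon> * (1/2) ^ (n + j) * wt t k + 2 * \<epsilon> * (1/2) ^ n * wt t k * (1 - (1/2) ^ j)"
      using Suc by linarith
    also have "\<dots> = 2 * \<epsilon> * (1/2) ^ n * wt t k * (1 - (1/2) ^ Suc j)"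
      by (simp add: power_add algebra_simps)
    finally show ?case .
  qed simp
  also have "\<dots> \<le> 2 * \<epsilon> * (1/2) ^ n * wt t k * 1"
    using profile_small assms by (intro mult_left_mono) auto
  finally show ?thesis by simp
qed

lemma iter_tendsto:
  assumes "0 \<le> t"
  shows "(\<lambda>n. iter n k t) \<longlonglongrightarrow> sol k t"
proof -
  have "summable (\<lambda>n. iter (Suc n) k t - iter n k t)"
  proof (rule summable_rabs_comparison_test[OF exI[of _ 0], OF allI[OF impI], THEN summable_rabs_cancel])
    show "\<bar>iter (Suc n) k t - iter n k t\<bar> \<le> \<epsilon> * wt t k * (1/2) ^ n" for n
      using source_boundD(3)[OF iter_step[of n] assms, of k] by (simp add: mult.commute mult.left_commute)
    show "summable (\<lambda>n. \<epsilon> * wt t k * (1/2) ^ n)"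
      by (intro summable_mult summable_geometric) auto
  qed
  then have "convergent (\<lambda>n. \<Sum>i<n. iter (Suc i) k t - iter i k t)"
    by (simp add: summable_iff_convergent)
  then have "convergent (\<lambda>n. iter n k t)"
    using sum_lessThan_telescope[of "\<lambda>n. iter n k t"] by simp
  then show ?thesis by (simp add: sol_def convergent_LIMSEQ_iff)
qed

lemma sol_dist:
  assumes "0 \<le> t"
  shows "\<bar>sol k t - iter n k t\<bar> \<le> 2 * \<epsilon> * (1/2) ^ n * wt t k"
proof (rule LIMSEQ_le_const2)
  show "(\<lambda>j. \<bar>iter (n + j) k t - iter n k t\<bar>) \<longlonglongrightarrow> \<bar>sol k t - iter n k t\<bar>"
    using LIMSEQ_ignore_initial_segment[OF iter_tendsto[OF assms], of n k]
    by (intro tendsto_intros) (simp add: add.commute)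
qed (use iter_dist[OF assms] in auto)

lemma sol_source_bound: "source_bound \<epsilon> sol"
  unfolding source_bound_def
proof (intro conjI allI impI)
  note [measurable] = source_boundD(1)[OF iter_source_bound]
  show "case_prod sol \<in> borel_measurable (borel \<Otimes>\<^sub>M borel)"
    unfolding sol_def[abs_def] case_prod_beta
    by (rule borel_measurable_lim_metric) measurable
  show "continuous_on {0..} (sol k)" for k
  proof (rule uniform_limit_theorem)
    show "\<forall>\<^sub>F n in sequentially. continuous_on {0..} (iter n k)"
      by (intro always_eventually allI source_boundD(2)[OF iter_source_bound])
    show "uniform_limit {0..} (\<lambda>n. iter n k) (sol k) sequentially"
    proof (rule uniform_limitI)
      fix e :: real assume "0 < e"
      have "(\<lambda>n. 2 * \<epsilon> * (1/2) ^ n) \<longlonglongrightarrow> 2 * \<epsilon> * 0"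
        by (intro tendsto_intros LIMSEQ_power_zero) auto
      then have "\<forall>\<^sub>F n in sequentially. 2 * \<epsilon> * (1/2) ^ n < e"
        using \<open>0 < e\<close> by (intro order_tendstoD) auto
      then show "\<forall>\<^sub>F n in sequentially. \<forall>t\<in>{0..}. dist (iter n k t) (sol k t) < e"
      proof eventually_elim
        case (elim n)
        have "dist (iter n k t) (sol k t) \<le> 2 * \<epsilon> * (1/2) ^ n" if "0 \<le> t" for t
        proof -
          have "2 * \<epsilon> * (1/2) ^ n * wt t k \<le> 2 * \<epsilon> * (1/2) ^ n * 1"
            using profile_small that by (intro mult_left_mono wt_le) auto
          then show ?thesis using sol_dist[OF that, of k n] by (simp add: dist_real_def abs_minus_commute)
        qed
        with elim show ?case by force
      qed
    qed
  qed simp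
  fix k t :: real assume t: "0 \<le> t"
  show "\<bar>sol k t\<bar> \<le> \<epsilon> * wt t k"
    by (rule LIMSEQ_le_const2[OF tendsto_rabs[OF iter_tendsto[OF t]]])
      (use source_boundD(3)[OF iter_source_bound t] in auto)
qed

lemma sol_eq:
  assumes t: "0 \<le> t"
  shows "rhs sol k t = sol k t"
proof -
  have 1: "\<bar>rhs (iter n) k t - rhs sol k t\<bar> \<le> \<epsilon> * wt t k * (1/2) ^ n" for n
  proof -
    have "source_bound (2 * \<epsilon> * (1/2) ^ n) (\<lambda>k t. iter n k t - sol k t)"
      using sol_dist by (intro source_bound_diff[OF iter_source_bound sol_source_bound])
        (simp add: abs_minus_commute)
    from rhs_contraction[OF iter_source_bound sol_source_bound this t, of k]
    show ?thesis by (simp add: mult.commute mult.left_commute)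
  qed
  have "(\<lambda>n. \<epsilon> * wt t k * (1/2) ^ n) \<longlonglongrightarrow> \<epsilon> * wt t k * 0"
    by (intro tendsto_intros LIMSEQ_power_zero) auto
  then have z: "(\<lambda>n. \<epsilon> * wt t k * (1/2) ^ n) \<longlonglongrightarrow> 0" by (simp only: mult_zero_right)
  have "(\<lambda>n. rhs (iter n) k t - rhs sol k t) \<longlonglongrightarrow> 0"
    by (rule Lim_null_comparison[OF _ z], intro always_eventually allI)
      (simp only: real_norm_def, rule 1)
  from tendsto_add[OF this tendsto_const[of "rhs sol k t"]]
  have "(\<lambda>n. iter (Suc n) k t) \<longlonglongrightarrow> rhs sol k t" by simp
  moreover have "(\<lambda>n. iter (Suc n) k t) \<longlonglongrightarrow> sol k t"
    using iter_tendsto[OF t] by (rule LIMSEQ_Suc)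
  ultimately show ?thesis by (rule LIMSEQ_unique)
qed

lemma state_even:
  assumes f: "\<And>k. f (- k) = f k"
  shows "duh f (- k) t = duh f k t" "sx f (- k) t = - 1 * sx f k t"
    "st f (- k) t = 1 * st f k t" "stt f (- k) t = 1 * stt f k t"
proof -
  show "duh f (- k) t = duh f k t" by (simp add: duh_def f)
  show 1: "sx f (- k) t = - 1 * sx f k t" by (simp add: sx_def duh_def f profile_odd)
  show 2: "st f (- k) t = 1 * st f k t" by (simp add: st_def duh_t_def f profile_odd)
  show "stt f (- k) t = 1 * stt f k t" using 1 2 by (simp add: stt_def f)
qed

lemma rhs_even:
  assumes f: "\<And>k. f (- k) = f k"
  shows "rhs f (- k) t = rhs f k t"
proof -
  note e = state_even[of f, OF f]
  have x: "- k * sx f (- k) t = 1 * (k * sx f k t)"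
    "- k * st f (- k) t = - 1 * (k * st f k t)" for k
    using e[of k t] by simp_all
  have "conv (\<lambda>k. st f k t) (conv (\<lambda>k. st f k t) (\<lambda>k. st f k t)) (- k) = 1 * (1 * 1) * conv (\<lambda>k. st f k t) (conv (\<lambda>k. st f k t) (\<lambda>k. st f k t)) k"
    by (intro conv_even e x)
  moreover have "conv (\<lambda>k. st f k t) (conv (\<lambda>k. sx f k t) (\<lambda>k. sx f k t)) (- k) = 1 * (- 1 * - 1) * conv (\<lambda>k. st f k t) (conv (\<lambda>k. sx f k t) (\<lambda>k. sx f k t)) k"
    by (intro conv_even e x)
  moreover have "conv (\<lambda>k. st f k t) (conv (\<lambda>k. st f k t) (\<lambda>k. k * sx f k t)) (- k) = 1 * (1 * 1) * conv (\<lambda>k. st f k t) (conv (\<lambda>k. st f k t) (\<lambda>k. k * sx f k t)) k"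
    by (intro conv_even e x)
  moreover have "conv (\<lambda>k. st f k t) (conv (\<lambda>k. sx f k t) (\<lambda>k. k * st f k t)) (- k) = 1 * (- 1 * - 1) * conv (\<lambda>k. st f k t) (conv (\<lambda>k. sx f k t) (\<lambda>k. k * st f k t)) k"
    by (intro conv_even e x)
  moreover have "conv (\<lambda>k. stt f k t) (conv (\<lambda>k. sx f k t) (\<lambda>k. sx f k t)) (- k) = 1 * (- 1 * - 1) * conv (\<lambda>k. stt f k t) (conv (\<lambda>k. sx f k t) (\<lambda>k. sx f k t)) k"
    by (intro conv_even e x)
  ultimately show ?thesis unfolding rhs_def Let_def by simp
qed

lemma sol_even: "sol (- k) t = sol k t"
proof -
  have "iter n (- k) = iter n k" for n k
  proof (induction n arbitrary: k)
    case (Suc n)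
    then show ?case using rhs_even[of "iter n"] by auto
  qed simp
  then show ?thesis by (simp add: sol_def)
qed

end

section \<open>Fourier integrals\<close>

text \<open>Differentiation under the integral sign, for the total derivative in a parameter: the difference
  quotients are dominated by means of the mean value inequality.\<close>

lemma has_derivative_lebesgue_integral:
  fixes \<phi> :: "real \<Rightarrow> 'a::real_normed_vector \<Rightarrow> real"
  assumes U: "open U" "convex U" "p \<in> U"
    and int: "\<And>y. y \<in> U \<Longrightarrow> integrable lborel (\<lambda>k. \<phi> k y)"
    and der: "\<And>k y. y \<in> U \<Longrightarrow> (\<phi> k has_derivative \<phi>' k y) (at y)"
    and bound: "\<And>k y v. y \<in> U \<Longrightarrow> \<bar>\<phi>' k y v\<bar> \<le> h k * norm v"
    and h: "integrable lborel h" "\<And>k. 0 \<le> h k"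
    and meas: "\<And>v. (\<lambda>k. \<phi>' k p v) \<in> borel_measurable lborel"
  shows "((\<lambda>y. LINT k|lborel. \<phi> k y) has_derivative (\<lambda>v. LINT k|lborel. \<phi>' k p v)) (at p)"
proof -
  have lin: "linear (\<phi>' k p)" for k
    using der[OF U(3), of k] has_derivative_linear by blast
  have int': "integrable lborel (\<lambda>k. \<phi>' k p v)" for v
  proof (rule Bochner_Integration.integrable_bound[OF _ meas])
    show "integrable lborel (\<lambda>k. h k * norm v)" using h(1) by simp
    show "AE k in lborel. norm (\<phi>' k p v) \<le> norm (h k * norm v)"
    proof (rule AE_I2)
      fix k show "norm (\<phi>' k p v) \<le> norm (h k * norm v)"
        using bound[OF U(3), of k v] by simp
    qed
  qed
  have bl: "bounded_linear (\<lambda>v. LINT k|lborel. \<phi>' k p v)"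
  proof (rule bounded_linear_intro)
    show "(LINT k|lborel. \<phi>' k p (v + w)) = (LINT k|lborel. \<phi>' k p v) + (LINT k|lborel. \<phi>' k p w)" for v w
      using int' by (simp add: linear_add[OF lin] Bochner_Integration.integral_add)
    show "(LINT k|lborel. \<phi>' k p (r *\<^sub>R v)) = r *\<^sub>R (LINT k|lborel. \<phi>' k p v)" for r v
      by (simp add: linear_scale[OF lin])
    show "norm (LINT k|lborel. \<phi>' k p v) \<le> norm v * (LINT k|lborel. h k)" for v
    proof -
      have "norm (LINT k|lborel. \<phi>' k p v) \<le> (LINT k|lborel. h k * norm v)"
        by (intro order_trans[OF integral_norm_bound] integral_mono integrable_norm int')
          (use h(1) bound[OF U(3)] in auto)
      then show ?thesis by (simp add: mult.commute)
    qed
  qed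
  have lip: "\<bar>\<phi> k y - \<phi> k p\<bar> \<le> h k * norm (y - p)" if "y \<in> U" for k y
    unfolding real_norm_def[symmetric]
  proof (rule differentiable_bound[OF U(2) _ _ that U(3)])
    show "(\<phi> k has_derivative \<phi>' k x) (at x within U)" if "x \<in> U" for x
      using der[OF that] by (rule has_derivative_at_withinI)
    show "onorm (\<phi>' k x) \<le> h k" if "x \<in> U" for x
      using bound[OF that, of k] h(2)[of k] by (intro onorm_bound) simp_all
  qed
  have "((\<lambda>y. LINT k|lborel. \<phi> k y) has_derivative (\<lambda>v. LINT k|lborel. \<phi>' k p v)) (at p within U)"
    unfolding has_derivative_iff_norm tendsto_at_iff_sequentially
  proof (intro conjI allI impI bl)
    fix X :: "nat \<Rightarrow> 'a" assume X: "\<forall>i. X i \<in> U - {p}" "X \<longlonglongrightarrow> p"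
    define q where "q n k = (\<phi> k (X n) - \<phi> k p - \<phi>' k p (X n - p)) / norm (X n - p)" for n k
    have q_int: "integrable lborel (q n)" for n
      unfolding q_def using X int U(3) int' by auto
    have "(\<lambda>n. LINT k|lborel. q n k) \<longlonglongrightarrow> (LINT k::real|lborel. (0::real))"
    proof (rule integral_dominated_convergence[where w="\<lambda>k. 2 * h k"])
      show "integrable lborel (\<lambda>k. 2 * h k)" using h(1) by simp
      show "AE k in lborel. (\<lambda>n. q n k) \<longlonglongrightarrow> 0"
      proof (rule AE_I2)
        fix k
        have "((\<lambda>y. norm (\<phi> k y - \<phi> k p - \<phi>' k p (y - p)) / norm (y - p)) \<longlongrightarrow> 0) (at p within U)"
          using has_derivative_at_withinI[OF der[OF U(3), of k], of U]
          by (simp add: has_derivative_iff_norm)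
        then have "(\<lambda>n. norm (\<phi> k (X n) - \<phi> k p - \<phi>' k p (X n - p)) / norm (X n - p)) \<longlonglongrightarrow> 0"
          using X unfolding tendsto_at_iff_sequentially o_def by blast
        then have "(\<lambda>n. \<bar>q n k\<bar>) \<longlonglongrightarrow> 0"
          by (simp add: q_def abs_divide)
        then show "(\<lambda>n. q n k) \<longlonglongrightarrow> 0" by (rule tendsto_rabs_zero_cancel)
      qed
      show "AE k in lborel. norm (q n k) \<le> 2 * h k" for n
      proof (rule AE_I2)
        fix k
        have "0 < norm (X n - p)" "X n \<in> U" using X by auto
        moreover have "\<bar>\<phi> k (X n) - \<phi> k p - \<phi>' k p (X n - p)\<bar> \<le> 2 * h k * norm (X n - p)"
          using lip[OF \<open>X n \<in> U\<close>, of k] bound[OF U(3), of k "X n - p"] by linarith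
        ultimately show "norm (q n k) \<le> 2 * h k"
          by (simp add: q_def abs_divide divide_le_eq)
      qed
    qed (use q_int in auto)
    then have lim: "(\<lambda>n. \<bar>LINT k|lborel. q n k\<bar>) \<longlonglongrightarrow> 0" using tendsto_rabs_zero by fastforce
    have eq: "(LINT k|lborel. q n k) = ((LINT k|lborel. \<phi> k (X n)) - (LINT k|lborel. \<phi> k p)
        - (LINT k|lborel. \<phi>' k p (X n - p))) / norm (X n - p)" for n
      unfolding q_def using X int U(3) int' by (simp add: Bochner_Integration.integral_diff)
    have "((\<lambda>y. norm ((LINT k|lborel. \<phi> k y) - (LINT k|lborel. \<phi> k p)
        - (LINT k|lborel. \<phi>' k p (y - p))) / norm (y - p)) \<circ> X) = (\<lambda>n. \<bar>LINT k|lborel. q n k\<bar>)"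
      by (rule ext) (simp only: o_def eq real_norm_def abs_divide abs_norm_cancel)
    then show "((\<lambda>y. norm ((LINT k|lborel. \<phi> k y) - (LINT k|lborel. \<phi> k p)
        - (LINT k|lborel. \<phi>' k p (y - p))) / norm (y - p)) \<circ> X) \<longlonglongrightarrow> 0"
      using lim by (simp only:)
  qed
  then show ?thesis unfolding at_within_open[OF U(3,1)] .
qed

text \<open>The phase shift by multiples of \<open>pi / 2\<close> encodes differentiation in \<open>x\<close>: each derivative multiplies
  the symbol by \<open>k\<close> and raises \<open>n\<close> by one.\<close>

definition ft :: "nat \<Rightarrow> (real \<Rightarrow> real) \<Rightarrow> real \<Rightarrow> real" where
  "ft n g x = (LINT k|lborel. g k * cos (k * x + real n * (pi / 2)))"

abbreviation half :: "(real \<times> real) set" where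
  "half \<equiv> {p. 0 < snd p}"

lemma open_half: "open half" and convex_half: "convex half"
proof -
  have "half = UNIV \<times> {0<..}" by auto
  then show "open half" "convex half" by (simp_all only: open_Times convex_Times open_UNIV
        convex_UNIV open_greaterThan convex_real_interval)
qed

text \<open>The function \<open>c\<close>, constant in \<open>(x, t)\<close>, renders integrals convergent whose symbol is too singular
  at \<open>k = 0\<close>; it does not affect derivatives.\<close>

lemma phase_integral_has_derivative:
  assumes der: "\<And>k t. 0 < t \<Longrightarrow> (g k has_real_derivative g' k t) (at t)"
    and int: "\<And>x t. 0 < t \<Longrightarrow> integrable lborel (\<lambda>k. g k t * cos (k * x + real n * (pi / 2)) - c k)"
    and bx: "\<And>k t. 0 < t \<Longrightarrow> \<bar>k * g k t\<bar> \<le> C / (1 + k\<^sup>2 * 1\<^sup>2)"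
    and bt: "\<And>k t. 0 < t \<Longrightarrow> \<bar>g' k t\<bar> \<le> C / (1 + k\<^sup>2 * 1\<^sup>2)"
    and mx: "\<And>t. 0 < t \<Longrightarrow> (\<lambda>k. k * g k t) \<in> borel_measurable borel"
    and mt: "\<And>t. 0 < t \<Longrightarrow> (\<lambda>k. g' k t) \<in> borel_measurable borel"
    and p: "0 < snd p"
  shows "((\<lambda>p. LINT k|lborel. g k (snd p) * cos (k * fst p + real n * (pi / 2)) - c k)
    has_derivative (\<lambda>v. fst v * ft (Suc n) (\<lambda>k. k * g k (snd p)) (fst p)
      + snd v * ft n (\<lambda>k. g' k (snd p)) (fst p))) (at p)"
proof -
  let ?\<phi> = "\<lambda>k p. g k (snd p) * cos (k * fst p + real n * (pi / 2)) - c k"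
  let ?\<phi>' = "\<lambda>k p v. fst v * (k * g k (snd p) * cos (k * fst p + real (Suc n) * (pi / 2)))
    + snd v * (g' k (snd p) * cos (k * fst p + real n * (pi / 2)))"
  have i: "integrable lborel (\<lambda>k. h k * cos (k * y + z))"
    if "\<And>k. \<bar>h k\<bar> \<le> C / (1 + k\<^sup>2 * 1\<^sup>2)" "h \<in> borel_measurable borel" for h y z
  proof (rule integrable_le_cauchy(1)[where r=1 and K=C])
    show "(\<lambda>k. h k * cos (k * y + z)) \<in> borel_measurable borel" using that(2) by measurable
    fix k
    have "\<bar>h k\<bar> * \<bar>cos (k * y + z)\<bar> \<le> \<bar>h k\<bar> * 1" by (intro mult_left_mono) auto
    then show "norm (h k * cos (k * y + z)) \<le> C / (1 + k\<^sup>2 * 1\<^sup>2)"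
      using that(1)[of k] by (simp add: abs_mult)
  qed simp
  have "((\<lambda>p. LINT k|lborel. ?\<phi> k p) has_derivative (\<lambda>v. LINT k|lborel. ?\<phi>' k p v)) (at p)"
  proof (rule has_derivative_lebesgue_integral[OF open_half convex_half])
    show "integrable lborel (\<lambda>k. 2 * C * (1 / (1 + k\<^sup>2 * 1\<^sup>2)))"
      by (intro integrable_mult_right integrable_cauchy) simp
    show "0 \<le> 2 * C * (1 / (1 + k\<^sup>2 * 1\<^sup>2))" for k using bt[of 1 k] by simp
    fix k and y :: "real \<times> real" assume "y \<in> half"
    then have y: "0 < snd y" by simp
    show "integrable lborel (\<lambda>k. ?\<phi> k y)" using int[OF y] by simp
    have s: "cos (a + real (Suc n) * (pi / 2)) = - sin (a + real n * (pi / 2))" for a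
    proof -
      have "a + real (Suc n) * (pi / 2) = (a + real n * (pi / 2)) + pi / 2"
        by (simp add: algebra_simps)
      then show ?thesis by (simp only: cos_add) simp
    qed
    have gd: "((\<lambda>p. g k (snd p)) has_derivative (\<lambda>v. g' k (snd y) * snd v)) (at y)"
      using has_derivative_compose[OF has_derivative_snd[OF has_derivative_ident]
          der[OF y, of k, unfolded has_field_derivative_def]] by simp
    show "(?\<phi> k has_derivative ?\<phi>' k y) (at y)"
      unfolding s by (auto intro!: derivative_eq_intros gd simp: algebra_simps)
    have nn: "0 \<le> C / (1 + k\<^sup>2 * 1\<^sup>2)" using bt[OF y, of k] by linarith
    fix v :: "real \<times> real"
    have "\<bar>?\<phi>' k y v\<bar> \<le> norm v * (C / (1 + k\<^sup>2 * 1\<^sup>2)) + norm v * (C / (1 + k\<^sup>2 * 1\<^sup>2))"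
    proof (intro order_trans[OF abs_triangle_ineq] add_mono)
      have "\<bar>fst v\<bar> * (\<bar>k * g k (snd y)\<bar> * \<bar>cos (k * fst y + real (Suc n) * (pi / 2))\<bar>)
          \<le> norm v * (C / (1 + k\<^sup>2 * 1\<^sup>2) * 1)"
        by (intro mult_mono bx y) (use norm_fst_le[of "fst v" "snd v"] nn in auto)
      then show "\<bar>fst v * (k * g k (snd y) * cos (k * fst y + real (Suc n) * (pi / 2)))\<bar>
          \<le> norm v * (C / (1 + k\<^sup>2 * 1\<^sup>2))"
        by (simp only: abs_mult mult_1_right)
      have "\<bar>snd v\<bar> * (\<bar>g' k (snd y)\<bar> * \<bar>cos (k * fst y + real n * (pi / 2))\<bar>)
          \<le> norm v * (C / (1 + k\<^sup>2 * 1\<^sup>2) * 1)"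
        by (intro mult_mono bt y) (use norm_snd_le[of "snd v" "fst v"] nn in auto)
      then show "\<bar>snd v * (g' k (snd y) * cos (k * fst y + real n * (pi / 2)))\<bar>
          \<le> norm v * (C / (1 + k\<^sup>2 * 1\<^sup>2))"
        by (simp only: abs_mult mult_1_right)
    qed
    then show "\<bar>?\<phi>' k y v\<bar> \<le> 2 * C * (1 / (1 + k\<^sup>2 * 1\<^sup>2)) * norm v" by simp
  next
    show "p \<in> half" using p by simp
    note [measurable] = mx[OF p] mt[OF p]
    show "(\<lambda>k. ?\<phi>' k p v) \<in> borel_measurable lborel" for v by measurable
  qed
  moreover have "(LINT k|lborel. ?\<phi>' k p v)
    = fst v * ft (Suc n) (\<lambda>k. k * g k (snd p)) (fst p) + snd v * ft n (\<lambda>k. g' k (snd p)) (fst p)" for v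
    unfolding ft_def using i[OF bx[OF p] mx[OF p]] i[OF bt[OF p] mt[OF p]]
    by (simp add: Bochner_Integration.integral_add)
  ultimately show ?thesis by simp
qed

lemma integrable_phase:
  assumes "\<And>k. \<bar>g k\<bar> \<le> C / (1 + k\<^sup>2 * r\<^sup>2)" "g \<in> borel_measurable borel" "0 < r"
  shows "integrable lborel (\<lambda>k. g k * cos (k * x + z))"
    and "\<bar>LINT k|lborel. g k * cos (k * x + z)\<bar> \<le> C * pi / r"
proof -
  have m: "(\<lambda>k. g k * cos (k * x + z)) \<in> borel_measurable borel"
    using assms(2) by measurable
  have "norm (g k * cos (k * x + z)) \<le> C / (1 + k\<^sup>2 * r\<^sup>2)" for k
  proof -
    have "\<bar>g k\<bar> * \<bar>cos (k * x + z)\<bar> \<le> \<bar>g k\<bar> * 1" by (intro mult_left_mono) auto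
    then show ?thesis using assms(1)[of k] by (simp add: abs_mult)
  qed
  note * = integrable_le_cauchy[OF assms(3) m this]
  show "integrable lborel (\<lambda>k. g k * cos (k * x + z))"
    and "\<bar>LINT k|lborel. g k * cos (k * x + z)\<bar> \<le> C * pi / r"
    using * by auto
qed

lemma ft_has_derivative:
  assumes der: "\<And>k t. 0 < t \<Longrightarrow> (g k has_real_derivative g' k t) (at t)"
    and b0: "\<And>k t. 0 < t \<Longrightarrow> \<bar>g k t\<bar> \<le> C / (1 + k\<^sup>2 * 1\<^sup>2)"
    and bx: "\<And>k t. 0 < t \<Longrightarrow> \<bar>k * g k t\<bar> \<le> C / (1 + k\<^sup>2 * 1\<^sup>2)"
    and bt: "\<And>k t. 0 < t \<Longrightarrow> \<bar>g' k t\<bar> \<le> C / (1 + k\<^sup>2 * 1\<^sup>2)"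
    and m0: "\<And>t. 0 < t \<Longrightarrow> (\<lambda>k. g k t) \<in> borel_measurable borel"
    and mt: "\<And>t. 0 < t \<Longrightarrow> (\<lambda>k. g' k t) \<in> borel_measurable borel"
    and p: "0 < snd p"
  shows "((\<lambda>p. ft n (\<lambda>k. g k (snd p)) (fst p))
    has_derivative (\<lambda>v. fst v * ft (Suc n) (\<lambda>k. k * g k (snd p)) (fst p)
      + snd v * ft n (\<lambda>k. g' k (snd p)) (fst p))) (at p)"
  using phase_integral_has_derivative[of g g' n "\<lambda>_. 0" C p, OF der _ bx bt _ mt p]
    integrable_phase(1)[OF b0 m0, of _ _ "real n * (pi / 2)"] m0
  unfolding ft_def by simp

lemma ft_has_derivative_x:
  assumes "\<And>k. \<bar>g k\<bar> \<le> C / (1 + k\<^sup>2 * 1\<^sup>2)"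
    and "\<And>k. \<bar>k * g k\<bar> \<le> C / (1 + k\<^sup>2 * 1\<^sup>2)"
    and "g \<in> borel_measurable borel"
  shows "(ft n g has_real_derivative ft (Suc n) (\<lambda>k. k * g k) x) (at x)"
proof -
  have C: "0 \<le> C" using assms(1)[of 0] by simp
  have "((\<lambda>p. ft n g (fst p)) has_derivative (\<lambda>v. fst v * ft (Suc n) (\<lambda>k. k * g k) (fst (x, 1::real))
      + snd v * ft n (\<lambda>k. 0) (fst (x, 1::real)))) (at (x, 1))"
    by (rule ft_has_derivative[where g="\<lambda>k t. g k" and C=C])
      (use assms C in \<open>auto intro!: divide_nonneg_pos add_pos_nonneg\<close>)
  then have "((\<lambda>p. ft n g (fst p)) has_derivative (\<lambda>v. fst v * ft (Suc n) (\<lambda>k. k * g k) x)) (at (x, 1::real))"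
    by (simp add: ft_def)
  from has_derivative_compose[OF has_derivative_Pair[OF has_derivative_ident has_derivative_const] this]
  show ?thesis by (simp add: has_field_derivative_def mult_commute_abs)
qed

lemma power_le_fact_exp:
  fixes x :: real
  assumes "0 \<le> x"
  shows "x ^ n \<le> fact n * exp x"
proof -
  have "sum (\<lambda>n. x ^ n /\<^sub>R fact n) {n} \<le> (\<Sum>n. x ^ n /\<^sub>R fact n)"
    using assms by (intro sum_le_suminf summable_exp_generic) auto
  moreover have "(\<Sum>n. x ^ n /\<^sub>R fact n) = exp x" by (simp add: exp_def)
  ultimately show ?thesis by (simp add: field_simps)
qed

lemma symbol_bound_moment:
  assumes "symbol_bound K r g"
  shows "\<bar>k ^ n * g k\<bar> \<le> K * fact n / (1 + k\<^sup>2 * r\<^sup>2)"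
proof -
  have "\<bar>k\<bar> ^ n * exp (- \<bar>k\<bar>) \<le> fact n * exp \<bar>k\<bar> * exp (- \<bar>k\<bar>)"
    by (intro mult_right_mono power_le_fact_exp) auto
  also have "\<dots> = fact n" by (simp add: exp_minus)
  finally have e: "\<bar>k\<bar> ^ n * exp (- \<bar>k\<bar>) \<le> fact n" .
  have "\<bar>k ^ n * g k\<bar> \<le> \<bar>k\<bar> ^ n * (K * mj r k)"
    unfolding abs_mult power_abs by (intro mult_left_mono symbol_boundD(2)[OF assms]) auto
  also have "\<dots> = K * (\<bar>k\<bar> ^ n * exp (- \<bar>k\<bar>)) / (1 + k\<^sup>2 * r\<^sup>2)" by (simp add: mj_def)
  also have "\<dots> \<le> K * fact n / (1 + k\<^sup>2 * r\<^sup>2)"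
    using symbol_bound_nonneg[OF assms]
    by (intro divide_right_mono mult_left_mono e) (auto intro: add_nonneg_nonneg)
  finally show ?thesis .
qed

lemma symbol_bound_moment_1:
  assumes "symbol_bound K r g" "1 \<le> r"
  shows "\<bar>k ^ n * g k\<bar> \<le> K * fact n / (1 + k\<^sup>2 * 1\<^sup>2)"
proof -
  have "K * fact n / (1 + k\<^sup>2 * r\<^sup>2) \<le> K * fact n / (1 + k\<^sup>2 * 1\<^sup>2)"
    using assms(2) symbol_bound_nonneg[OF assms(1)]
    by (intro divide_left_mono add_left_mono mult_left_mono power_mono mult_pos_pos add_pos_nonneg) auto
  with symbol_bound_moment[OF assms(1), of k n] show ?thesis by linarith
qed

subsection \<open>Products\<close>

text \<open>The complex transform turns convolutions into products; for even and odd symbols it reduces to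
  cosine and sine integrals.\<close>

definition cft :: "(real \<Rightarrow> real) \<Rightarrow> real \<Rightarrow> complex" where
  "cft g x = (LINT k|lborel. of_real (g k) * cis (k * x))"

lemma cis_measurable [measurable]: "cis \<in> borel_measurable borel"
  by (intro borel_measurable_continuous_onI continuous_intros)

lemma cft_integrable:
  assumes "symbol_bound K r g" "0 < r"
  shows "integrable lborel (\<lambda>k. complex_of_real (g k) * cis (k * x))"
proof (rule integrable_le_cauchy(1)[OF assms(2), where K=K])
  have [measurable]: "g \<in> borel_measurable borel" using assms(1) by (rule symbol_boundD)
  show "(\<lambda>k. complex_of_real (g k) * cis (k * x)) \<in> borel_measurable borel" by measurable
  show "norm (complex_of_real (g k) * cis (k * x)) \<le> K / (1 + k\<^sup>2 * r\<^sup>2)" for k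
    using symbol_bound_cauchy[OF assms(1)] by (simp add: norm_mult)
qed

text \<open>Fubini and translation invariance of Lebesgue measure.\<close>

lemma cft_conv:
  assumes g: "symbol_bound K r g" and h: "symbol_bound L r h" and r: "0 < r"
  shows "cft (conv g h) x = cft g x * cft h x"
proof -
  have [measurable]: "g \<in> borel_measurable borel" "h \<in> borel_measurable borel"
    using g h by (auto dest: symbol_boundD)
  define F where "F \<eta> k = complex_of_real (g \<eta> * h (k - \<eta>)) * cis (k * x)" for \<eta> k
  have F[measurable]: "case_prod F \<in> borel_measurable (lborel \<Otimes>\<^sub>M lborel)"
    unfolding F_def[abs_def] by measurable
  have hi: "integrable lborel h" "integrable lborel g"
    using integrable_le_cauchy(1)[OF r, of h L] integrable_le_cauchy(1)[OF r, of g K]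
      symbol_bound_cauchy[OF h] symbol_bound_cauchy[OF g] by auto
  have sh: "integrable lborel (\<lambda>k. h (k - \<eta>))" for \<eta>
    using lborel_integrable_real_affine[OF hi(1), of 1 "- \<eta>"] by simp
  have shi: "(LINT k|lborel. \<bar>h (k - \<eta>)\<bar>) = (LINT k|lborel. \<bar>h k\<bar>)" for \<eta>
    using lborel_integral_real_affine[of 1 "\<lambda>k. \<bar>h k\<bar>" "- \<eta>"] by simp
  have nF: "norm (F \<eta> k) = \<bar>g \<eta>\<bar> * \<bar>h (k - \<eta>)\<bar>" for \<eta> k
    by (simp add: F_def norm_mult abs_mult)
  have "integrable (lborel \<Otimes>\<^sub>M lborel) (case_prod F)"
  proof (rule lborel_pair.Fubini_integrable[OF F])
    show "integrable lborel (\<lambda>\<eta>. LINT k|lborel. norm (case_prod F (\<eta>, k)))"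
      using hi by (simp add: nF shi)
    have "integrable lborel (F \<eta>)" for \<eta>
    proof (rule Bochner_Integration.integrable_bound)
      show "integrable lborel (\<lambda>k. g \<eta> * h (k - \<eta>))" using sh by simp
      show "F \<eta> \<in> borel_measurable lborel" unfolding F_def by measurable
      show "AE k in lborel. norm (F \<eta> k) \<le> norm (g \<eta> * h (k - \<eta>))" by (simp add: nF abs_mult)
    qed
    then show "AE \<eta> in lborel. integrable lborel (\<lambda>k. case_prod F (\<eta>, k))" by simp
  qed
  then have swap: "(LINT k|lborel. LINT \<eta>|lborel. F \<eta> k) = (LINT \<eta>|lborel. LINT k|lborel. F \<eta> k)"
    by (rule lborel_pair.Fubini_integral)
  have "cft (conv g h) x = (LINT k|lborel. LINT \<eta>|lborel. F \<eta> k)"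
    unfolding cft_def
  proof (rule Bochner_Integration.integral_cong[OF refl])
    fix k
    have "complex_of_real (conv g h k) = (LINT \<eta>|lborel. complex_of_real (g \<eta> * h (k - \<eta>)))"
      unfolding conv_def by (simp only: integral_complex_of_real)
    then show "complex_of_real (conv g h k) * cis (k * x) = (LINT \<eta>|lborel. F \<eta> k)"
      unfolding F_def by simp
  qed
  also have "\<dots> = (LINT \<eta>|lborel. LINT k|lborel. F \<eta> k)" by (rule swap)
  also have "\<dots> = (LINT \<eta>|lborel. complex_of_real (g \<eta>) * cis (\<eta> * x) * cft h x)"
  proof (rule Bochner_Integration.integral_cong[OF refl])
    fix \<eta>
    have "(LINT k|lborel. F \<eta> k) = (LINT k|lborel. F \<eta> (\<eta> + 1 * k))"
      using lborel_integral_real_affine[of 1 "F \<eta>" \<eta>] by simp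
    also have "\<dots> = (LINT k|lborel. complex_of_real (g \<eta>) * cis (\<eta> * x) * (complex_of_real (h k) * cis (k * x)))"
      by (rule Bochner_Integration.integral_cong[OF refl])
        (simp add: F_def distrib_right cis_mult[symmetric])
    also have "\<dots> = complex_of_real (g \<eta>) * cis (\<eta> * x) * cft h x"
      unfolding cft_def by (rule integral_mult_right_zero)
    finally show "(LINT k|lborel. F \<eta> k) = complex_of_real (g \<eta>) * cis (\<eta> * x) * cft h x" .
  qed
  also have "\<dots> = cft g x * cft h x"
    unfolding cft_def by (rule integral_mult_left_zero)
  finally show ?thesis .
qed

lemma odd_integral_zero:
  fixes f :: "real \<Rightarrow> real"
  assumes "\<And>k. f (- k) = - f k"
  shows "integral\<^sup>L lborel f = 0"
proof -
  have "integral\<^sup>L lborel f = (LINT k|lborel. f (0 + - 1 * k))"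
    by (subst lborel_integral_real_affine[where c="-1" and t=0]) auto
  also have "\<dots> = - integral\<^sup>L lborel f" by (simp add: assms)
  finally show ?thesis by simp
qed

lemma cft_split:
  assumes g: "symbol_bound K r g" and r: "0 < r"
  shows "cft g x = Complex (ft 0 g x) (- ft 1 g x)"
proof -
  have s: "cos (y + pi / 2) = - sin y" for y :: real by (simp add: cos_add)
  have "Re (cft g x) = ft 0 g x"
    unfolding cft_def ft_def using cft_integrable[OF g r, of x]
    by (simp flip: integral_Re)
  moreover have "Im (cft g x) = - ft 1 g x"
    unfolding cft_def ft_def using cft_integrable[OF g r, of x]
    by (simp add: s flip: integral_Im)
  ultimately show ?thesis by (simp add: complex_eq_iff)
qed

lemma cft_even:
  assumes g: "symbol_bound K r g" and r: "0 < r" and e: "\<And>k. g (- k) = g k"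
  shows "cft g x = of_real (ft 0 g x)"
proof -
  have "ft 1 g x = 0" unfolding ft_def by (rule odd_integral_zero) (simp add: e cos_add cos_diff)
  then show ?thesis by (simp add: cft_split[OF g r] complex_eq_iff)
qed

lemma cft_odd:
  assumes g: "symbol_bound K r g" and r: "0 < r" and e: "\<And>k. g (- k) = - g k"
  shows "cft g x = - \<i> * of_real (ft 1 g x)"
proof -
  have "ft 0 g x = 0" unfolding ft_def by (rule odd_integral_zero) (simp add: e)
  then show ?thesis by (simp add: cft_split[OF g r] complex_eq_iff)
qed

section \<open>From symbols to functions\<close>

context profile
begin

text \<open>The functions \<open>ux j\<close>, \<open>ut j\<close> and \<open>utt j\<close> are the \<open>j\<close>-th \<open>x\<close>-derivatives of \<open>u\<^sub>x\<close>, \<open>u\<^sub>t\<close> and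
  \<open>u\<^sub>t\<^sub>t\<close>, at the point \<open>p = (x, t)\<close>.\<close>

definition ux :: "nat \<Rightarrow> real \<times> real \<Rightarrow> real" where
  "ux j p = ft (Suc j) (\<lambda>k. k ^ j * sx sol k (snd p)) (fst p)"

definition ut :: "nat \<Rightarrow> real \<times> real \<Rightarrow> real" where
  "ut j p = ft j (\<lambda>k. k ^ j * st sol k (snd p)) (fst p)"

definition utt :: "nat \<Rightarrow> real \<times> real \<Rightarrow> real" where
  "utt j p = ft j (\<lambda>k. k ^ j * stt sol k (snd p)) (fst p)"

lemma profile_zero [simp]: "\<alpha> 0 = 0"
  using profile_odd[of 0] by simp

lemma duh_sol_DERIV:
  assumes "0 < t"
  shows "(duh sol k has_real_derivative duh_t sol k t) (at t)"
    and "(duh_t sol k has_real_derivative duh_t sol k t + k\<^sup>2 * duh sol k t + sol k t) (at t)"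
proof -
  have "at t within {0..} = at t"
    using assms by (intro at_within_interior) (simp add: interior_Ici[of "-1"])
  with duh_has_derivative[OF sol_source_bound, of t k] assms
  show "(duh sol k has_real_derivative duh_t sol k t) (at t)"
    and "(duh_t sol k has_real_derivative duh_t sol k t + k\<^sup>2 * duh sol k t + sol k t) (at t)"
    by simp_all
qed

lemma sx_DERIV:
  assumes "0 < t"
  shows "(sx sol k has_real_derivative k * st sol k t) (at t)"
  unfolding sx_def[abs_def] st_def
  by (auto intro!: derivative_eq_intros duh_sol_DERIV assms simp: algebra_simps)

text \<open>For the linear part this is the characteristic equation of \<open>- lam k\<close>; at \<open>k = 0\<close> it holds since
  \<open>\<alpha>\<close> vanishes there.\<close>

lemma st_DERIV:
  assumes "0 < t"
  shows "(st sol k has_real_derivative stt sol k t) (at t)"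
proof -
  let ?l = "lam k"
  have "?l / k * ?l * \<alpha> k = (k - ?l / k) * \<alpha> k"
  proof (cases "k = 0")
    case False
    have "?l * ?l = k * k - ?l" using lam_quadratic[of k] by (simp add: power2_eq_square algebra_simps)
    then have "?l / k * ?l = k - ?l / k" using False by (simp add: field_simps)
    then show ?thesis by simp
  qed simp
  then have e: "?l / k * ?l * \<alpha> k * E = (k - ?l / k) * \<alpha> k * E" for E by simp
  have "(st sol k has_real_derivative
    ?l / k * ?l * \<alpha> k * exp (- ?l * t) + (duh_t sol k t + k\<^sup>2 * duh sol k t + sol k t)) (at t)"
  proof -
    have E: "((\<lambda>t. exp (- ?l * t)) has_real_derivative - ?l * exp (- ?l * t)) (at t)"
      by (auto intro!: derivative_eq_intros)
    show ?thesis unfolding st_def[abs_def]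
      by (rule DERIV_add[OF DERIV_cmult[OF E] duh_sol_DERIV(2)[OF assms], THEN DERIV_cong]) simp
  qed
  then show ?thesis unfolding e
    by (rule DERIV_cong) (simp add: stt_def st_def sx_def power2_eq_square algebra_simps)
qed

lemma state_at_measurable [measurable]:
  "(\<lambda>k. sx sol k t) \<in> borel_measurable borel"
  "(\<lambda>k. st sol k t) \<in> borel_measurable borel"
  "(\<lambda>k. stt sol k t) \<in> borel_measurable borel"
  "(\<lambda>k. duh sol k t) \<in> borel_measurable borel"
  using state_measurable[OF source_boundD(1)[OF sol_source_bound], THEN measurable_at]
    duh_measurable(1)[OF source_boundD(1)[OF sol_source_bound], THEN measurable_at] by auto

lemma state_symbol_bounds:
  assumes "0 < t"
  shows "symbol_bound (11 * \<epsilon>) (rr t) (\<lambda>k. sx sol k t)"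
    "symbol_bound (11 * \<epsilon>) (rr t) (\<lambda>k. k * sx sol k t)"
    "symbol_bound (11 * \<epsilon>) (rr t) (\<lambda>k. st sol k t)"
    "symbol_bound (11 * \<epsilon>) (rr t) (\<lambda>k. k * st sol k t)"
    "symbol_bound (11 * \<epsilon>) (rr t) (\<lambda>k. stt sol k t)"
  using state_families[OF sol_source_bound, THEN symbol_familyD(3), of t] assms by auto

lemma state_moments:
  assumes "0 < t"
  shows "\<bar>k ^ n * sx sol k t\<bar> \<le> 11 * \<epsilon> * fact n / (1 + k\<^sup>2 * 1\<^sup>2)"
    "\<bar>k ^ n * st sol k t\<bar> \<le> 11 * \<epsilon> * fact n / (1 + k\<^sup>2 * 1\<^sup>2)"
    "\<bar>k ^ n * stt sol k t\<bar> \<le> 11 * \<epsilon> * fact n / (1 + k\<^sup>2 * 1\<^sup>2)"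
  using symbol_bound_moment_1[OF state_symbol_bounds(1)[OF assms], of k n]
    symbol_bound_moment_1[OF state_symbol_bounds(3)[OF assms], of k n]
    symbol_bound_moment_1[OF state_symbol_bounds(5)[OF assms], of k n]
    rr_ge_1[of t] assms by auto

lemma fact_moment_mono:
  assumes "\<bar>y\<bar> \<le> 11 * \<epsilon> * fact n / (1 + k\<^sup>2 * 1\<^sup>2)"
  shows "\<bar>y\<bar> \<le> 11 * \<epsilon> * fact (Suc n) / (1 + k\<^sup>2 * 1\<^sup>2)"
proof -
  have "11 * \<epsilon> * fact n / (1 + k\<^sup>2 * 1\<^sup>2) \<le> 11 * \<epsilon> * fact (Suc n) / (1 + k\<^sup>2 * 1\<^sup>2)"
    using profile_small by (intro divide_right_mono mult_left_mono fact_mono) (auto intro: add_nonneg_nonneg)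
  with assms show ?thesis by linarith
qed

lemma ux_has_derivative:
  assumes p: "0 < snd p"
  shows "(ux j has_derivative (\<lambda>v. fst v * ux (Suc j) p + snd v * ut (Suc j) p)) (at p)"
proof -
  have "((\<lambda>p. ft (Suc j) (\<lambda>k. k ^ j * sx sol k (snd p)) (fst p)) has_derivative
      (\<lambda>v. fst v * ft (Suc (Suc j)) (\<lambda>k. k * (k ^ j * sx sol k (snd p))) (fst p)
        + snd v * ft (Suc j) (\<lambda>k. k ^ j * (k * st sol k (snd p))) (fst p))) (at p)"
  proof (rule ft_has_derivative[where C="11 * \<epsilon> * fact (Suc j)"
        and g="\<lambda>k t. k ^ j * sx sol k t" and g'="\<lambda>k t. k ^ j * (k * st sol k t)"])
    fix k t :: real assume t: "0 < t"
    show "((\<lambda>t. k ^ j * sx sol k t) has_real_derivative k ^ j * (k * st sol k t)) (at t)"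
      by (intro DERIV_cmult sx_DERIV t)
    show "\<bar>k ^ j * sx sol k t\<bar> \<le> 11 * \<epsilon> * fact (Suc j) / (1 + k\<^sup>2 * 1\<^sup>2)"
      by (rule fact_moment_mono[OF state_moments(1)[OF t]])
    show "\<bar>k * (k ^ j * sx sol k t)\<bar> \<le> 11 * \<epsilon> * fact (Suc j) / (1 + k\<^sup>2 * 1\<^sup>2)"
      using state_moments(1)[OF t, of k "Suc j"] by (simp only: power_Suc mult.assoc)
    show "\<bar>k ^ j * (k * st sol k t)\<bar> \<le> 11 * \<epsilon> * fact (Suc j) / (1 + k\<^sup>2 * 1\<^sup>2)"
      using state_moments(2)[OF t, of k "Suc j"] by (simp only: power_Suc2 mult.assoc)
  qed (measurable, rule p)
  then show ?thesis
    by (simp add: ux_def[abs_def] ut_def mult.assoc mult.left_commute)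
qed

lemma ut_has_derivative:
  assumes p: "0 < snd p"
  shows "(ut j has_derivative (\<lambda>v. fst v * ut (Suc j) p + snd v * utt j p)) (at p)"
proof -
  have "((\<lambda>p. ft j (\<lambda>k. k ^ j * st sol k (snd p)) (fst p)) has_derivative
      (\<lambda>v. fst v * ft (Suc j) (\<lambda>k. k * (k ^ j * st sol k (snd p))) (fst p)
        + snd v * ft j (\<lambda>k. k ^ j * stt sol k (snd p)) (fst p))) (at p)"
  proof (rule ft_has_derivative[where C="11 * \<epsilon> * fact (Suc j)"
        and g="\<lambda>k t. k ^ j * st sol k t" and g'="\<lambda>k t. k ^ j * stt sol k t"])
    fix k t :: real assume t: "0 < t"
    show "((\<lambda>t. k ^ j * st sol k t) has_real_derivative k ^ j * stt sol k t) (at t)"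
      by (intro DERIV_cmult st_DERIV t)
    show "\<bar>k ^ j * st sol k t\<bar> \<le> 11 * \<epsilon> * fact (Suc j) / (1 + k\<^sup>2 * 1\<^sup>2)"
      by (rule fact_moment_mono[OF state_moments(2)[OF t]])
    show "\<bar>k * (k ^ j * st sol k t)\<bar> \<le> 11 * \<epsilon> * fact (Suc j) / (1 + k\<^sup>2 * 1\<^sup>2)"
      using state_moments(2)[OF t, of k "Suc j"] by (simp only: power_Suc mult.assoc)
    show "\<bar>k ^ j * stt sol k t\<bar> \<le> 11 * \<epsilon> * fact (Suc j) / (1 + k\<^sup>2 * 1\<^sup>2)"
      by (rule fact_moment_mono[OF state_moments(3)[OF t]])
  qed (measurable, rule p)
  then show ?thesis
    by (simp add: ut_def[abs_def] utt_def mult.assoc mult.left_commute)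
qed

lemma utt_DERIV_x:
  assumes t: "0 < t"
  shows "((\<lambda>x. utt j (x, t)) has_real_derivative utt (Suc j) (x, t)) (at x)"
proof -
  have "(ft j (\<lambda>k. k ^ j * stt sol k t) has_real_derivative
      ft (Suc j) (\<lambda>k. k * (k ^ j * stt sol k t)) x) (at x)"
  proof (rule ft_has_derivative_x[where C="11 * \<epsilon> * fact (Suc j)"])
    fix k :: real
    show "\<bar>k ^ j * stt sol k t\<bar> \<le> 11 * \<epsilon> * fact (Suc j) / (1 + k\<^sup>2 * 1\<^sup>2)"
      by (rule fact_moment_mono[OF state_moments(3)[OF t]])
    show "\<bar>k * (k ^ j * stt sol k t)\<bar> \<le> 11 * \<epsilon> * fact (Suc j) / (1 + k\<^sup>2 * 1\<^sup>2)"
      using state_moments(3)[OF t, of k "Suc j"] by (simp only: power_Suc mult.assoc)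
  qed measurable
  then show ?thesis by (simp add: utt_def mult.assoc)
qed

lemma ux_ut_bound:
  assumes p: "0 < snd p"
  shows "\<bar>ux j p\<bar> \<le> 11 * \<epsilon> * fact j * pi / rr (snd p)"
    and "\<bar>ut j p\<bar> \<le> 11 * \<epsilon> * fact j * pi / rr (snd p)"
  unfolding ux_def ut_def ft_def using p
  by (intro integrable_phase(2) symbol_bound_moment state_symbol_bounds rr_pos; measurable; simp)+

lemma ft_2: "ft (Suc (Suc 0)) g x = - ft 0 g x"
proof -
  have "cos (y + pi) = - cos y" for y :: real by simp
  then show ?thesis by (simp add: ft_def)
qed

lemma cft_rhs_form:
  assumes r: "0 < r" and b: "symbol_bound K1 r c1" "symbol_bound K2 r c2" "symbol_bound K3 r c3"
    "symbol_bound K4 r c4" "symbol_bound K5 r c5"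
  shows "cft (\<lambda>k. c1 k - c2 k + c3 k - 2 * c4 k + c5 k) x
    = cft c1 x - cft c2 x + cft c3 x - 2 * cft c4 x + cft c5 x"
  unfolding cft_def using b[THEN cft_integrable, OF r]
  by (simp add: left_diff_distrib distrib_right mult.assoc Bochner_Integration.integral_diff
      Bochner_Integration.integral_add)

text \<open>The fixed point equation \<open>sol_eq\<close>, transformed back to functions and solved for \<open>u\<^sub>t\<^sub>t\<close>. The
  symbols \<open>st\<close>, \<open>stt\<close>, \<open>k * sx\<close> are even and \<open>sx\<close>, \<open>k * st\<close> are odd, so all transforms
  are real or imaginary.\<close>

lemma soliton_equation:
  assumes q: "0 < snd q"
  shows "(1 + (ux 0 q)\<^sup>2) * utt 0 q
    = ut 0 q * (1 + (ux 0 q)\<^sup>2 + (ut 0 q)\<^sup>2) - (1 + (ut 0 q)\<^sup>2) * ux 1 q + 2 * ux 0 q * ut 0 q * ut 1 q"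
proof -
  define t where "t = snd q"
  define x where "x = fst q"
  define A where "A = (\<lambda>k. sx sol k t)"
  define B where "B = (\<lambda>k. st sol k t)"
  define D where "D = (\<lambda>k. stt sol k t)"
  define XA where "XA = (\<lambda>k. k * sx sol k t)"
  define XB where "XB = (\<lambda>k. k * st sol k t)"
  have t: "0 < t" using q by (simp add: t_def)
  define r where "r = rr t"
  have r: "0 < r" using t by (simp add: r_def rr_pos)
  note s = state_symbol_bounds[OF t, folded A_def B_def D_def XA_def XB_def r_def]
  have F: "symbol_bound \<epsilon> r (\<lambda>k. sol k t)"
    unfolding symbol_bound_def r_def
  proof (intro conjI allI)
    show "(\<lambda>k. sol k t) \<in> borel_measurable borel"
      by (rule measurable_at[OF source_boundD(1)[OF sol_source_bound]])
    show "\<bar>sol k t\<bar> \<le> \<epsilon> * mj (rr t) k" for k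
      using source_boundD(3)[OF sol_source_bound, of t k] wt_le(1)[of t k] t profile_small
      by (meson less_imp_le mult_left_mono order_trans)
  qed
  note e = state_even[of sol, OF ext[OF sol_even]]
  have cA: "cft A x = - \<i> * of_real (ux 0 q)"
    using cft_odd[OF s(1) r, of x] e(2) by (simp add: A_def ux_def t_def x_def)
  have cXB: "cft XB x = - \<i> * of_real (ut 1 q)"
    using cft_odd[OF s(4) r, of x] e(3) by (simp add: XB_def ut_def t_def x_def)
  have cB: "cft B x = of_real (ut 0 q)"
    using cft_even[OF s(3) r, of x] e(3) by (simp add: B_def ut_def t_def x_def)
  have cD: "cft D x = of_real (utt 0 q)"
    using cft_even[OF s(5) r, of x] e(4) by (simp add: D_def utt_def t_def x_def)
  have cXA: "cft XA x = - of_real (ux 1 q)"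
    using cft_even[OF s(2) r, of x] e(2) by (simp add: XA_def ux_def t_def x_def ft_2)
  note c = symbol_bound_conv[OF r]
  note cc = cft_conv[OF _ _ r]
  have "cft (\<lambda>k. sol k t) x = cft (\<lambda>k. conv B (conv B B) k - conv B (conv A A) k
      + conv B (conv B XA) k - 2 * conv B (conv A XB) k + conv D (conv A A) k) x"
    using sol_eq[of t] t by (simp add: rhs_def Let_def A_def B_def D_def XA_def XB_def)
  also have "\<dots> = cft (conv B (conv B B)) x - cft (conv B (conv A A)) x
      + cft (conv B (conv B XA)) x - 2 * cft (conv B (conv A XB)) x + cft (conv D (conv A A)) x"
    by (rule cft_rhs_form[OF r c[OF s(3) c[OF s(3) s(3)]] c[OF s(3) c[OF s(1) s(1)]]
      c[OF s(3) c[OF s(3) s(2)]] c[OF s(3) c[OF s(1) s(4)]] c[OF s(5) c[OF s(1) s(1)]]])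
  also have "\<dots> = cft B x * (cft B x * cft B x) - cft B x * (cft A x * cft A x)
      + cft B x * (cft B x * cft XA x) - 2 * (cft B x * (cft A x * cft XB x)) + cft D x * (cft A x * cft A x)"
    by (simp only: cc[OF s(3) c[OF s(3) s(3)]] cc[OF s(3) c[OF s(1) s(1)]]
      cc[OF s(3) c[OF s(3) s(2)]] cc[OF s(3) c[OF s(1) s(4)]] cc[OF s(5) c[OF s(1) s(1)]]
      cc[OF s(3) s(3)] cc[OF s(1) s(1)] cc[OF s(3) s(2)] cc[OF s(1) s(4)])
  finally have 1: "cft (\<lambda>k. sol k t) x = \<dots>" .
  have "D = (\<lambda>k. B k + XA k + sol k t)"
    by (simp add: D_def B_def XA_def stt_def[abs_def])
  then have 2: "cft D x = cft B x + cft XA x + cft (\<lambda>k. sol k t) x"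
    unfolding cft_def using s(3,2)[THEN cft_integrable, OF r] cft_integrable[OF F r]
    by (simp add: distrib_right Bochner_Integration.integral_add)
  define b p d pxx pxt where "b = ut 0 q" "p = ux 0 q" "d = utt 0 q" "pxx = ux 1 q" "pxt = ut 1 q"
  note defs = this
  have "complex_of_real d = of_real (b - pxx + (b * b * b + b * p * p - b * b * pxx + 2 * b * p * pxt - d * p * p))"
    using 2 unfolding 1 cA cB cD cXA cXB defs[symmetric]
    by (simp add: complex_eq_iff algebra_simps)
  then have "d = b - pxx + (b * b * b + b * p * p - b * b * pxx + 2 * b * p * pxt - d * p * p)"
    by (simp only: of_real_eq_iff)
  then show ?thesis unfolding defs[symmetric] by (simp add: power2_eq_square algebra_simps)
qed

subsection \<open>The algebra generated by the derivatives\<close>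

text \<open>The equation for \<open>u\<^sub>t\<^sub>t\<close> is divided by \<open>1 + u\<^sub>x\<^sup>2\<close>. Subtracting \<open>1\<close> from the reciprocal
  gives a generator that tends to zero, like the others.\<close>

definition uq :: "real \<times> real \<Rightarrow> real" where
  "uq p = 1 / (1 + (ux 0 p)\<^sup>2) - 1"

text \<open>An algebra without unit, so that every element inherits the limit zero from the generators.\<close>

inductive dalg :: "(real \<times> real \<Rightarrow> real) \<Rightarrow> bool" where
  dalg_ux: "dalg (ux j)"
| dalg_ut: "dalg (ut j)"
| dalg_uq: "dalg uq"
| dalg_add: "dalg f \<Longrightarrow> dalg g \<Longrightarrow> dalg (\<lambda>p. f p + g p)"
| dalg_mult: "dalg f \<Longrightarrow> dalg g \<Longrightarrow> dalg (\<lambda>p. f p * g p)"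
| dalg_cmult: "dalg f \<Longrightarrow> dalg (\<lambda>p. c * f p)"

lemma uq_has_derivative:
  assumes d: "(ux 0 has_derivative (\<lambda>v. fst v * a + snd v * b)) (at p)"
  shows "(uq has_derivative (\<lambda>v. fst v * (- 2 * (ux 0 p * a) + - 4 * (ux 0 p * (a * uq p)) + - 2 * (ux 0 p * (a * (uq p * uq p))))
    + snd v * (- 2 * (ux 0 p * b) + - 4 * (ux 0 p * (b * uq p)) + - 2 * (ux 0 p * (b * (uq p * uq p)))))) (at p)"
proof -
  have pos: "1 + (ux 0 p)\<^sup>2 \<noteq> 0" by (metis add_pos_nonneg less_irrefl zero_le_power2 zero_less_one)
  have q: "inverse (1 + (ux 0 p)\<^sup>2) = 1 + uq p" by (simp add: uq_def divide_inverse)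
  have "(uq has_derivative (\<lambda>v. - (inverse (1 + (ux 0 p)\<^sup>2) * (2 * (fst v * a + snd v * b) * ux 0 p)
      * inverse (1 + (ux 0 p)\<^sup>2)))) (at p)"
    unfolding uq_def[abs_def] divide_inverse using pos
    by (auto intro!: derivative_eq_intros d simp: fun_eq_iff)
  then show ?thesis unfolding q
    by (rule has_derivative_eq_rhs) (simp add: fun_eq_iff algebra_simps)
qed

lemma dalg_combine:
  "dalg f \<Longrightarrow> dalg g \<Longrightarrow> dalg h \<Longrightarrow> dalg (\<lambda>p. - 2 * (f p * g p) + - 4 * (f p * (g p * h p)) + - 2 * (f p * (g p * (h p * h p))))"
  by (intro dalg_add dalg_mult dalg_cmult)

text \<open>Derivatives in \<open>x\<close> come first: they are needed to see that \<open>utt j\<close> belongs to the algebra,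
  on which the derivatives in \<open>t\<close> rely.\<close>

lemma dalg_partial_x:
  assumes "dalg g"
  shows "\<exists>gx. dalg gx \<and> (\<forall>x t. 0 < t \<longrightarrow> ((\<lambda>x. g (x, t)) has_real_derivative gx (x, t)) (at x))"
  using assms
proof induction
  have *: "((\<lambda>x. g (x, t)) has_real_derivative a) (at x)"
    if "(g has_derivative (\<lambda>v. fst v * a + snd v * b)) (at (x, t))" for g :: "real \<times> real \<Rightarrow> real" and a b x t
    using has_derivative_compose[OF has_derivative_Pair[OF has_derivative_ident has_derivative_const] that]
    by (simp add: has_field_derivative_def mult_commute_abs)
  {
    case (dalg_ux j)
    show ?case using *[OF ux_has_derivative[of "(_, _)" j]] by (intro exI[of _ "ux (Suc j)"]) (auto intro: dalg.intros)
  next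
    case (dalg_ut j)
    show ?case using *[OF ut_has_derivative[of "(_, _)" j]] by (intro exI[of _ "ut (Suc j)"]) (auto intro: dalg.intros)
  next
    case dalg_uq
    show ?case
      by (rule exI, rule conjI[OF dalg_combine[OF dalg.dalg_ux[of 0] dalg.dalg_ux[of "Suc 0"] dalg.dalg_uq]],
          intro allI impI, rule *[OF uq_has_derivative[OF ux_has_derivative]]) simp
  next
    case (dalg_add f g)
    then obtain fx gx where "dalg fx" "dalg gx"
      "\<forall>x t. 0 < t \<longrightarrow> ((\<lambda>x. f (x, t)) has_real_derivative fx (x, t)) (at x)"
      "\<forall>x t. 0 < t \<longrightarrow> ((\<lambda>x. g (x, t)) has_real_derivative gx (x, t)) (at x)" by blast
    then show ?case
      by (intro exI[of _ "\<lambda>p. fx p + gx p"]) (auto intro: dalg.intros DERIV_add)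
  next
    case (dalg_mult f g)
    then obtain fx gx where h: "dalg fx" "dalg gx"
      "\<forall>x t. 0 < t \<longrightarrow> ((\<lambda>x. f (x, t)) has_real_derivative fx (x, t)) (at x)"
      "\<forall>x t. 0 < t \<longrightarrow> ((\<lambda>x. g (x, t)) has_real_derivative gx (x, t)) (at x)" by blast
    then show ?case using dalg_mult(1,2)
      by (intro exI[of _ "\<lambda>p. fx p * g p + gx p * f p"]) (auto intro!: dalg.intros DERIV_mult)
  next
    case (dalg_cmult f c)
    then obtain fx where "dalg fx"
      "\<forall>x t. 0 < t \<longrightarrow> ((\<lambda>x. f (x, t)) has_real_derivative fx (x, t)) (at x)" by blast
    then show ?case
      by (intro exI[of _ "\<lambda>p. c * fx p"]) (auto intro: dalg.intros DERIV_cmult)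
  }
qed

text \<open>Differentiating the equation for \<open>u\<^sub>t\<^sub>t\<close> in \<open>x\<close> stays within the algebra.\<close>

lemma utt_dalg: "\<exists>g. dalg g \<and> (\<forall>x t. 0 < t \<longrightarrow> utt j (x, t) = g (x, t))"
proof (induction j)
  case 0
  define e where "e p = ut 0 p + (ut 0 p * (ux 0 p * ux 0 p) + (ut 0 p * (ut 0 p * ut 0 p) + (- 1 * ux 1 p
     + (- 1 * (ut 0 p * (ut 0 p * ux 1 p)) + 2 * (ux 0 p * (ut 0 p * ut 1 p))))))" for p
  have e: "dalg e" unfolding e_def[abs_def] by (intro dalg.intros)
  have "dalg (\<lambda>p. e p + uq p * e p)" by (intro dalg.intros e)
  moreover have "utt 0 (x, t) = e (x, t) + uq (x, t) * e (x, t)" if t: "0 < t" for x t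
  proof -
    have pos: "1 + (ux 0 (x, t))\<^sup>2 \<noteq> 0" by (metis add_pos_nonneg less_irrefl zero_le_power2 zero_less_one)
    have "(1 + (ux 0 (x, t))\<^sup>2) * utt 0 (x, t) = e (x, t)"
      using soliton_equation[of "(x, t)"] t by (simp add: e_def power2_eq_square algebra_simps)
    moreover have "e (x, t) + uq (x, t) * e (x, t) = e (x, t) / (1 + (ux 0 (x, t))\<^sup>2)"
      by (simp add: uq_def algebra_simps)
    moreover from calculation(1) pos have "utt 0 (x, t) = e (x, t) / (1 + (ux 0 (x, t))\<^sup>2)"
      by (metis nonzero_mult_div_cancel_left)
    ultimately show ?thesis by simp
  qed
  ultimately show ?case by blast
next
  case (Suc j)
  then obtain g where g: "dalg g" "\<forall>x t. 0 < t \<longrightarrow> utt j (x, t) = g (x, t)" by blast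
  obtain gx where gx: "dalg gx" "\<forall>x t. 0 < t \<longrightarrow> ((\<lambda>x. g (x, t)) has_real_derivative gx (x, t)) (at x)"
    using dalg_partial_x[OF g(1)] by blast
  have "utt (Suc j) (x, t) = gx (x, t)" if t: "0 < t" for x t
  proof -
    have "(\<lambda>x. utt j (x, t)) = (\<lambda>x. g (x, t))" using g(2) t by auto
    with utt_DERIV_x[OF t, of j x] gx(2) t show ?thesis by (metis DERIV_unique)
  qed
  with gx(1) show ?case by blast
qed

lemma dalg_has_derivative:
  assumes "dalg g"
  shows "\<exists>gx gt. dalg gx \<and> dalg gt \<and>
    (\<forall>p. 0 < snd p \<longrightarrow> (g has_derivative (\<lambda>v. fst v * gx p + snd v * gt p)) (at p))"
  using assms
proof induction
  case (dalg_ux j)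
  show ?case using ux_has_derivative[of _ j] dalg.dalg_ux dalg.dalg_ut by blast
next
  case (dalg_ut j)
  obtain g where g: "dalg g" "\<forall>x t. 0 < t \<longrightarrow> utt j (x, t) = g (x, t)" using utt_dalg by blast
  have "(ut j has_derivative (\<lambda>v. fst v * ut (Suc j) p + snd v * g p)) (at p)" if "0 < snd p" for p
    using ut_has_derivative[OF that, of j] g(2) that by (metis prod.collapse)
  with g(1) show ?case using dalg.dalg_ut by blast
next
  case dalg_uq
  show ?case
    by (rule exI, rule exI, rule conjI[OF dalg_combine[OF dalg.dalg_ux[of 0] dalg.dalg_ux[of "Suc 0"] dalg.dalg_uq]],
        rule conjI[OF dalg_combine[OF dalg.dalg_ux[of 0] dalg.dalg_ut[of "Suc 0"] dalg.dalg_uq]])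
      (intro allI impI uq_has_derivative ux_has_derivative)
next
  case (dalg_add f g)
  then obtain fx ft gx gt where h: "dalg fx" "dalg ft" "dalg gx" "dalg gt"
    "\<forall>p. 0 < snd p \<longrightarrow> (f has_derivative (\<lambda>v. fst v * fx p + snd v * ft p)) (at p)"
    "\<forall>p. 0 < snd p \<longrightarrow> (g has_derivative (\<lambda>v. fst v * gx p + snd v * gt p)) (at p)" by blast
  have "((\<lambda>p. f p + g p) has_derivative (\<lambda>v. fst v * (fx p + gx p) + snd v * (ft p + gt p))) (at p)"
    if "0 < snd p" for p
    by (rule has_derivative_eq_rhs[OF has_derivative_add[OF h(5,6)[rule_format, OF that]]])
      (simp add: fun_eq_iff algebra_simps)
  then show ?case using dalg.dalg_add[OF h(1,3)] dalg.dalg_add[OF h(2,4)] by blast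
next
  case (dalg_mult f g)
  then obtain fx ft gx gt where h: "dalg fx" "dalg ft" "dalg gx" "dalg gt"
    "\<forall>p. 0 < snd p \<longrightarrow> (f has_derivative (\<lambda>v. fst v * fx p + snd v * ft p)) (at p)"
    "\<forall>p. 0 < snd p \<longrightarrow> (g has_derivative (\<lambda>v. fst v * gx p + snd v * gt p)) (at p)" by blast
  have "((\<lambda>p. f p * g p) has_derivative (\<lambda>v. fst v * (fx p * g p + f p * gx p) + snd v * (ft p * g p + f p * gt p))) (at p)"
    if "0 < snd p" for p
    by (rule has_derivative_eq_rhs[OF has_derivative_mult[OF h(5,6)[rule_format, OF that]]])
      (simp add: fun_eq_iff algebra_simps)
  then show ?case
    using dalg.dalg_add[OF dalg.dalg_mult[OF h(1) dalg_mult(2)] dalg.dalg_mult[OF dalg_mult(1) h(3)]]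
      dalg.dalg_add[OF dalg.dalg_mult[OF h(2) dalg_mult(2)] dalg.dalg_mult[OF dalg_mult(1) h(4)]]
    by blast
next
  case (dalg_cmult f c)
  then obtain fx ft where h: "dalg fx" "dalg ft"
    "\<forall>p. 0 < snd p \<longrightarrow> (f has_derivative (\<lambda>v. fst v * fx p + snd v * ft p)) (at p)" by blast
  have "((\<lambda>p. c * f p) has_derivative (\<lambda>v. fst v * (c * fx p) + snd v * (c * ft p))) (at p)"
    if "0 < snd p" for p
    by (rule has_derivative_eq_rhs[OF has_derivative_mult_right[OF h(3)[rule_format, OF that]]])
      (simp add: fun_eq_iff algebra_simps)
  then show ?case using dalg.dalg_cmult[OF h(1), of c] dalg.dalg_cmult[OF h(2), of c] by blast
qed

lemma rr_at_top: "filterlim rr at_top at_top"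
  unfolding rr_def[abs_def]
  by (intro filterlim_compose[OF sqrt_at_top] filterlim_tendsto_add_at_top[OF tendsto_const]
      filterlim_at_top_mult_tendsto_pos[OF tendsto_const _ filterlim_ident, of "1/2", simplified]) 

lemma dalg_tendsto:
  assumes "dalg g"
  shows "(g \<longlongrightarrow> 0) (filtercomap snd at_top)"
proof -
  have ev: "\<forall>\<^sub>F p in filtercomap snd at_top. 0 < snd (p :: real \<times> real)"
    using eventually_filtercomapI[OF eventually_gt_at_top[of 0]] .
  have lim: "((\<lambda>p. C / rr (snd p)) \<longlongrightarrow> 0) (filtercomap snd at_top)" for C
    by (intro real_tendsto_divide_at_top[OF tendsto_const] filterlim_compose[OF rr_at_top] filterlim_filtercomap)
  from assms show ?thesis
  proof induction
    case (dalg_ux j)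
    show ?case
      by (rule Lim_null_comparison[OF _ lim[of "11 * \<epsilon> * fact j * pi"]], rule eventually_mono[OF ev])
        (simp add: ux_ut_bound)
  next
    case (dalg_ut j)
    show ?case
      by (rule Lim_null_comparison[OF _ lim[of "11 * \<epsilon> * fact j * pi"]], rule eventually_mono[OF ev])
        (simp add: ux_ut_bound)
  next
    case dalg_uq
    have "(ux 0 \<longlongrightarrow> 0) (filtercomap snd at_top)"
      by (rule Lim_null_comparison[OF _ lim[of "11 * \<epsilon> * fact 0 * pi"]], rule eventually_mono[OF ev])
        (simp only: real_norm_def ux_ut_bound)
    then have "((\<lambda>p. 1 / (1 + (ux 0 p)\<^sup>2) - 1) \<longlongrightarrow> 1 / (1 + 0\<^sup>2) - 1) (filtercomap snd at_top)"
      by (intro tendsto_intros) auto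
    then show ?case by (simp add: uq_def[abs_def])
  qed (auto intro: tendsto_add_zero tendsto_mult_zero tendsto_mult_right_zero)
qed

end

section \<open>The linear solution\<close>

text \<open>Up to a constant factor, the transform of the datum is \<open>cutoff k * osc \<tau> k / \<bar>k\<bar>\<close>. For small
  \<open>k > 0\<close> its primitive behaves like \<open>sin (\<tau> * ln k) / \<tau>\<close>, which is bounded, has no limit as
  \<open>k\<close> tends to zero, and is large for small \<open>\<tau>\<close>.\<close>

definition cutoff :: "real \<Rightarrow> real" where
  "cutoff k = exp (- \<bar>k\<bar>) / (1 + k\<^sup>2)\<^sup>2"

definition osc :: "real \<Rightarrow> real \<Rightarrow> real" where
  "osc \<tau> k = cos (\<tau> * ln \<bar>k\<bar>)"

lemma cutoff_bounds: "0 \<le> cutoff k" "cutoff k \<le> 1" "cutoff k * (1 + k\<^sup>2) \<le> 1"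
proof -
  have q: "1 \<le> 1 + k\<^sup>2" by simp
  show "0 \<le> cutoff k" by (simp add: cutoff_def)
  have e: "exp (- \<bar>k\<bar>) \<le> 1" by simp
  have "exp (- \<bar>k\<bar>) \<le> 1 + k\<^sup>2" using e q by linarith
  then show 1: "cutoff k * (1 + k\<^sup>2) \<le> 1"
    by (simp add: cutoff_def power2_eq_square[of "1 + k\<^sup>2"] divide_simps add_pos_nonneg)
  have "cutoff k * 1 \<le> cutoff k * (1 + k\<^sup>2)"
    by (intro mult_left_mono) (auto simp: cutoff_def)
  with 1 show "cutoff k \<le> 1" by simp
qed

lemma one_minus_cutoff:
  assumes "0 \<le> k" "k \<le> 1"
  shows "1 - cutoff k \<le> 3 * k"
proof -
  define q where "q = 1 / (1 + k\<^sup>2)\<^sup>2"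
  have q0: "0 \<le> q" "q \<le> 1" by (auto simp: q_def divide_le_eq_1 intro: one_le_power)
  have x: "k\<^sup>2 \<le> k" using assms by (simp add: power2_eq_square mult_left_le)
  have "1 - 2 * k\<^sup>2 \<le> q"
  proof -
    have "(1 - 2 * z) * (1 + z)\<^sup>2 \<le> 1" if "0 \<le> z" for z :: real
    proof -
      have "1 - (1 - 2 * z) * (1 + z)\<^sup>2 = 3 * z\<^sup>2 + 2 * z ^ 3"
        by (simp add: power2_eq_square power3_eq_cube algebra_simps)
      then show ?thesis using that by (smt (verit) zero_le_power)
    qed
    then have "(1 - 2 * k\<^sup>2) * (1 + k\<^sup>2)\<^sup>2 \<le> 1" by simp
    moreover have "0 < (1 + k\<^sup>2)\<^sup>2" by (intro zero_less_power add_pos_nonneg) auto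
    ultimately show ?thesis by (simp add: q_def pos_le_divide_eq)
  qed
  moreover have "1 - k \<le> exp (- k)" using exp_ge_add_one_self[of "- k"] by simp
  moreover have "0 \<le> (1 - exp (- k)) * (1 - q)" using q0 assms by (intro mult_nonneg_nonneg) auto
  moreover have "cutoff k = exp (- k) * q" using assms by (simp add: cutoff_def q_def)
  ultimately show ?thesis using x by (simp add: algebra_simps)
qed

lemma one_minus_cos_le: "1 - cos y \<le> \<bar>y :: real\<bar>"
proof -
  have "1 - cos y = 2 * (sin (y / 2))\<^sup>2" using cos_double_sin[of "y / 2"] by simp
  also have "(sin (y / 2))\<^sup>2 = \<bar>sin (y / 2)\<bar> * \<bar>sin (y / 2)\<bar>" by (simp add: power2_eq_square abs_mult[symmetric])
  also have "\<dots> \<le> 1 * \<bar>y / 2\<bar>" by (intro mult_mono abs_sin_x_le_abs_x) auto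
  finally show ?thesis by simp
qed

lemma small_frequency:
  assumes t: "0 \<le> t" and xi: "0 \<le> k" "k \<le> 1"
  shows "\<bar>cutoff k * exp (- lam k * t) * cos (k * x) - 1\<bar> \<le> k * (\<bar>x\<bar> + k * t + 3)"
proof -
  define w E c where "w = cutoff k" "E = exp (- lam k * t)" "c = cos (k * x)"
  have w: "0 \<le> w" "w \<le> 1" "1 - w \<le> 3 * k"
    using cutoff_bounds one_minus_cutoff[OF xi] by (auto simp: w_E_c_def)
  have E: "0 \<le> E" "E \<le> 1" using t by (auto simp: w_E_c_def)
  have "1 - E \<le> lam k * t" using exp_ge_add_one_self[of "- lam k * t"] by (simp add: w_E_c_def)
  also have "\<dots> \<le> k\<^sup>2 * t" by (intro mult_right_mono lam_le_square t)
  finally have E3: "1 - E \<le> k\<^sup>2 * t" .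
  have c: "\<bar>c\<bar> \<le> 1" "1 - c \<le> k * \<bar>x\<bar>"
    using one_minus_cos_le[of "k * x"] xi by (auto simp: w_E_c_def abs_mult)
  \<comment> \<open>Deviations from \<open>1\<close> of factors in the unit interval at most add up in a product.\<close>
  have "0 \<le> (1 - w) * (1 - E)" using w E by simp
  then have 1: "1 - w * E \<le> (1 - w) + (1 - E)" by (simp add: algebra_simps)
  have wE: "0 \<le> w * E" "w * E \<le> 1" using w E by (auto intro: mult_le_one)
  have "0 \<le> (1 - w * E) * (1 - c)" using wE c by (intro mult_nonneg_nonneg) auto
  then have 2: "1 - w * E * c \<le> (1 - w * E) + (1 - c)" by (simp add: algebra_simps)
  have "\<bar>w * E * c\<bar> \<le> 1" using wE c by (simp add: abs_mult mult_le_one)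
  then have "\<bar>w * E * c - 1\<bar> = 1 - w * E * c" by linarith
  also have "\<dots> \<le> 3 * k + k\<^sup>2 * t + k * \<bar>x\<bar>" using 1 2 w(3) E3 c(2) by linarith
  also have "\<dots> = k * (\<bar>x\<bar> + k * t + 3)" by (simp add: algebra_simps power2_eq_square)
  finally show ?thesis by (simp add: w_E_c_def)
qed

text \<open>The integral of \<open>osc \<tau> k / \<bar>k\<bar>\<close> does not converge at \<open>k = 0\<close>. Solutions may be changed by
  constants, and the subtraction of this divergent constant, restricted to \<open>\<bar>k\<bar> \<le> 1\<close>, restores
  convergence.\<close>

definition lin_int :: "real \<Rightarrow> real \<Rightarrow> real \<Rightarrow> real \<Rightarrow> real" where
  "lin_int \<tau> x t k = cutoff k * osc \<tau> k / \<bar>k\<bar> * exp (- lam k * t) * cos (k * x)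
     - (if \<bar>k\<bar> \<le> 1 then osc \<tau> k / \<bar>k\<bar> else 0)"

lemma lin_int_small:
  assumes "0 \<le> t" "0 \<le> k" "k \<le> 1"
  shows "\<bar>lin_int \<tau> x t k\<bar> \<le> \<bar>x\<bar> + k * t + 3"
proof (cases "k = 0")
  case False
  have "lin_int \<tau> x t k = (cutoff k * exp (- lam k * t) * cos (k * x) - 1) * osc \<tau> k / k"
    using assms False by (simp add: lin_int_def field_simps)
  then have "\<bar>lin_int \<tau> x t k\<bar> = \<bar>cutoff k * exp (- lam k * t) * cos (k * x) - 1\<bar> * \<bar>osc \<tau> k\<bar> / k"
    using assms by (simp add: abs_mult)
  also have "\<dots> \<le> k * (\<bar>x\<bar> + k * t + 3) * 1 / k"
    using small_frequency[OF assms, of x] assms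
    by (intro divide_right_mono mult_mono) (auto simp: osc_def)
  finally show ?thesis using False assms by simp
qed (use assms in \<open>simp add: lin_int_def\<close>)

lemma lin_int_even: "lin_int \<tau> x t (- k) = lin_int \<tau> x t k"
  by (simp add: lin_int_def cutoff_def osc_def)

lemma lin_int_measurable [measurable]: "lin_int \<tau> x t \<in> borel_measurable borel"
  unfolding lin_int_def[abs_def] cutoff_def osc_def by measurable

lemma lin_int_bound:
  assumes t: "0 \<le> t"
  shows "\<bar>lin_int \<tau> x t k\<bar> \<le> 2 * (\<bar>x\<bar> + t + 3) / (1 + k\<^sup>2 * 1\<^sup>2)"
proof -
  have *: "\<bar>lin_int \<tau> x t k\<bar> \<le> 2 * (\<bar>x\<bar> + t + 3) / (1 + k\<^sup>2)" if xi: "0 \<le> k" for k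
  proof (cases "k \<le> 1")
    case True
    have "k * t \<le> t" using t xi True by (simp add: mult_left_le_one_le)
    then have "\<bar>lin_int \<tau> x t k\<bar> \<le> \<bar>x\<bar> + t + 3" using lin_int_small[OF t xi True, of \<tau> x] by linarith
    also have "\<dots> = 2 * (\<bar>x\<bar> + t + 3) / 2" by simp
    also have "\<dots> \<le> 2 * (\<bar>x\<bar> + t + 3) / (1 + k\<^sup>2)"
      using t xi True by (intro divide_left_mono mult_pos_pos add_pos_nonneg) (auto simp: power_le_one)
    finally show ?thesis .
  next
    case False
    have c: "cutoff k \<le> 1 / (1 + k\<^sup>2)"
      using cutoff_bounds(3)[of k] by (simp add: pos_le_divide_eq add_pos_nonneg)
    have "\<bar>lin_int \<tau> x t k\<bar> = cutoff k * \<bar>osc \<tau> k\<bar> * (1 / k) * exp (- lam k * t) * \<bar>cos (k * x)\<bar>"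
      using False xi cutoff_bounds(1)[of k] by (simp add: lin_int_def abs_mult)
    also have "\<dots> \<le> 1 / (1 + k\<^sup>2) * 1 * 1 * 1 * 1"
      using False t c cutoff_bounds(1)[of k] by (intro mult_mono) (auto simp: osc_def)
    also have "\<dots> \<le> 2 * (\<bar>x\<bar> + t + 3) / (1 + k\<^sup>2)"
      using t by (simp add: divide_right_mono add_nonneg_nonneg)
    finally show ?thesis .
  qed
  have "\<bar>lin_int \<tau> x t \<bar>k\<bar>\<bar> \<le> 2 * (\<bar>x\<bar> + t + 3) / (1 + \<bar>k\<bar>\<^sup>2)" by (rule *) simp
  moreover have "lin_int \<tau> x t \<bar>k\<bar> = lin_int \<tau> x t k" by (cases "0 \<le> k") (auto simp: lin_int_even)
  ultimately show ?thesis by simp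
qed

lemma lin_int_integrable: "0 \<le> t \<Longrightarrow> integrable lborel (lin_int \<tau> x t)"
  by (rule integrable_le_cauchy(1)[where r=1, OF _ lin_int_measurable]) (use lin_int_bound in auto)

lemma even_integral:
  fixes F :: "real \<Rightarrow> real"
  assumes i: "integrable lborel F" and e: "\<And>k. F (- k) = F k"
  shows "integral\<^sup>L lborel F = 2 * (LINT k:{0..}|lborel. F k)"
proof -
  have s: "set_integrable lborel A F" if "A \<in> sets borel" for A
    unfolding set_integrable_def using i that by (intro integrable_mult_indicator) auto
  have "integral\<^sup>L lborel F = (LINT k:{..<0} \<union> {0..}|lborel. F k)"
    unfolding set_lebesgue_integral_def by (rule Bochner_Integration.integral_cong) (auto simp: indicator_def)
  also have "\<dots> = (LINT k:{..<0}|lborel. F k) + (LINT k:{0..}|lborel. F k)"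
    by (rule set_integral_Un) (auto intro: s)
  also have "(LINT k:{..<0}|lborel. F k) = (LINT k|lborel. indicator {..<0} (0 + - 1 * k) *\<^sub>R F (0 + - 1 * k))"
    unfolding set_lebesgue_integral_def
    by (subst lborel_integral_real_affine[where c="-1" and t=0]) auto
  also have "\<dots> = (LINT k:{0<..}|lborel. F k)"
    unfolding set_lebesgue_integral_def
    by (rule Bochner_Integration.integral_cong) (auto simp: indicator_def e)
  also have "\<dots> = (LINT k:{0..}|lborel. F k)"
  proof -
    have "(LINT k:{0..}|lborel. F k) = (LINT k:{0} \<union> {0<..}|lborel. F k)"
      by (rule arg_cong[where f="\<lambda>A. set_lebesgue_integral lborel A F"]) auto
    also have "\<dots> = (LINT k:{0}|lborel. F k) + (LINT k:{0<..}|lborel. F k)"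
      by (rule set_integral_Un) (auto intro: s)
    also have "(LINT k:{0}|lborel. F k) = (LINT k::real|lborel. 0)"
      unfolding set_lebesgue_integral_def
    proof (rule integral_cong_AE)
      have [measurable]: "F \<in> borel_measurable borel" using i by (simp add: borel_measurable_integrable)
      show "(\<lambda>k. indicat_real {0} k *\<^sub>R F k) \<in> borel_measurable lborel" by measurable
      show "AE k in lborel. indicat_real {0} k *\<^sub>R F k = 0"
        using AE_lborel_singleton[of "0::real"] by eventually_elim (simp add: indicator_def)
    qed simp
    finally show ?thesis by simp
  qed
  finally show ?thesis by simp
qed

lemma cutoff_has_derivative:
  assumes "0 < k"
  shows "(cutoff has_real_derivative
    - (exp (- k) / (1 + k\<^sup>2)\<^sup>2 + 4 * k * exp (- k) / (1 + k\<^sup>2) ^ 3)) (at k)"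
proof -
  have p: "1 + k\<^sup>2 \<noteq> 0" by (metis add_pos_nonneg less_irrefl zero_le_power2 zero_less_one)
  have "((\<lambda>k. exp (- k) / (1 + k\<^sup>2)\<^sup>2) has_real_derivative
    - (exp (- k) / (1 + k\<^sup>2)\<^sup>2 + 4 * k * exp (- k) / (1 + k\<^sup>2) ^ 3)) (at k)"
    using p by (auto intro!: derivative_eq_intros simp: divide_simps power_numeral_reduce) (simp add: algebra_simps)
  then show ?thesis
    by (rule has_field_derivative_transform_within[where d=k])
      (use assms in \<open>auto simp: cutoff_def dist_real_def\<close>)
qed

text \<open>For \<open>\<eta> = 1 / sqrt (x\<^sup>2 + t)\<close> and \<open>x\<^sup>2 \<le> t\<close> the bound is at most \<open>1\<close>: in this regime the
  frequencies above \<open>\<eta>\<close> are damped by the flow.\<close>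

lemma far_frequencies_diffusive:
  assumes t: "0 < t" and \<eta>: "0 < \<eta>" "\<eta> \<le> b"
    and h: "continuous_on {\<eta>..b} (\<lambda>k. cutoff k * osc \<tau> k / k * exp (- lam k * t) * cos (k * x))"
  shows "\<bar>integral {\<eta>..b} (\<lambda>k. cutoff k * osc \<tau> k / k * exp (- lam k * t) * cos (k * x))\<bar>
    \<le> 1 / (2 * t * \<eta>\<^sup>2)"
proof -
  have "\<bar>integral {\<eta>..b} (\<lambda>k. cutoff k * osc \<tau> k / k * exp (- lam k * t) * cos (k * x))\<bar>
    \<le> - (1 / (2 * t * b\<^sup>2)) - - (1 / (2 * t * \<eta>\<^sup>2))"
  proof (rule integral_abs_le_primitive[OF \<eta>(2) h, where \<phi>="\<lambda>k. 1 / (t * k ^ 3)"])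
    fix k assume "k \<in> {\<eta>..b}"
    then have xi: "0 < k" using \<eta> by auto
    have y: "y * exp (- y) \<le> 1" for y :: real
    proof -
      have "y \<le> exp y" using exp_ge_add_one_self[of y] by linarith
      then show ?thesis by (simp add: exp_minus field_simps)
    qed
    have "k\<^sup>2 * (t * (cutoff k * exp (- lam k * t))) \<le> lam k * (1 + k\<^sup>2) * (t * (cutoff k * exp (- lam k * t)))"
      using t cutoff_bounds(1)[of k] by (intro mult_right_mono square_le_lam) auto
    also have "\<dots> = (cutoff k * (1 + k\<^sup>2)) * (lam k * t * exp (- (lam k * t)))" by simp
    also have "\<dots> \<le> 1 * 1"
      using t by (intro mult_mono cutoff_bounds y) auto
    finally have 1: "cutoff k * exp (- lam k * t) \<le> 1 / (t * k\<^sup>2)"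
      using t xi by (simp add: field_simps)
    have "\<bar>cutoff k * osc \<tau> k / k * exp (- lam k * t) * cos (k * x)\<bar>
      = (cutoff k * exp (- lam k * t)) * (\<bar>osc \<tau> k\<bar> * \<bar>cos (k * x)\<bar>) / k"
      using xi cutoff_bounds(1)[of k] by (simp add: abs_mult)
    also have "\<dots> \<le> (1 / (t * k\<^sup>2)) * (1 * 1) / k"
      using 1 xi t by (intro divide_right_mono mult_mono) (auto simp: osc_def)
    finally show "\<bar>cutoff k * osc \<tau> k / k * exp (- lam k * t) * cos (k * x)\<bar> \<le> 1 / (t * k ^ 3)"
      by (simp add: power2_eq_square power3_eq_cube mult.assoc)
    show "((\<lambda>k. - (1 / (2 * t * k\<^sup>2))) has_real_derivative 1 / (t * k ^ 3)) (at k within {\<eta>..b})"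
      using xi t by (auto intro!: derivative_eq_intros simp: field_simps power2_eq_square power3_eq_cube)
  qed
  also have "\<dots> \<le> 1 / (2 * t * \<eta>\<^sup>2)" using t by simp
  finally show ?thesis .
qed

text \<open>For \<open>x\<^sup>2 > t\<close> the frequencies above \<open>\<eta> = 1 / sqrt (x\<^sup>2 + t)\<close>, which is then comparable to
  \<open>1 / \<bar>x\<bar>\<close>, cancel by oscillation. One integration by parts gains
  \<open>1 / \<bar>x\<bar>\<close>; the factor \<open>P\<close> is decreasing, so its derivative integrates to at most \<open>1\<close>.\<close>

lemma far_frequencies_oscillating:
  assumes t: "0 < t" and \<eta>: "0 < \<eta>" "\<eta> \<le> b" and x: "x \<noteq> 0" and \<tau>: "0 \<le> \<tau>" "\<tau> \<le> 1"
    and h: "continuous_on {\<eta>..b} (\<lambda>k. cutoff k * osc \<tau> k / k * exp (- lam k * t) * cos (k * x))"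
  shows "\<bar>integral {\<eta>..b} (\<lambda>k. cutoff k * osc \<tau> k / k * exp (- lam k * t) * cos (k * x))\<bar>
    \<le> 5 / (\<bar>x\<bar> * \<eta>)"
proof -
  define w1 where "w1 k = exp (- k) / (1 + k\<^sup>2)\<^sup>2 + 4 * k * exp (- k) / (1 + k\<^sup>2) ^ 3" for k :: real
  define P where "P k = cutoff k * exp (- lam k * t)" for k
  define Q where "Q k = (w1 k + cutoff k * (2 * k / (1 + 2 * lam k) * t)) * exp (- lam k * t)" for k
  define h where "h k = P k * (osc \<tau> k / k)" for k
  define h1 where "h1 k = - Q k * (osc \<tau> k / k) - P k * ((sin (\<tau> * ln k) * \<tau> + osc \<tau> k) / k\<^sup>2)" for k
  \<comment> \<open>The derivative of \<open>\<Phi>\<close> majorizes \<open>h1\<close>, and its total increment is at most \<open>3 / \<eta>\<close>.\<close>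
  define \<Phi> where "\<Phi> k = - (P k / \<eta>) - 2 / k" for k
  have pos: "0 < k" if "k \<in> {\<eta>..b}" for k using that \<eta> by auto
  have Ed: "((\<lambda>k. exp (- lam k * t)) has_real_derivative
      - (2 * k / (1 + 2 * lam k) * t * exp (- lam k * t))) (at k)" for k
    by (auto intro!: derivative_eq_intros lam_has_derivative)
  have wd: "(cutoff has_real_derivative - w1 k) (at k)" if "0 < k" for k
    unfolding w1_def by (rule cutoff_has_derivative[OF that])
  have Pd: "(P has_real_derivative - Q k) (at k)" if "0 < k" for k
    unfolding P_def[abs_def] Q_def
    by (rule DERIV_mult[OF wd[OF that] Ed, THEN DERIV_cong]) (simp add: algebra_simps)
  have od: "(osc \<tau> has_real_derivative - sin (\<tau> * ln k) * \<tau> / k) (at k)" if "0 < k" for k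
  proof -
    have "((\<lambda>k. cos (\<tau> * ln k)) has_real_derivative - sin (\<tau> * ln k) * \<tau> / k) (at k)"
      using that by (auto intro!: derivative_eq_intros)
    then show ?thesis
      by (rule has_field_derivative_transform_within[where d=k])
        (use that in \<open>auto simp: osc_def dist_real_def\<close>)
  qed
  have hd: "(h has_real_derivative h1 k) (at k)" if "0 < k" for k
    unfolding h_def[abs_def] using that
    by (auto intro!: derivative_eq_intros Pd od simp: h1_def)
      (simp add: field_simps power2_eq_square)
  have P: "0 \<le> P k" "P k \<le> 1" for k
    using cutoff_bounds[of k] t by (auto simp: P_def intro: mult_le_one)
  have Q: "0 \<le> Q k" if "0 < k" for k
    using that t cutoff_bounds(1)[of k] lam_nonneg[of k] by (simp add: Q_def w1_def add_nonneg_nonneg)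
  have o: "\<bar>osc \<tau> k / k\<bar> \<le> 1 / \<eta>" if "k \<in> {\<eta>..b}" for k
    using that \<eta> by (auto simp: osc_def abs_divide intro!: frac_le)
  have h_le: "\<bar>h k\<bar> \<le> 1 / \<eta>" if "k \<in> {\<eta>..b}" for k
    using mult_mono[OF P(2) o[OF that]] P(1)[of k] by (simp add: h_def abs_mult)
  have h1_le: "\<bar>h1 k\<bar> \<le> Q k / \<eta> + 2 / k\<^sup>2" if "k \<in> {\<eta>..b}" for k
  proof -
    have 1: "\<bar>- Q k * (osc \<tau> k / k)\<bar> \<le> Q k * (1 / \<eta>)"
      using mult_left_mono[OF o[OF that] Q[OF pos[OF that]]] Q[OF pos[OF that]] by (simp add: abs_mult)
    have "\<bar>sin (\<tau> * ln k)\<bar> * \<tau> \<le> 1 * 1" using \<tau> by (intro mult_mono) auto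
    then have "\<bar>sin (\<tau> * ln k) * \<tau> + osc \<tau> k\<bar> \<le> 1 + 1"
      using \<tau> by (intro order_trans[OF abs_triangle_ineq] add_mono) (auto simp: abs_mult osc_def)
    then have "\<bar>(sin (\<tau> * ln k) * \<tau> + osc \<tau> k) / k\<^sup>2\<bar> \<le> 2 / k\<^sup>2"
      by (simp add: abs_divide divide_right_mono)
    then have "P k * \<bar>(sin (\<tau> * ln k) * \<tau> + osc \<tau> k) / k\<^sup>2\<bar> \<le> 1 * (2 / k\<^sup>2)"
      by (intro mult_mono P) auto
    then have 2: "\<bar>P k * ((sin (\<tau> * ln k) * \<tau> + osc \<tau> k) / k\<^sup>2)\<bar> \<le> 2 / k\<^sup>2"
      using P(1)[of k] by (simp only: abs_mult abs_of_nonneg mult_1)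
    show ?thesis unfolding h1_def using order_trans[OF abs_triangle_ineq4 add_mono[OF 1 2]] by simp
  qed
  have cont_h1: "continuous_on {\<eta>..b} h1"
  proof -
    have "continuous_on {\<eta>..b} lam" "continuous_on {\<eta>..b} cutoff" "continuous_on {\<eta>..b} (osc \<tau>)"
      "continuous_on {\<eta>..b} P"
      using DERIV_isCont[OF lam_has_derivative] DERIV_isCont[OF wd] DERIV_isCont[OF od] DERIV_isCont[OF Pd] pos
      by (blast intro: continuous_at_imp_continuous_on)+
    moreover have "1 + 2 * lam k \<noteq> 0" for k using lam_nonneg[of k] by linarith
    moreover have "1 + k\<^sup>2 \<noteq> 0" for k :: real by (metis add_pos_nonneg less_irrefl zero_le_power2 zero_less_one)
    ultimately show ?thesis
      unfolding h1_def Q_def w1_def by (intro continuous_intros) (auto dest: pos)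
  qed
  let ?g = "\<lambda>k. sin (k * x) / x * h1 k"
  let ?G = "\<lambda>k. sin (k * x) / x * h k"
  have g: "\<bar>integral {\<eta>..b} (\<lambda>k. \<bar>x\<bar> * ?g k)\<bar> \<le> \<Phi> b - \<Phi> \<eta>"
  proof (rule integral_abs_le_primitive[OF \<eta>(2), where \<phi>="\<lambda>k. Q k / \<eta> + 2 / k\<^sup>2"])
    show "continuous_on {\<eta>..b} (\<lambda>k. \<bar>x\<bar> * ?g k)" using x by (intro continuous_intros cont_h1) auto
    fix k assume xi: "k \<in> {\<eta>..b}"
    have "\<bar>\<bar>x\<bar> * ?g k\<bar> = \<bar>sin (k * x)\<bar> * \<bar>h1 k\<bar>" using x by (simp add: abs_mult)
    also have "\<dots> \<le> 1 * \<bar>h1 k\<bar>" by (intro mult_right_mono) auto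
    finally show "\<bar>\<bar>x\<bar> * ?g k\<bar> \<le> Q k / \<eta> + 2 / k\<^sup>2" using h1_le[OF xi] by linarith
    have i: "((\<lambda>k. 2 / k) has_real_derivative - (2 / k\<^sup>2)) (at k)"
      using pos[OF xi] by (auto intro!: derivative_eq_intros simp: power2_eq_square)
    have "(\<Phi> has_real_derivative - (- Q k / \<eta>) - - (2 / k\<^sup>2)) (at k)"
      unfolding \<Phi>_def[abs_def]
      by (intro DERIV_diff DERIV_minus DERIV_cdivide Pd i pos[OF xi])
    then have "(\<Phi> has_real_derivative Q k / \<eta> + 2 / k\<^sup>2) (at k)"
      by (rule DERIV_cong) simp
    then show "(\<Phi> has_real_derivative Q k / \<eta> + 2 / k\<^sup>2) (at k within {\<eta>..b})"
      by (rule has_field_derivative_at_within)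
  qed
  also have "\<Phi> b - \<Phi> \<eta> \<le> 3 / \<eta>"
  proof -
    have "0 \<le> P b / \<eta>" "0 \<le> 2 / b" "P \<eta> / \<eta> \<le> 1 / \<eta>"
      using P \<eta> by (auto intro: divide_right_mono)
    moreover have "3 / \<eta> = 1 / \<eta> + 2 / \<eta>" by (simp add: add_divide_distrib[symmetric])
    ultimately show ?thesis unfolding \<Phi>_def by linarith
  qed
  finally have g2: "\<bar>integral {\<eta>..b} ?g\<bar> \<le> 3 / (\<bar>x\<bar> * \<eta>)"
    using x \<eta> by (simp add: abs_mult field_simps)
  have "((\<lambda>k. h k * cos (k * x) + ?g k) has_integral ?G b - ?G \<eta>) {\<eta>..b}"
  proof (rule fundamental_theorem_of_calculus[OF \<eta>(2)])
    fix k assume xi: "k \<in> {\<eta>..b}"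
    have "(?G has_real_derivative h k * cos (k * x) + ?g k) (at k)"
      using x by (auto intro!: derivative_eq_intros hd pos[OF xi] simp: field_simps)
    then show "(?G has_vector_derivative h k * cos (k * x) + ?g k) (at k within {\<eta>..b})"
      by (simp add: has_real_derivative_iff_has_vector_derivative has_vector_derivative_at_within)
  qed
  moreover have "?g integrable_on {\<eta>..b}"
    using x by (intro integrable_continuous_interval continuous_intros cont_h1) auto
  moreover have he: "(\<lambda>k. cutoff k * osc \<tau> k / k * exp (- lam k * t) * cos (k * x)) = (\<lambda>k. h k * cos (k * x))"
    by (simp add: h_def P_def mult_ac)
  moreover have hi: "(\<lambda>k. h k * cos (k * x)) integrable_on {\<eta>..b}"
    using integrable_continuous_interval[OF assms(7)] unfolding he .
  ultimately have eq: "integral {\<eta>..b} (\<lambda>k. h k * cos (k * x)) = ?G b - ?G \<eta> - integral {\<eta>..b} ?g"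
    using Henstock_Kurzweil_Integration.integral_add[of "\<lambda>k. h k * cos (k * x)" "{\<eta>..b}" ?g]
    by (simp add: integral_unique)
  have G: "\<bar>?G k\<bar> \<le> 1 / (\<bar>x\<bar> * \<eta>)" if "k \<in> {\<eta>..b}" for k
  proof -
    have "\<bar>?G k\<bar> = \<bar>sin (k * x)\<bar> * \<bar>h k\<bar> / \<bar>x\<bar>" by (simp add: abs_mult)
    also have "\<dots> \<le> 1 * (1 / \<eta>) / \<bar>x\<bar>" using h_le[OF that] by (intro divide_right_mono mult_mono) auto
    finally show ?thesis by (simp add: mult.commute)
  qed
  have "5 / (\<bar>x\<bar> * \<eta>) = 1 / (\<bar>x\<bar> * \<eta>) + 1 / (\<bar>x\<bar> * \<eta>) + 3 / (\<bar>x\<bar> * \<eta>)"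
    by (simp add: add_divide_distrib[symmetric])
  moreover have "\<bar>a - b - c\<bar> \<le> \<bar>a\<bar> + \<bar>b\<bar> + \<bar>c\<bar>" for a b c :: real by linarith
  then have "\<bar>?G b - ?G \<eta> - integral {\<eta>..b} ?g\<bar> \<le> 1 / (\<bar>x\<bar> * \<eta>) + 1 / (\<bar>x\<bar> * \<eta>) + 3 / (\<bar>x\<bar> * \<eta>)"
    by (rule order_trans) (intro add_mono G g2; use \<eta> in simp)
  ultimately show ?thesis unfolding he eq by (simp only:)
qed

text \<open>Below the frequency \<open>\<eta>\<close> the integrand is nearly the one that has been subtracted; above \<open>\<eta>\<close> the
  solution has averaged out, and the subtracted integral from \<open>\<eta>\<close> to \<open>1\<close> remains. It is evaluated
  exactly.\<close>

lemma linear_asymptotics: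
  fixes x t \<tau> :: real
  assumes t: "1 \<le> t" and \<tau>: "0 < \<tau>" "\<tau> \<le> 1"
  defines "\<eta> \<equiv> 1 / sqrt (x\<^sup>2 + t)"
  shows "\<bar>integral\<^sup>L lborel (lin_int \<tau> x t) - 2 * (sin (\<tau> * ln \<eta>) / \<tau>)\<bar> \<le> 34"
proof -
  let ?F = "lin_int \<tau> x t"
  let ?s = "sin (\<tau> * ln \<eta>) / \<tau>"
  have N: "1 \<le> x\<^sup>2 + t" using t by (simp add: add_increasing)
  have \<eta>: "0 < \<eta>" "\<eta> \<le> 1" using N by (auto simp: \<eta>_def)
  have \<eta>2: "\<eta>\<^sup>2 = 1 / (x\<^sup>2 + t)" using N by (simp add: \<eta>_def power_divide)
  have xe: "\<bar>x\<bar> * \<eta> \<le> 1"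
  proof -
    have "\<bar>x\<bar> \<le> sqrt (x\<^sup>2 + t)" using t by (intro real_le_rsqrt) auto
    then show ?thesis using N by (simp add: \<eta>_def divide_le_eq)
  qed
  have te: "t * \<eta>\<^sup>2 \<le> 1" using N by (simp add: \<eta>2 divide_le_eq)
  note i = lin_int_integrable[of t \<tau> x]
  have si: "set_integrable lborel A ?F" if "A \<in> sets borel" for A
    unfolding set_integrable_def using i t that by (intro integrable_mult_indicator) auto
  have ion: "?F integrable_on {a..b}" for a b
    by (rule set_borel_integral_eq_integral(1)[OF si]) simp
  have near: "\<bar>integral {0..\<eta>} ?F\<bar> \<le> 5"
  proof -
    have "norm (integral {0..\<eta>} ?F) \<le> integral {0..\<eta>} (\<lambda>_. \<bar>x\<bar> + \<eta> * t + 3)"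
    proof (rule integral_norm_bound_integral[OF ion])
      fix k assume xi: "k \<in> {0..\<eta>}"
      have "\<bar>?F k\<bar> \<le> \<bar>x\<bar> + k * t + 3" using xi \<eta> t by (intro lin_int_small) auto
      also have "\<dots> \<le> \<bar>x\<bar> + \<eta> * t + 3" using xi t by (simp add: mult_right_mono)
      finally show "norm (?F k) \<le> \<bar>x\<bar> + \<eta> * t + 3" by simp
    qed (rule integrable_const_ivl)
    also have "\<dots> = \<bar>x\<bar> * \<eta> + t * \<eta>\<^sup>2 + 3 * \<eta>" using \<eta> by (simp add: algebra_simps power2_eq_square)
    also have "\<dots> \<le> 5" using xe te \<eta> by linarith
    finally show ?thesis by simp
  qed
  let ?h = "\<lambda>k. cutoff k * osc \<tau> k / k * exp (- lam k * t) * cos (k * x)"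
  have cont_osc: "continuous_on {\<eta>..b} (osc \<tau>)" for b
    unfolding osc_def using \<eta> by (intro continuous_intros) auto
  have far: "\<bar>integral {\<eta>..b} ?F - ?s\<bar> \<le> 12" if b: "1 \<le> b" for b
  proof -
    have "continuous_on {\<eta>..b} lam"
      using lam_has_derivative by (auto intro!: DERIV_continuous_on intro: has_field_derivative_at_within)
    moreover have "1 + k\<^sup>2 \<noteq> 0" for k :: real by (metis add_pos_nonneg less_irrefl zero_le_power2 zero_less_one)
    ultimately have h: "continuous_on {\<eta>..b} ?h"
      unfolding cutoff_def using \<eta> by (intro continuous_intros cont_osc) auto
    have b\<eta>: "\<eta> \<le> b" using \<eta> b by simp
    have J: "\<bar>integral {\<eta>..b} ?h\<bar> \<le> 12"
    proof (cases "x\<^sup>2 \<le> t")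
      case True
      have "\<bar>integral {\<eta>..b} ?h\<bar> \<le> 1 / (2 * t * \<eta>\<^sup>2)"
        using t by (intro far_frequencies_diffusive h \<eta> b\<eta>) auto
      also have "\<dots> = (x\<^sup>2 + t) / (2 * t)" by (simp add: \<eta>2)
      also have "\<dots> \<le> 12" using True t by (simp add: divide_le_eq)
      finally show ?thesis .
    next
      case False
      then have x: "x \<noteq> 0" using t by auto
      have "\<bar>integral {\<eta>..b} ?h\<bar> \<le> 5 / (\<bar>x\<bar> * \<eta>)"
        using t \<tau> by (intro far_frequencies_oscillating h \<eta> b\<eta> x) auto
      also have "\<dots> = 5 * (sqrt (x\<^sup>2 + t) / \<bar>x\<bar>)" by (simp add: \<eta>_def)
      also have "sqrt (x\<^sup>2 + t) \<le> 2 * \<bar>x\<bar>"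
      proof (rule real_le_lsqrt)
        show "x\<^sup>2 + t \<le> (2 * \<bar>x\<bar>)\<^sup>2" using False t by (simp add: power_mult_distrib)
      qed (use N in auto)
      then have "5 * (sqrt (x\<^sup>2 + t) / \<bar>x\<bar>) \<le> 12" using x by (simp add: divide_le_eq)
      finally show ?thesis .
    qed
    have "((\<lambda>k. osc \<tau> k / k) has_integral sin (\<tau> * ln 1) / \<tau> - sin (\<tau> * ln \<eta>) / \<tau>) {\<eta>..1}"
    proof (rule fundamental_theorem_of_calculus[OF \<eta>(2)])
      fix k assume "k \<in> {\<eta>..1}"
      then have xi: "0 < k" using \<eta> by auto
      have "((\<lambda>k. sin (\<tau> * ln k) / \<tau>) has_real_derivative osc \<tau> k / k) (at k)"
        using xi \<tau> by (auto intro!: derivative_eq_intros simp: osc_def)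
      then show "((\<lambda>k. sin (\<tau> * ln k) / \<tau>) has_vector_derivative osc \<tau> k / k) (at k within {\<eta>..1})"
        by (simp add: has_real_derivative_iff_has_vector_derivative has_vector_derivative_at_within)
    qed
    moreover have "{..1} \<inter> {\<eta>..b} = {\<eta>..1}" using b by auto
    ultimately have c: "((\<lambda>k. osc \<tau> k / k) has_integral - ?s) ({..1} \<inter> {\<eta>..b})"
      by (simp only: ln_one mult_zero_right sin_zero div_0 diff_0)
    then have c': "((\<lambda>k. if k \<in> {..1} then osc \<tau> k / k else 0) has_integral - ?s) {\<eta>..b}"
      by (simp only: has_integral_restrict_Int)
    have "((\<lambda>k. ?h k - (if k \<in> {..1} then osc \<tau> k / k else 0)) has_integral integral {\<eta>..b} ?h - - ?s) {\<eta>..b}"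
      by (intro has_integral_diff c' integrable_integral integrable_continuous_interval h)
    moreover have "?h k - (if k \<in> {..1} then osc \<tau> k / k else 0) = ?F k" if "k \<in> {\<eta>..b}" for k
      using that \<eta> by (auto simp: lin_int_def)
    ultimately have "(?F has_integral integral {\<eta>..b} ?h - - ?s) {\<eta>..b}"
      by (rule has_integral_eq[rotated])
    then show ?thesis using J by (simp add: integral_unique)
  qed
  have "\<bar>integral {0..b} ?F - ?s\<bar> \<le> 17" if b: "1 \<le> b" for b
  proof -
    have "integral {0..\<eta>} ?F + integral {\<eta>..b} ?F = integral {0..b} ?F"
      using \<eta> b by (intro Henstock_Kurzweil_Integration.integral_combine ion) auto
    with near far[OF b] show ?thesis by linarith
  qed
  then have le: "\<bar>(LINT k:{0..b}|lborel. ?F k) - ?s\<bar> \<le> 17" if "1 \<le> b" for b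
    using that set_borel_integral_eq_integral(2)[OF si, of "{0..b}"] by simp
  have "((\<lambda>b. LINT k:{0..b}|lborel. ?F k) \<longlongrightarrow> (LINT k:{0..}|lborel. ?F k)) at_top"
    by (rule tendsto_set_lebesgue_integral_at_top) (auto intro: si)
  then have "((\<lambda>b. \<bar>(LINT k:{0..b}|lborel. ?F k) - ?s\<bar>) \<longlongrightarrow> \<bar>(LINT k:{0..}|lborel. ?F k) - ?s\<bar>) at_top"
    by (intro tendsto_intros)
  then have "\<bar>(LINT k:{0..}|lborel. ?F k) - ?s\<bar> \<le> 17"
    by (rule tendsto_upperbound) (auto intro: eventually_mono[OF eventually_ge_at_top[of 1]] le)
  moreover have "integral\<^sup>L lborel ?F = 2 * (LINT k:{0..}|lborel. ?F k)"
    using i t by (intro even_integral lin_int_even) auto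
  ultimately show ?thesis by linarith
qed

section \<open>Derivatives within a domain\<close>

text \<open>In each coordinate direction a point is a limit of further points of the set. This makes
  derivatives within the set unique, on open sets and on the closed half-plane alike.\<close>

definition fat :: "(real \<times> real) set \<Rightarrow> bool" where
  "fat S \<longleftrightarrow> (\<forall>x\<in>S. \<forall>i\<in>Basis. \<forall>e>0. \<exists>d. 0 < \<bar>d\<bar> \<and> \<bar>d\<bar> < e \<and> x + d *\<^sub>R i \<in> S)"

lemma fat_open: 
  assumes "open S"
  shows "fat S"
  unfolding fat_def
proof (intro ballI allI impI)
  fix x i :: "real \<times> real" and e :: real assume h: "x \<in> S" "i \<in> Basis" "0 < e"
  obtain \<delta> where \<delta>: "0 < \<delta>" "ball x \<delta> \<subseteq> S" using assms h(1) openE by blast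
  let ?d = "min \<delta> e / 2"
  have "norm (?d *\<^sub>R i) < \<delta>" using h \<delta> by (simp add: norm_Basis)
  then have "x + ?d *\<^sub>R i \<in> ball x \<delta>" by (simp add: dist_norm)
  then show "\<exists>d. 0 < \<bar>d\<bar> \<and> \<bar>d\<bar> < e \<and> x + d *\<^sub>R i \<in> S"
    using \<delta> h(3) by (intro exI[of _ ?d]) auto
qed

lemma fat_lower_half_plane: "fat lower_half_plane"
  unfolding fat_def lower_half_plane_def
proof (intro ballI allI impI)
  fix x i :: "real \<times> real" and e :: real
  assume h: "x \<in> {(x2, x3). x3 \<le> 0}" "i \<in> Basis" "0 < e"
  have "i = (1, 0) \<or> i = (0, 1)" using h(2) by (auto simp: Basis_prod_def)
  then show "\<exists>d. 0 < \<bar>d\<bar> \<and> \<bar>d\<bar> < e \<and> x + d *\<^sub>R i \<in> {(x2, x3). x3 \<le> 0}"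
    using h by (intro exI[of _ "- e / 2"]) auto
qed

lemma dir_deriv_eqI:
  assumes "fat S" "x \<in> S" "(f has_derivative f') (at x within S)"
  shows "dir_deriv S v f x = f' v"
proof -
  have "(f has_derivative frechet_derivative f (at x within S)) (at x within S)"
    using assms(3) differentiableI frechet_derivative_works by blast
  then have "frechet_derivative f (at x within S) = f'"
    by (rule frechet_derivative_unique_within[OF _ assms(3)])
      (use assms(1,2) in \<open>auto simp: fat_def\<close>)
  then show ?thesis by (simp add: dir_deriv_def)
qed

lemma dir_deriv_cong_eqI:
  assumes "fat S" "x \<in> S" "(f has_derivative f') (at x within S)" "\<And>y. y \<in> S \<Longrightarrow> g y = f y"
  shows "dir_deriv S v g x = f' v"
  using has_derivative_transform[OF assms(2,4,3)] by (intro dir_deriv_eqI assms)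

lemma iter_deriv_zero:
  assumes "fat S" "y \<in> S"
  shows "iter_deriv S vs (\<lambda>_. 0 :: real) y = 0"
  using assms(2)
proof (induction vs arbitrary: y)
  case (Cons v vs)
  show ?case
    using dir_deriv_cong_eqI[OF assms(1) Cons.prems has_derivative_const[of 0] Cons.IH] by simp
qed simp

text \<open>A class of functions that is closed under linear combinations and contains the partial
  derivatives of its members contains their iterated derivatives in arbitrary directions.\<close>

locale derivative_closed =
  fixes C :: "(real \<times> real \<Rightarrow> real) \<Rightarrow> bool" and H :: "(real \<times> real) set"
  assumes closed_lincomb: "C f \<Longrightarrow> C g \<Longrightarrow> C (\<lambda>p. a * f p + b * g p)"
    and closed_deriv: "C f \<Longrightarrow> \<exists>f1 f2. C f1 \<and> C f2 \<and>
      (\<forall>p\<in>H. (f has_derivative (\<lambda>v. fst v * f1 p + snd v * f2 p)) (at p))"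
begin

text \<open>The derivative \<open>G\<close> is the same for all domains \<open>S\<close> and all translations \<open>q\<close>. Therefore a decay
  estimate for \<open>G\<close> gives convergence of the derivatives of the translates.\<close>

lemma iter_deriv_closed:
  assumes g1: "C g1" and g2: "C g2"
    and g: "\<And>p. p \<in> H \<Longrightarrow> (g has_derivative (\<lambda>v. fst v * g1 p + snd v * g2 p)) (at p)"
  shows "\<exists>G. (if vs = [] then G = g else C G) \<and>
    (\<forall>S q. fat S \<longrightarrow> (\<forall>y\<in>S. q + y \<in> H) \<longrightarrow> (\<forall>y\<in>S. iter_deriv S vs (\<lambda>y. g (q + y)) y = G (q + y)))"
proof (induction vs)
  case (Cons v vs)
  then obtain G where G: "if vs = [] then G = g else C G"
    "\<And>S q y. fat S \<Longrightarrow> (\<forall>y\<in>S. q + y \<in> H) \<Longrightarrow> y \<in> S \<Longrightarrow> iter_deriv S vs (\<lambda>y. g (q + y)) y = G (q + y)"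
    by blast
  obtain f1 f2 where f: "C f1" "C f2"
    "\<And>p. p \<in> H \<Longrightarrow> (G has_derivative (\<lambda>v. fst v * f1 p + snd v * f2 p)) (at p)"
  proof (cases "vs = []")
    case True
    then show ?thesis using that[OF g1 g2] g G(1) by simp
  next
    case False
    then show ?thesis using closed_deriv[of G] G(1) that by auto
  qed
  have "iter_deriv S (v # vs) (\<lambda>y. g (q + y)) y = fst v * f1 (q + y) + snd v * f2 (q + y)"
    if S: "fat S" "\<forall>y\<in>S. q + y \<in> H" "y \<in> S" for S q y
  proof -
    have "((\<lambda>y. G (q + y)) has_derivative (\<lambda>v. fst v * f1 (q + y) + snd v * f2 (q + y))) (at y within S)"
      using has_derivative_compose[OF has_derivative_add[OF has_derivative_const has_derivative_ident]
        f(3)[of "q + y"]] S by simp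
    then show ?thesis
      unfolding iter_deriv.simps by (rule dir_deriv_cong_eqI[OF S(1,3)]) (rule G(2)[OF S(1,2)])
  qed
  then show ?case using closed_lincomb[OF f(1,2), of "fst v" "snd v"]
    by (intro exI[of _ "\<lambda>p. fst v * f1 p + snd v * f2 p"]) auto
qed simp

lemma smooth_on_closed:
  assumes g1: "C g1" and g2: "C g2"
    and g: "\<And>p. p \<in> H \<Longrightarrow> (g has_derivative (\<lambda>v. fst v * g1 p + snd v * g2 p)) (at p)"
    and S: "fat S" "\<And>y. y \<in> S \<Longrightarrow> q + y \<in> H"
  shows "smooth_on S (\<lambda>y. g (q + y))"
  unfolding smooth_on_def differentiable_on_def
proof (intro allI ballI)
  fix vs y assume y: "y \<in> S"
  have "\<exists>G. (if vs = [] then G = g else C G) \<and>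
    (\<forall>S q. fat S \<longrightarrow> (\<forall>y\<in>S. q + y \<in> H) \<longrightarrow> (\<forall>y\<in>S. iter_deriv S vs (\<lambda>y. g (q + y)) y = G (q + y)))"
    by (rule iter_deriv_closed[OF g1 g2]) (rule g)
  then obtain G where G1: "if vs = [] then G = g else C G"
    and G': "\<forall>S q. fat S \<longrightarrow> (\<forall>y\<in>S. q + y \<in> H) \<longrightarrow> (\<forall>y\<in>S. iter_deriv S vs (\<lambda>y. g (q + y)) y = G (q + y))"
    by (elim exE conjE)
  have G2: "iter_deriv S vs (\<lambda>y. g (q + y)) y = G (q + y)" if "y \<in> S" for y
    using G' S that by blast
  obtain D where "(G has_derivative D) (at (q + y))"
  proof (cases "vs = []")
    case True
    then show ?thesis using G1 that g[OF S(2)[OF y]] by simp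
  next
    case False
    then show ?thesis using G1 that closed_deriv[of G] S(2)[OF y] by auto
  qed
  then have "((\<lambda>y. G (q + y)) has_derivative D) (at y within S)"
    using has_derivative_compose[OF has_derivative_add[OF has_derivative_const has_derivative_ident], of G D q y S]
    by simp
  then have "(iter_deriv S vs (\<lambda>y. g (q + y)) has_derivative D) (at y within S)"
    by (rule has_derivative_transform[OF y, rotated]) (rule G2)
  then show "iter_deriv S vs (\<lambda>y. g (q + y)) differentiable (at y within S)"
    by (rule differentiableI)
qed

end

section \<open>The solutions\<close>

text \<open>The factor \<open>1 / 10000\<close> is the smallness that the contraction needs. It is independent of \<open>\<tau>\<close>, and
  letting \<open>\<tau>\<close> tend to zero makes the amplitude as large as desired.\<close>

definition alp :: "real \<Rightarrow> real \<Rightarrow> real" where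
  "alp \<tau> k = sgn k * (1 / 10000 * (cutoff k * osc \<tau> k))"

lemma profile_alp: "profile (alp \<tau>) (1 / 10000)"
proof
  show "alp \<tau> \<in> borel_measurable borel"
    unfolding alp_def[abs_def] cutoff_def osc_def by measurable
  show "alp \<tau> (- k) = - alp \<tau> k" for k
    by (simp add: alp_def cutoff_def osc_def sgn_minus)
  show "\<bar>alp \<tau> k\<bar> \<le> 1 / 10000 * (exp (- \<bar>k\<bar>) / (1 + k\<^sup>2)\<^sup>2)" for k
  proof -
    have "\<bar>alp \<tau> k\<bar> = \<bar>sgn k\<bar> * (1 / 10000 * (cutoff k * \<bar>osc \<tau> k\<bar>))"
      using cutoff_bounds(1)[of k] by (simp add: alp_def abs_mult)
    also have "\<dots> \<le> 1 * (1 / 10000 * (cutoff k * 1))"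
      using cutoff_bounds(1)[of k] by (intro mult_mono) (auto simp: osc_def sgn_if)
    finally show ?thesis by (simp add: cutoff_def)
  qed
qed auto

locale oscillation =
  fixes \<tau> :: real
  assumes \<tau>: "0 < \<tau>" "\<tau> \<le> 1"
begin

sublocale profile "alp \<tau>" "1 / 10000"
  by (rule profile_alp)

text \<open>The linear solution plus the Duhamel correction.\<close>

definition U :: "real \<times> real \<Rightarrow> real" where
  "U p = (LINT k|lborel. (alp \<tau> k / k * exp (- lam k * snd p) + duh sol k (snd p))
      * cos (k * fst p + real 0 * (pi / 2))
    - 1 / 10000 * (if \<bar>k\<bar> \<le> 1 then osc \<tau> k / \<bar>k\<bar> else 0))"

lemma U_integrand:
  "(alp \<tau> k / k * exp (- lam k * t) + duh sol k t) * cos (k * x + real 0 * (pi / 2))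
    - 1 / 10000 * (if \<bar>k\<bar> \<le> 1 then osc \<tau> k / \<bar>k\<bar> else 0)
  = 1 / 10000 * lin_int \<tau> x t k + duh sol k t * cos (k * x + 0)"
proof -
  have "alp \<tau> k / k = 1 / 10000 * (cutoff k * osc \<tau> k / \<bar>k\<bar>)"
    by (simp add: alp_def sgn_if)
  then show ?thesis by (simp add: lin_int_def algebra_simps)
qed

lemma duh_sol_bound:
  assumes "0 < t"
  shows "\<bar>duh sol k t\<bar> \<le> 5 / 10000 / (1 + k\<^sup>2 * (rr t)\<^sup>2)"
proof -
  have "\<bar>duh sol k t\<bar> \<le> 5 * (1 / 10000 * mj (rr t) k)"
    using duh_bounds(1)[OF sol_source_bound, of t k] assms by simp
  also have "\<dots> \<le> 5 * (1 / 10000 * (1 / (1 + k\<^sup>2 * (rr t)\<^sup>2)))"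
    by (intro mult_left_mono mj_le_cauchy) auto
  also have "5 * (1 / 10000 * (1 / D)) = 5 / 10000 / D" for D :: real
    by (cases "D = 0") (simp_all add: field_simps)
  finally show ?thesis .
qed

lemma U_integrable:
  assumes "0 < t"
  shows "integrable lborel (\<lambda>k. (alp \<tau> k / k * exp (- lam k * t) + duh sol k t) * cos (k * x + real 0 * (pi / 2))
    - 1 / 10000 * (if \<bar>k\<bar> \<le> 1 then osc \<tau> k / \<bar>k\<bar> else 0))"
  unfolding U_integrand
proof (rule Bochner_Integration.integrable_add)
  show "integrable lborel (\<lambda>k. 1 / 10000 * lin_int \<tau> x t k)"
    using lin_int_integrable[of t \<tau> x] assms by simp
  show "integrable lborel (\<lambda>k. duh sol k t * cos (k * x + 0))"
    by (rule integrable_phase(1)[OF duh_sol_bound[OF assms] state_at_measurable(4) rr_pos]) (use assms in simp)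
qed

lemma U_asymptotics:
  assumes t: "1 \<le> t"
  shows "\<bar>U (x, t) - 1 / 5000 * (sin (\<tau> * ln (1 / sqrt (x\<^sup>2 + t))) / \<tau>)\<bar> \<le> 1"
proof -
  let ?s = "sin (\<tau> * ln (1 / sqrt (x\<^sup>2 + t))) / \<tau>"
  have t0: "0 < t" using t by simp
  have r: "1 \<le> rr t" using t by (intro rr_ge_1) simp
  have "U (x, t) = (LINT k|lborel. 1 / 10000 * lin_int \<tau> x t k + duh sol k t * cos (k * x + 0))"
    by (simp only: U_def fst_conv snd_conv U_integrand)
  also have "\<dots> = 1 / 10000 * integral\<^sup>L lborel (lin_int \<tau> x t) + (LINT k|lborel. duh sol k t * cos (k * x + 0))"
    using lin_int_integrable[of t \<tau> x] t
      integrable_phase(1)[OF duh_sol_bound[OF t0] state_at_measurable(4) rr_pos, of x 0]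
    by (subst Bochner_Integration.integral_add) auto
  finally have U: "U (x, t) = \<dots>" .
  have "\<bar>LINT k|lborel. duh sol k t * cos (k * x + 0)\<bar> \<le> 5 / 10000 * pi / rr t"
    by (rule integrable_phase(2)[OF duh_sol_bound[OF t0] state_at_measurable(4) rr_pos]) (use t in simp)
  also have "\<dots> \<le> 5 / 10000 * pi / 1" using r by (intro divide_left_mono) auto
  also have "\<dots> \<le> 1 / 2" using pi_less_4 by simp
  finally have 1: "\<bar>LINT k|lborel. duh sol k t * cos (k * x + 0)\<bar> \<le> 1 / 2" .
  have 2: "\<bar>integral\<^sup>L lborel (lin_int \<tau> x t) - 2 * ?s\<bar> \<le> 34"
    by (rule linear_asymptotics[OF t \<tau>])
  show ?thesis unfolding U using 1 2 by linarith
qed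

lemma U_has_derivative:
  assumes p: "0 < snd p"
  shows "(U has_derivative (\<lambda>v. fst v * ux 0 p + snd v * ut 0 p)) (at p)"
proof -
  let ?g = "\<lambda>k t. alp \<tau> k / k * exp (- lam k * t) + duh sol k t"
  have xg: "k * ?g k t = sx sol k t" for k t
    by (cases "k = 0") (auto simp: sx_def distrib_left)
  have "(U has_derivative (\<lambda>v. fst v * ft (Suc 0) (\<lambda>k. k * ?g k (snd p)) (fst p)
      + snd v * ft 0 (\<lambda>k. st sol k (snd p)) (fst p))) (at p)"
    unfolding U_def[abs_def]
  proof (rule phase_integral_has_derivative[where g="?g" and g'="st sol" and C="11 * (1 / 10000)"
        and n=0 and c="\<lambda>k. 1 / 10000 * (if \<bar>k\<bar> \<le> 1 then osc \<tau> k / \<bar>k\<bar> else 0)", OF _ U_integrable])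
    fix k t :: real assume t: "0 < t"
    have E: "((\<lambda>t. exp (- lam k * t)) has_real_derivative - lam k * exp (- lam k * t)) (at t)"
      by (auto intro!: derivative_eq_intros)
    show "(?g k has_real_derivative st sol k t) (at t)"
      by (rule DERIV_add[OF DERIV_cmult[OF E] duh_sol_DERIV(1)[OF t], THEN DERIV_cong])
        (simp add: st_def)
    show "\<bar>k * ?g k t\<bar> \<le> 11 * (1 / 10000) / (1 + k\<^sup>2 * 1\<^sup>2)"
      unfolding xg using state_moments(1)[OF t, of k 0] by simp
    show "\<bar>st sol k t\<bar> \<le> 11 * (1 / 10000) / (1 + k\<^sup>2 * 1\<^sup>2)"
      using state_moments(2)[OF t, of k 0] by simp
    show "(\<lambda>k. k * ?g k t) \<in> borel_measurable borel" unfolding xg by measurable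
  qed (use p in measurable)
  then show ?thesis unfolding xg by (simp add: ux_def ut_def)
qed

definition V :: "real \<times> real \<Rightarrow> real" where
  "V p = U (fst p, 1 - snd p)"

text \<open>The shift by \<open>1\<close> puts the closed lower half-plane into the open set \<open>t > 0\<close>, so that derivatives up to
  the boundary are ordinary derivatives.\<close>

definition mirror :: "real \<times> real \<Rightarrow> real \<times> real" where
  "mirror p = (fst p, 1 - snd p)"

definition valg :: "(real \<times> real \<Rightarrow> real) \<Rightarrow> bool" where
  "valg g \<longleftrightarrow> (\<exists>G. dalg G \<and> g = (\<lambda>p. G (mirror p)))"

abbreviation below :: "(real \<times> real) set" where
  "below \<equiv> {p. snd p < 1}"

lemma mirror_has_derivative:
  assumes "(G has_derivative (\<lambda>v. fst v * a + snd v * b)) (at (mirror p))"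
  shows "((\<lambda>p. G (mirror p)) has_derivative (\<lambda>v. fst v * a + snd v * (- 1 * b))) (at p)"
proof -
  have "(mirror has_derivative (\<lambda>v. (fst v, - snd v))) (at p)"
    unfolding mirror_def[abs_def] by (auto intro!: derivative_eq_intros)
  from has_derivative_compose[OF this assms] show ?thesis by simp
qed

sublocale derivative_closed valg below
proof
  fix f g a b assume "valg f" "valg g"
  then obtain F G where "dalg F" "dalg G" "f = (\<lambda>p. F (mirror p))" "g = (\<lambda>p. G (mirror p))"
    by (auto simp: valg_def)
  then show "valg (\<lambda>p. a * f p + b * g p)"
    unfolding valg_def by (intro exI[of _ "\<lambda>p. a * F p + b * G p"]) (auto intro: dalg.intros)
next
  fix f assume "valg f"
  then obtain F where F: "dalg F" "f = (\<lambda>p. F (mirror p))" by (auto simp: valg_def)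
  obtain F1 F2 where h: "dalg F1" "dalg F2"
    "\<And>p. 0 < snd p \<Longrightarrow> (F has_derivative (\<lambda>v. fst v * F1 p + snd v * F2 p)) (at p)"
    using dalg_has_derivative[OF F(1)] by blast
  have "valg (\<lambda>p. F1 (mirror p))" using h(1) by (auto simp: valg_def)
  moreover have "valg (\<lambda>p. - 1 * F2 (mirror p))"
    unfolding valg_def using dalg_cmult[OF h(2), of "-1"] by blast
  moreover have "(f has_derivative (\<lambda>v. fst v * F1 (mirror p) + snd v * (- 1 * F2 (mirror p)))) (at p)"
    if "p \<in> below" for p
    unfolding F(2) by (rule mirror_has_derivative[OF h(3)]) (use that in \<open>simp add: mirror_def\<close>)
  ultimately show "\<exists>f1 f2. valg f1 \<and> valg f2 \<and>
      (\<forall>p\<in>below. (f has_derivative (\<lambda>v. fst v * f1 p + snd v * f2 p)) (at p))" by blast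
qed

lemma valg_generators:
  "valg (\<lambda>p. ux j (mirror p))" "valg (\<lambda>p. - 1 * ut j (mirror p))"
  using dalg_ux[of j] dalg_cmult[OF dalg_ut[of j], of "-1"] unfolding valg_def by blast+

lemma V_has_derivative:
  assumes "p \<in> below"
  shows "((\<lambda>p. V p - c) has_derivative (\<lambda>v. fst v * ux 0 (mirror p) + snd v * (- 1 * ut 0 (mirror p)))) (at p)"
proof -
  have "((\<lambda>p. U (mirror p)) has_derivative (\<lambda>v. fst v * ux 0 (mirror p) + snd v * (- 1 * ut 0 (mirror p)))) (at p)"
    by (rule mirror_has_derivative[OF U_has_derivative]) (use assms in \<open>simp add: mirror_def\<close>)
  from has_derivative_diff[OF this has_derivative_const] show ?thesis by (simp add: V_def mirror_def)
qed

lemma lower_below: "p \<in> lower_half_plane \<Longrightarrow> p \<in> below"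
  by (auto simp: lower_half_plane_def)

lemma V_smooth: "smooth_on lower_half_plane V"
proof -
  have "smooth_on lower_half_plane (\<lambda>y. V (0 + y) - 0)"
    using lower_below
    by (intro smooth_on_closed[OF valg_generators V_has_derivative fat_lower_half_plane]) auto
  then show ?thesis by simp
qed

lemma normalized_has_derivative:
  assumes A: "(A has_derivative A') (at p within S)" and B: "(B has_derivative B') (at p within S)"
  defines "W \<equiv> sqrt (1 + ((A p)\<^sup>2 + (B p)\<^sup>2))"
  shows "((\<lambda>q. A q / sqrt (1 + ((A q)\<^sup>2 + (B q)\<^sup>2))) has_derivative
    (\<lambda>v. A' v / W - A p * (A p * A' v + B p * B' v) / W ^ 3)) (at p within S)"
proof -
  have pos: "0 < 1 + ((A p)\<^sup>2 + (B p)\<^sup>2)" by (intro add_pos_nonneg) auto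
  have W: "0 < W" using pos by (simp add: W_def)
  have s: "((\<lambda>q. sqrt (1 + ((A q)\<^sup>2 + (B q)\<^sup>2))) has_derivative (\<lambda>v. (A p * A' v + B p * B' v) / W)) (at p within S)"
    unfolding W_def using pos
    by (auto intro!: derivative_eq_intros A B simp: fun_eq_iff field_simps)
  show ?thesis
    by (rule has_derivative_eq_rhs[OF has_derivative_divide[OF A s]])
      (use W in \<open>auto simp: fun_eq_iff W_def[symmetric] field_simps power3_eq_cube\<close>)
qed

text \<open>The divergence form of the equation differs from \<open>soliton_equation\<close> by the factor \<open>W ^ 3\<close>. The sign of the
  first \<open>x3\<close>-derivative and of the mixed one is reversed by \<open>t = 1 - x3\<close>.\<close>

lemma V_solution: "translating_soliton_solution lower_half_plane V"
  unfolding translating_soliton_solution_def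
proof (intro conjI ballI V_smooth)
  fix p assume p: "p \<in> lower_half_plane"
  let ?S = lower_half_plane
  let ?A = "\<lambda>q. ux 0 (mirror q)"
  let ?B = "\<lambda>q. - 1 * ut 0 (mirror q)"
  have V: "(V has_derivative (\<lambda>v. fst v * ?A q + snd v * ?B q)) (at q within ?S)" if "q \<in> ?S" for q
    using has_derivative_at_withinI[OF V_has_derivative[OF lower_below[OF that], of 0]] by simp
  have dV: "dir_deriv ?S v V q = fst v * ?A q + snd v * ?B q" if "q \<in> ?S" for v q
    by (rule dir_deriv_eqI[OF fat_lower_half_plane that V[OF that]])
  have grad: "gradient ?S V q = (?A q, ?B q)" if "q \<in> ?S" for q
    using dV[OF that] by (simp add: gradient_def)
  have nrm: "(norm (gradient ?S V q))\<^sup>2 = (?A q)\<^sup>2 + (?B q)\<^sup>2" if "q \<in> ?S" for q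
    by (simp add: grad[OF that] norm_Pair)
  have r: "0 < snd (mirror p)" using lower_below[OF p] by (simp add: mirror_def)
  define a b axx axt d where "a = ux 0 (mirror p)" "b = ut 0 (mirror p)" "axx = ux 1 (mirror p)"
    "axt = ut 1 (mirror p)" "d = utt 0 (mirror p)"
  note defs = this
  have A: "(?A has_derivative (\<lambda>v. fst v * axx + snd v * (- axt))) (at p within ?S)"
    using has_derivative_at_withinI[OF mirror_has_derivative[OF ux_has_derivative[OF r, of 0]], of ?S]
    by (simp add: defs)
  have B: "(?B has_derivative (\<lambda>v. - 1 * (fst v * axt + snd v * (- d)))) (at p within ?S)"
    using has_derivative_at_withinI[OF has_derivative_mult_right[OF mirror_has_derivative[OF
      ut_has_derivative[OF r, of 0]], of "-1"], of ?S]
    by (simp add: defs)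
  define W where "W = sqrt (1 + (a\<^sup>2 + b\<^sup>2))"
  have W: "0 < W" "W\<^sup>2 = 1 + (a\<^sup>2 + b\<^sup>2)" by (simp_all add: W_def add_pos_nonneg)
  let ?F = "\<lambda>q. gradient ?S V q /\<^sub>R sqrt (1 + (norm (gradient ?S V q))\<^sup>2)"
  have F1: "fst (?F q) = ?A q / sqrt (1 + ((?A q)\<^sup>2 + (?B q)\<^sup>2))" if "q \<in> ?S" for q
    unfolding nrm[OF that] by (simp add: grad[OF that] divide_inverse mult.commute)
  have F2: "snd (?F q) = ?B q / sqrt (1 + ((?B q)\<^sup>2 + (?A q)\<^sup>2))" if "q \<in> ?S" for q
    unfolding nrm[OF that] by (simp add: grad[OF that] divide_inverse mult.commute add.commute)
  have 1: "dir_deriv ?S (1, 0) (\<lambda>q. fst (?F q)) p = axx / W - a * (a * axx + b * axt) / W ^ 3"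
    using dir_deriv_cong_eqI[OF fat_lower_half_plane p normalized_has_derivative[OF A B] F1, of "(1, 0)"]
    by (simp add: defs W_def)
  have 2: "dir_deriv ?S (0, 1) (\<lambda>q. snd (?F q)) p = d / W - b * (b * d + a * axt) / W ^ 3"
    using dir_deriv_cong_eqI[OF fat_lower_half_plane p normalized_has_derivative[OF B A] F2, of "(0, 1)"]
    by (simp add: defs W_def add.commute) (simp add: minus_divide_left algebra_simps)
  have eq: "(1 + a\<^sup>2) * d = b * (1 + a\<^sup>2 + b\<^sup>2) - (1 + b\<^sup>2) * axx + 2 * a * b * axt"
    using soliton_equation[OF r] by (simp add: defs)
  have "axx / W - a * (a * axx + b * axt) / W ^ 3 + (d / W - b * (b * d + a * axt) / W ^ 3)
    = (axx * W\<^sup>2 - a * (a * axx + b * axt) + (d * W\<^sup>2 - b * (b * d + a * axt))) / W ^ 3"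
    using W(1) by (simp add: field_simps power2_eq_square power3_eq_cube)
  also have "axx * W\<^sup>2 - a * (a * axx + b * axt) + (d * W\<^sup>2 - b * (b * d + a * axt)) = b * W\<^sup>2"
    unfolding W(2) using eq by (simp add: power2_eq_square algebra_simps)
  also have "b * W\<^sup>2 / W ^ 3 = b / W" using W(1) by (simp add: power2_eq_square power3_eq_cube)
  finally have e: "axx / W - a * (a * axx + b * axt) / W ^ 3 + (d / W - b * (b * d + a * axt) / W ^ 3) = b / W" .
  have "divergence ?S ?F p = b / W" unfolding divergence_def 1 2 by (rule e)
  moreover have "dir_deriv ?S (0, 1) V p = - b" using dV[OF p] by (simp add: defs)
  moreover have "sqrt (1 + (norm (gradient ?S V p))\<^sup>2) = W" unfolding nrm[OF p] by (simp add: W_def defs)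
  ultimately show "divergence ?S ?F p
      = - (dir_deriv ?S (0, 1) V p / sqrt (1 + (norm (gradient ?S V p))\<^sup>2))" by simp
qed


subsection \<open>Oscillation\<close>

definition amp :: real where "amp = 1 / (5000 * \<tau>)"

lemma V_asymptotics:
  assumes "x3 \<le> 0"
  shows "\<bar>V (x2, x3) - amp * sin (\<tau> * ln (1 / sqrt (x2\<^sup>2 + (1 - x3))))\<bar> \<le> 1"
  using U_asymptotics[of "1 - x3" x2] assms by (simp add: V_def amp_def mult.commute)

lemma V_bounded: "bounded (V ` lower_half_plane)"
proof (rule boundedI)
  fix y assume "y \<in> V ` lower_half_plane"
  then obtain x2 x3 where y: "y = V (x2, x3)" "x3 \<le> 0" by (auto simp: lower_half_plane_def)
  let ?s = "sin (\<tau> * ln (1 / sqrt (x2\<^sup>2 + (1 - x3))))"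
  have "\<bar>amp * ?s\<bar> \<le> \<bar>amp\<bar> * 1" unfolding abs_mult by (intro mult_left_mono) auto
  with V_asymptotics[OF y(2), of x2] show "norm y \<le> \<bar>amp\<bar> + 1" unfolding y(1) by simp
qed

text \<open>As \<open>x3\<close> decreases, the phase \<open>\<tau> * ln \<eta>\<close> runs continuously to \<open>- \<infinity>\<close>, hence passes
  through every angle infinitely often.\<close>

lemma phase_attained:
  assumes "0 \<le> c"
  shows "\<exists>x3\<le>N. x3 \<le> 0 \<and> sin (\<tau> * ln (1 / sqrt (x2\<^sup>2 + (1 - x3)))) = - sin c"
proof -
  obtain n :: nat where n: "x2\<^sup>2 + 1 + \<bar>N\<bar> \<le> real n" using real_arch_simple by blast
  \<comment> \<open>\<open>- z\<close> is the value of the phase that is aimed at; \<open>y = x2\<^sup>2 + t\<close> is solved for \<open>x3\<close>.\<close>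
  define z where "z = c + real n * (2 * pi)"
  define y where "y = exp (2 * z / \<tau>)"
  have "real n * 1 \<le> real n * (2 * pi)" by (intro mult_left_mono) (use pi_ge_two in auto)
  then have "real n \<le> real n * (2 * pi)" by simp
  also have "\<dots> \<le> z" using assms by (simp add: z_def)
  also have "z \<le> 2 * z / \<tau>"
  proof -
    have "0 \<le> z" using assms by (simp add: z_def)
    then have "z * \<tau> \<le> 2 * z" using \<tau> by (smt (verit) mult_left_le)
    then show ?thesis using \<tau> by (simp add: le_divide_eq)
  qed
  also have "\<dots> \<le> y" unfolding y_def using exp_ge_add_one_self[of "2 * z / \<tau>"] by linarith
  finally have y: "x2\<^sup>2 + 1 + \<bar>N\<bar> \<le> y" using n by linarith
  have "ln (1 / sqrt y) = - (z / \<tau>)"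
    by (simp add: y_def ln_div ln_sqrt)
  then have "\<tau> * ln (1 / sqrt y) = - z" using \<tau> by simp
  moreover have "sin z = sin c" using sin.plus_of_nat[of c n] by (simp add: z_def)
  ultimately have "sin (\<tau> * ln (1 / sqrt y)) = - sin c" by simp
  then show ?thesis using y
    by (intro exI[of _ "x2\<^sup>2 + 1 - y"]) (auto simp: algebra_simps abs_if split: if_splits)
qed

lemma V_high: "\<exists>x3\<le>N. x3 \<le> 0 \<and> amp - 1 \<le> V (x2, x3)"
proof -
  have "sin (3 * pi / 2) = - 1" by (metis sin_3over2_pi mult.commute times_divide_eq_left times_divide_eq_right)
  then obtain x3 where "x3 \<le> N" "x3 \<le> 0" "sin (\<tau> * ln (1 / sqrt (x2\<^sup>2 + (1 - x3)))) = 1"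
    using phase_attained[of "3 * pi / 2" N x2] by auto
  with V_asymptotics[of x3 x2] show ?thesis by (intro exI[of _ x3]) auto
qed

lemma V_low: "\<exists>x3\<le>N. x3 \<le> 0 \<and> V (x2, x3) \<le> - (amp - 1)"
proof -
  obtain x3 where "x3 \<le> N" "x3 \<le> 0" "sin (\<tau> * ln (1 / sqrt (x2\<^sup>2 + (1 - x3)))) = - 1"
    using phase_attained[of "pi / 2" N x2] by auto
  with V_asymptotics[of x3 x2] show ?thesis by (intro exI[of _ x3]) auto
qed

lemma V_Limsup: "ereal (amp - 1) \<le> Limsup at_bot (\<lambda>x3. ereal (V (x2, x3)))"
proof (rule ccontr)
  assume "\<not> ?thesis"
  then have "Limsup at_bot (\<lambda>x3. ereal (V (x2, x3))) < ereal (amp - 1)" by simp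
  from Limsup_lessD[OF this] obtain N where "\<forall>x3\<le>N. V (x2, x3) < amp - 1"
    unfolding eventually_at_bot_linorder by auto
  with V_high[of N x2] show False by force
qed

lemma V_Liminf: "Liminf at_bot (\<lambda>x3. ereal (V (x2, x3))) \<le> ereal (- (amp - 1))"
proof (rule ccontr)
  assume "\<not> ?thesis"
  then have "ereal (- (amp - 1)) < Liminf at_bot (\<lambda>x3. ereal (V (x2, x3)))" by simp
  from less_LiminfD[OF this] obtain N where "\<forall>x3\<le>N. - (amp - 1) < V (x2, x3)"
    unfolding eventually_at_bot_linorder by auto
  with V_low[of N x2] show False by force
qed

lemma V_continuous_x3: "continuous_on {..0} (\<lambda>x3. V (0, x3))"
proof -
  have "isCont V p" if "p \<in> below" for p
    using has_derivative_continuous[OF V_has_derivative[OF that, of 0]] by simp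
  then have "continuous_on below V" by (blast intro: continuous_at_imp_continuous_on)
  then have "continuous_on ((\<lambda>x3. (0, x3)) ` {..0}) V"
    by (rule continuous_on_subset) auto
  then show ?thesis
    by (rule continuous_on_compose2) (auto intro!: continuous_intros)
qed

text \<open>The intermediate value theorem on the line \<open>x2 = 0\<close>, between a high and a low value.\<close>

lemma V_attains:
  assumes "- (amp - 1) \<le> \<gamma>" "\<gamma> \<le> amp - 1"
  shows "\<exists>s\<ge>N. 0 \<le> s \<and> V (0, - s) = \<gamma>"
proof -
  define M where "M = min 0 (- N)"
  obtain a b where ab: "a \<le> M" "amp - 1 \<le> V (0, a)" "b \<le> M" "V (0, b) \<le> - (amp - 1)"
    using V_high[of M 0] V_low[of M 0] by blast
  have "connected ((\<lambda>x3. V (0, x3)) ` {..M})"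
    by (intro connected_continuous_image continuous_on_subset[OF V_continuous_x3]) (auto simp: M_def)
  moreover have "V (0, b) \<in> (\<lambda>x3. V (0, x3)) ` {..M}" "V (0, a) \<in> (\<lambda>x3. V (0, x3)) ` {..M}"
    using ab by auto
  moreover have "V (0, b) \<le> \<gamma>" "\<gamma> \<le> V (0, a)" using ab assms by linarith+
  ultimately have "\<gamma> \<in> (\<lambda>x3. V (0, x3)) ` {..M}"
    by (rule connectedD_interval)
  then obtain x3 where "x3 \<le> M" "V (0, x3) = \<gamma>" by auto
  then show ?thesis by (intro exI[of _ "- x3"]) (auto simp: M_def)
qed

subsection \<open>Convergence of the translates\<close>

lemma valg_uniformly_small:
  assumes "valg g" "0 < e"
  shows "\<exists>T\<ge>0. \<forall>p. snd p \<le> - T \<longrightarrow> \<bar>g p\<bar> < e"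
proof -
  obtain G where G: "dalg G" "g = (\<lambda>p. G (mirror p))" using assms by (auto simp: valg_def)
  have "\<forall>\<^sub>F p in filtercomap snd at_top. dist (G p) 0 < e"
    using dalg_tendsto[OF G(1)] assms(2) by (rule tendstoD)
  then obtain P where P: "eventually P at_top" "\<And>p. P (snd p) \<Longrightarrow> dist (G p) 0 < e"
    unfolding eventually_filtercomap by blast
  from P(1) obtain T where "\<And>t. T \<le> t \<Longrightarrow> P t" unfolding eventually_at_top_linorder by blast
  then have T: "\<bar>G p\<bar> < e" if "T \<le> snd p" for p
    using P(2)[of p] that by (simp add: dist_real_def)
  have "\<bar>g p\<bar> < e" if "snd p \<le> - max T 0" for p
    unfolding G(2) by (rule T) (use that in \<open>auto simp: mirror_def\<close>)
  then show ?thesis by (intro exI[of _ "max T 0"]) auto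
qed

text \<open>The gradient tends to zero uniformly, so far down the function is nearly constant on balls of
  fixed radius.\<close>

lemma V_flat:
  assumes t: "filterlim t at_top sequentially" and eq: "\<And>k. V (0, - t k) = \<gamma>" and e: "0 < e"
  shows "\<forall>\<^sub>F k in sequentially. \<forall>y. norm y \<le> R \<longrightarrow> \<bar>V ((0, - t k) + y) - \<gamma>\<bar> < e"
proof -
  define N where "N = \<bar>R\<bar> + 1"
  define \<delta> where "\<delta> = e / N / 2"
  have N: "0 < N" "\<bar>R\<bar> / N < 1" by (simp_all add: N_def)
  have \<delta>: "0 < \<delta>" "2 * \<delta> = e / N" using e N by (simp_all add: \<delta>_def)
  obtain T1 where T1: "0 \<le> T1" "\<And>p. snd p \<le> - T1 \<Longrightarrow> \<bar>ux 0 (mirror p)\<bar> < \<delta>"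
    using valg_uniformly_small[OF valg_generators(1)[of 0] \<delta>(1)] by blast
  obtain T2 where T2: "0 \<le> T2" "\<And>p. snd p \<le> - T2 \<Longrightarrow> \<bar>- 1 * ut 0 (mirror p)\<bar> < \<delta>"
    using valg_uniformly_small[OF valg_generators(2)[of 0] \<delta>(1)] by blast
  define T where "T = max T1 T2"
  let ?S = "{p :: real \<times> real. snd p \<le> - T}"
  have "?S = UNIV \<times> {..- T}" by auto
  then have conv: "convex ?S" by (simp add: convex_Times)
  have lip: "\<bar>V p - V q\<bar> \<le> 2 * \<delta> * norm (p - q)" if "p \<in> ?S" "q \<in> ?S" for p q
    unfolding real_norm_def[symmetric]
  proof (rule differentiable_bound[OF conv _ _ that])
    fix p assume p: "p \<in> ?S"
    then have "p \<in> below" using T1 T2 by (auto simp: T_def)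
    from has_derivative_at_withinI[OF V_has_derivative[OF this, of 0], of ?S]
    show "(V has_derivative (\<lambda>v. fst v * ux 0 (mirror p) + snd v * (- 1 * ut 0 (mirror p)))) (at p within ?S)"
      by (simp only: diff_0_right)
    show "onorm (\<lambda>v. fst v * ux 0 (mirror p) + snd v * (- 1 * ut 0 (mirror p))) \<le> 2 * \<delta>"
    proof (rule onorm_bound)
      fix v :: "real \<times> real"
      have "T1 \<le> T" "T2 \<le> T" by (simp_all add: T_def)
      then have "\<bar>ux 0 (mirror p)\<bar> < \<delta>" "\<bar>- 1 * ut 0 (mirror p)\<bar> < \<delta>"
        using T1(2)[of p] T2(2)[of p] p by auto
      then have "\<bar>fst v\<bar> * \<bar>ux 0 (mirror p)\<bar> + \<bar>snd v\<bar> * \<bar>- 1 * ut 0 (mirror p)\<bar> \<le> norm v * \<delta> + norm v * \<delta>"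
        using norm_fst_le[of "fst v" "snd v"] norm_snd_le[of "snd v" "fst v"]
        by (intro add_mono mult_mono) auto
      then show "norm (fst v * ux 0 (mirror p) + snd v * (- 1 * ut 0 (mirror p))) \<le> 2 * \<delta> * norm v"
        unfolding real_norm_def by (intro order_trans[OF abs_triangle_ineq]) (simp add: abs_mult)
    qed (use \<delta> in auto)
  qed
  have "\<forall>\<^sub>F k in sequentially. T + \<bar>R\<bar> \<le> t k"
    using t by (simp add: filterlim_at_top)
  then show ?thesis
  proof eventually_elim
    case (elim k)
    show ?case
    proof (intro allI impI)
      fix y :: "real \<times> real" assume y: "norm y \<le> R"
      have "\<bar>snd y\<bar> \<le> \<bar>R\<bar>" using y norm_snd_le[of "snd y" "fst y"] by simp
      then have "(0, - t k) + y \<in> ?S" "(0, - t k) \<in> ?S" using elim by auto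
      from lip[OF this] have "\<bar>V ((0, - t k) + y) - \<gamma>\<bar> \<le> 2 * \<delta> * norm y" by (simp add: eq)
      also have "\<dots> \<le> 2 * \<delta> * \<bar>R\<bar>" using y \<delta> by (intro mult_left_mono) auto
      also have "\<dots> = e * (\<bar>R\<bar> / N)" by (simp add: \<delta>(2))
      also have "\<dots> < e * 1" using e N by (intro mult_strict_left_mono) auto
      finally show "\<bar>V ((0, - t k) + y) - \<gamma>\<bar> < e" by simp
    qed
  qed
qed

lemma translate_mem:
  "(x1, x2, x3) \<in> (\<lambda>x. x + s *\<^sub>R e3) ` Graph lower_half_plane V \<longleftrightarrow> x3 \<le> s \<and> x1 = V (x2, x3 - s)"
proof
  assume "(x1, x2, x3) \<in> (\<lambda>x. x + s *\<^sub>R e3) ` Graph lower_half_plane V"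
  then show "x3 \<le> s \<and> x1 = V (x2, x3 - s)"
    by (auto simp: Graph_def lower_half_plane_def e3_def)
next
  assume h: "x3 \<le> s \<and> x1 = V (x2, x3 - s)"
  then have "(V (x2, x3 - s), x2, x3 - s) \<in> Graph lower_half_plane V"
    by (auto simp: Graph_def lower_half_plane_def)
  then show "(x1, x2, x3) \<in> (\<lambda>x. x + s *\<^sub>R e3) ` Graph lower_half_plane V"
    by (rule rev_image_eqI) (use h in \<open>simp add: e3_def\<close>)
qed

text \<open>At a point of the plane the standard frame is used: both surfaces are graphs over the unit disc in
  the \<open>(x2, x3)\<close>-plane. The graph functions tend to zero by \<open>V_flat\<close>, their derivatives because they
  belong to \<open>valg\<close>.\<close>

lemma V_translates_converge:
  assumes t: "filterlim t at_top sequentially" and eq: "\<And>k. V (0, - t k) = \<gamma>"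
  shows "surfaces_converge_smoothly
    (\<lambda>k. (\<lambda>x. x + t k *\<^sub>R e3) ` Graph lower_half_plane V) {(x1, x2, x3). x1 = \<gamma>}"
  unfolding surfaces_converge_smoothly_def
proof (intro conjI allI impI ballI)
  fix p :: space assume "p \<notin> {(x1, x2, x3). x1 = \<gamma>}"
  then obtain p1 p2 p3 where p: "p = (p1, p2, p3)" "p1 \<noteq> \<gamma>" by (cases p) auto
  define d where "d = \<bar>p1 - \<gamma>\<bar> / 2"
  have d: "0 < d" using p by (simp add: d_def)
  have "\<forall>\<^sub>F k in sequentially. (\<lambda>x. x + t k *\<^sub>R e3) ` Graph lower_half_plane V \<inter> ball p d = {}"
    using V_flat[OF t eq d, of "norm (p2, p3) + d"]
  proof eventually_elim
    case (elim k)
    have False if m: "(x1, x2, x3) \<in> (\<lambda>x. x + t k *\<^sub>R e3) ` Graph lower_half_plane V"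
      and b: "(x1, x2, x3) \<in> ball p d" for x1 x2 x3
    proof -
      have x1: "x1 = V ((0, - t k) + (x2, x3))" using m unfolding translate_mem by simp
      have n: "norm (p1 - x1, (p2, p3) - (x2, x3)) < d" using b by (simp add: p dist_norm)
      have "norm ((p2, p3) - (x2, x3)) < d"
        using norm_snd_le[of "(p2, p3) - (x2, x3)" "p1 - x1"] n by linarith
      then have "norm (x2, x3) \<le> norm (p2, p3) + d"
        using norm_triangle_ineq3[of "(p2, p3)" "(x2, x3)"] by linarith
      with elim have "\<bar>x1 - \<gamma>\<bar> < d" unfolding x1 by blast
      moreover have "\<bar>p1 - x1\<bar> < d" using norm_fst_le[of "p1 - x1" "(p2, p3) - (x2, x3)"] n by simp
      ultimately show False by (simp add: d_def abs_if split: if_splits)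
    qed
    then show ?case unfolding disjoint_iff by (metis prod_cases3)
  qed
  then show "\<exists>W. open W \<and> p \<in> W \<and> (\<forall>\<^sub>F k in sequentially.
      (\<lambda>x. x + t k *\<^sub>R e3) ` Graph lower_half_plane V \<inter> W = {})"
    using d by (intro exI[of _ "ball p d"]) auto
next
  fix p :: space assume "p \<in> {(x1, x2, x3). x1 = \<gamma>}"
  then obtain p2 p3 where p: "p = (\<gamma>, p2, p3)" by (cases p) auto
  define q where "q k = (p2, p3 - t k)" for k
  define f where "f k y = V (q k + y) - \<gamma>" for k and y :: plane
  let ?B = "ball (0 :: plane) 1"
  have B: "fat ?B" by (intro fat_open) auto
  have qy: "q k + y = (0, - t k) + ((p2, p3) + y)" for k y by (simp add: q_def prod_eq_iff)
  have y3: "\<bar>snd y\<bar> < 1" if "y \<in> ?B" for y :: plane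
    using that norm_snd_le[of "snd y" "fst y"] by simp
  have inside: "\<forall>\<^sub>F k in sequentially. \<forall>y\<in>?B. p3 + snd y \<le> t k \<and> q k + y \<in> below"
  proof -
    have "\<forall>\<^sub>F k in sequentially. \<bar>p3\<bar> + 1 \<le> t k" using t by (simp add: filterlim_at_top)
    then show ?thesis
    proof eventually_elim
      case (elim k)
      show ?case
      proof
        fix y :: plane assume "y \<in> ?B"
        from y3[OF this] elim show "p3 + snd y \<le> t k \<and> q k + y \<in> below" by (auto simp: q_def)
      qed
    qed
  qed
  have small: "\<forall>\<^sub>F k in sequentially. \<forall>y\<in>?B. \<bar>f k y\<bar> < e" if "0 < e" for e
    using V_flat[OF t eq that, of "norm (p2, p3) + 1"]
  proof eventually_elim
    case (elim k)
    show ?case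
    proof
      fix y :: plane assume "y \<in> ?B"
      then have "norm ((p2, p3) + y) \<le> norm (p2, p3) + 1"
        using norm_triangle_ineq[of "(p2, p3)" y] by simp
      with elim show "\<bar>f k y\<bar> < e" unfolding f_def qy by blast
    qed
  qed
  have plane: "{(x1, x2, x3). x1 = \<gamma>} \<inter> cylinder p (\<lambda>x. x) 1 1 = graph_in_frame p (\<lambda>x. x) 1 (\<lambda>_. 0)"
    unfolding cylinder_def graph_in_frame_def p by (fastforce simp: prod_eq_iff)
  have surf: "\<forall>\<^sub>F k in sequentially. (\<lambda>x. x + t k *\<^sub>R e3) ` Graph lower_half_plane V \<inter> cylinder p (\<lambda>x. x) 1 1
      = graph_in_frame p (\<lambda>x. x) 1 (f k)"
    using inside small[OF zero_less_one]
  proof eventually_elim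
    case (elim k)
    have *: "(\<gamma> + s, p2 + y2, p3 + y3) \<in> (\<lambda>x. x + t k *\<^sub>R e3) ` Graph lower_half_plane V
        \<longleftrightarrow> s = f k (y2, y3)" if "(y2, y3) \<in> ?B" for s y2 y3
      unfolding translate_mem using bspec[OF elim(1) that] by (auto simp: f_def q_def algebra_simps)
    show ?case
    proof (intro set_eqI iffI)
      fix x assume x: "x \<in> (\<lambda>x. x + t k *\<^sub>R e3) ` Graph lower_half_plane V \<inter> cylinder p (\<lambda>x. x) 1 1"
      then obtain s y2 y3 where s: "x = (\<gamma> + s, p2 + y2, p3 + y3)" "(y2, y3) \<in> ?B"
        by (auto simp: cylinder_def p)
      have "s = f k (y2, y3)" using x unfolding s(1) Int_iff *[OF s(2)] by (elim conjE)
      then have "x = p + (f k (y2, y3), (y2, y3))" by (simp add: s(1) p)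
      with s(2) show "x \<in> graph_in_frame p (\<lambda>x. x) 1 (f k)"
        unfolding graph_in_frame_def by blast
    next
      fix x assume "x \<in> graph_in_frame p (\<lambda>x. x) 1 (f k)"
      then obtain y2 y3 where s: "x = (\<gamma> + f k (y2, y3), p2 + y2, p3 + y3)" "(y2, y3) \<in> ?B"
        by (auto simp: graph_in_frame_def p)
      have "x \<in> cylinder p (\<lambda>x. x) 1 1"
        unfolding cylinder_def p s(1) using s(2) elim(2) by force
      with *[OF s(2)] s(1) show "x \<in> (\<lambda>x. x + t k *\<^sub>R e3) ` Graph lower_half_plane V \<inter> cylinder p (\<lambda>x. x) 1 1"
        by simp
    qed
  qed
  have smooth: "\<forall>\<^sub>F k in sequentially. smooth_on ?B (f k)"
    using inside
  proof eventually_elim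
    case (elim k)
    show ?case unfolding f_def[abs_def]
      by (rule smooth_on_closed[OF valg_generators V_has_derivative B]) (use elim in auto)
  qed
  have "smooth_on ?B (\<lambda>_. 0 :: real)"
    unfolding smooth_on_def differentiable_on_def
  proof (intro allI ballI)
    fix vs and y :: plane assume y: "y \<in> ?B"
    have "(iter_deriv ?B vs (\<lambda>_. 0 :: real) has_derivative (\<lambda>_. 0)) (at y within ?B)"
      by (rule has_derivative_transform[OF y _ has_derivative_const[of 0]]) (rule iter_deriv_zero[OF B])
    then show "iter_deriv ?B vs (\<lambda>_. 0 :: real) differentiable (at y within ?B)"
      by (rule differentiableI)
  qed
  moreover have "smooth_uniform_limit ?B f (\<lambda>_. 0)"
    unfolding smooth_uniform_limit_def
  proof (intro allI uniform_limitI)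
    fix vs :: "plane list" and e :: real assume e: "0 < e"
    have "\<forall>\<^sub>F k in sequentially. \<forall>y\<in>?B. \<bar>iter_deriv ?B vs (f k) y\<bar> < e"
    proof (cases "vs = []")
      case True
      then show ?thesis using small[OF e] by simp
    next
      case False
      have "\<exists>G. (if vs = [] then G = (\<lambda>p. V p - \<gamma>) else valg G) \<and>
        (\<forall>S q. fat S \<longrightarrow> (\<forall>y\<in>S. q + y \<in> below) \<longrightarrow>
          (\<forall>y\<in>S. iter_deriv S vs (\<lambda>y. V (q + y) - \<gamma>) y = G (q + y)))"
        by (rule iter_deriv_closed[OF valg_generators]) (rule V_has_derivative)
      with False obtain G where G: "valg G" and G': "\<forall>S q. fat S \<longrightarrow> (\<forall>y\<in>S. q + y \<in> below) \<longrightarrow>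
          (\<forall>y\<in>S. iter_deriv S vs (\<lambda>y. V (q + y) - \<gamma>) y = G (q + y))" by auto
      obtain T where T: "\<And>p. snd p \<le> - T \<Longrightarrow> \<bar>G p\<bar> < e" using valg_uniformly_small[OF G e] by blast
      have "\<forall>\<^sub>F k in sequentially. T + \<bar>p3\<bar> + 1 \<le> t k" using t by (simp add: filterlim_at_top)
      with inside show ?thesis
      proof eventually_elim
        case (elim k)
        show ?case
        proof
          fix y :: plane assume y: "y \<in> ?B"
          have "iter_deriv ?B vs (f k) y = G (q k + y)"
            unfolding f_def[abs_def] using G' B elim(1) y by blast
          moreover have "\<bar>G (q k + y)\<bar> < e"
            by (rule T) (use elim(2) y3[OF y] in \<open>auto simp: q_def\<close>)
          ultimately show "\<bar>iter_deriv ?B vs (f k) y\<bar> < e" by simp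
        qed
      qed
    qed
    then show "\<forall>\<^sub>F k in sequentially. \<forall>y\<in>?B. dist (iter_deriv ?B vs (f k) y) (iter_deriv ?B vs (\<lambda>_. 0) y) < e"
      by eventually_elim (simp add: iter_deriv_zero[OF B] dist_real_def)
  qed
  moreover have "orthogonal_transformation (\<lambda>x :: space. x)"
    by (simp add: orthogonal_transformation_def linear_id[unfolded id_def])
  ultimately show "\<exists>Q r h f g. orthogonal_transformation Q \<and> r > 0 \<and> h > 0 \<and> smooth_on (ball 0 r) g \<and>
      {(x1, x2, x3). x1 = \<gamma>} \<inter> cylinder p Q r h = graph_in_frame p Q r g \<and>
      (\<forall>\<^sub>F k in sequentially. smooth_on (ball 0 r) (f k) \<and>
        (\<lambda>x. x + t k *\<^sub>R e3) ` Graph lower_half_plane V \<inter> cylinder p Q r h = graph_in_frame p Q r (f k)) \<and>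
      smooth_uniform_limit (ball 0 r) f g"
    using plane eventually_conj[OF smooth surf]
    by (intro exI[of _ "\<lambda>x. x"] exI[of _ 1] exI[of _ f] exI[of _ "\<lambda>_. 0"] conjI) auto
qed

text \<open>Successive depths are chosen at distance at least \<open>1\<close>, so that they tend to infinity.\<close>

lemma V_subsequence:
  assumes "- (amp - 1) \<le> \<gamma>" "\<gamma> \<le> amp - 1"
  shows "\<exists>t :: nat \<Rightarrow> real. strict_mono t \<and> filterlim t at_top sequentially \<and>
    surfaces_converge_smoothly
      (\<lambda>k. (\<lambda>x. x + t k *\<^sub>R e3) ` Graph lower_half_plane V) {(x1, x2, x3). x1 = \<gamma>}"
proof -
  have "\<exists>t. \<forall>n. V (0, - t n) = \<gamma> \<and> t n + 1 \<le> t (Suc n)"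
    by (rule dependent_nat_choice) (use V_attains[OF assms] in blast)+
  then obtain t where t: "\<And>n. V (0, - t n) = \<gamma>" "\<And>n. t n + 1 \<le> t (Suc n)" by blast
  have "t n < t (Suc n)" for n using t(2)[of n] by linarith
  then have mono: "strict_mono t" by (simp add: strict_mono_Suc_iff)
  have "t 0 + real n \<le> t n" for n
  proof (induction n)
    case (Suc n)
    with t(2)[of n] show ?case by simp
  qed simp
  moreover have "filterlim (\<lambda>n. t 0 + real n) at_top sequentially"
    by (intro filterlim_tendsto_add_at_top[OF tendsto_const] filterlim_real_sequentially)
  ultimately have "filterlim t at_top sequentially"
    using filterlim_at_top_mono[of "\<lambda>n. t 0 + real n" sequentially t] by (simp add: always_eventually)
  note lim = this
  show ?thesis by (intro exI[of _ t] conjI mono lim V_translates_converge[OF lim t(1)])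
qed

end

lemma oscillation_exists:
  assumes "1 \<le> A"
  shows "oscillation (1 / (5000 * A))" "oscillation.amp (1 / (5000 * A)) = A"
proof -
  show o: "oscillation (1 / (5000 * A))"
    using assms by unfold_locales (auto simp: divide_le_eq)
  show "oscillation.amp (1 / (5000 * A)) = A"
    using assms by (simp add: oscillation.amp_def[OF o])
qed

theorem theorem5p1:
  shows
    "(\<exists>u :: real \<times> real \<Rightarrow> real.
        translating_soliton_solution lower_half_plane u \<and>
        bounded (u ` lower_half_plane) \<and>
        (\<forall>x2 :: real.
           Limsup at_bot (\<lambda>x3. ereal (u (x2, x3))) - Liminf at_bot (\<lambda>x3. ereal (u (x2, x3))) > 0) \<and>
        (\<forall>x2 :: real. \<not> (\<exists>L :: ereal. ((\<lambda>x3. ereal (u (x2, x3))) \<longlongrightarrow> L) at_bot)))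
     \<and>
     (\<forall>\<alpha> \<beta> :: real. \<alpha> \<le> \<beta> \<longrightarrow>
        (\<exists>u :: real \<times> real \<Rightarrow> real.
           translating_soliton_solution lower_half_plane u \<and>
           bounded (u ` lower_half_plane) \<and>
           (\<forall>\<gamma>\<in>{\<alpha><..<\<beta>}. \<exists>t :: nat \<Rightarrow> real.
              strict_mono t \<and> filterlim t at_top sequentially \<and>
              surfaces_converge_smoothly
                (\<lambda>k. (\<lambda>x. x + t k *\<^sub>R e3) ` Graph lower_half_plane u)
                {(x1, x2, x3). x1 = \<gamma>})))"
proof (intro conjI allI impI, goal_cases)
  case 1
  define A :: real where "A = 2"
  have A: "1 \<le> A" by (simp add: A_def)
  interpret oscillation "1 / (5000 * A)" by (rule oscillation_exists[OF A])
  have amp: "amp = 2" using oscillation_exists(2)[OF A] by (simp add: A_def)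
  have sup: "1 \<le> Limsup at_bot (\<lambda>x3. ereal (V (x2, x3)))" for x2
    using V_Limsup[of x2] by (simp add: amp one_ereal_def)
  have inf: "Liminf at_bot (\<lambda>x3. ereal (V (x2, x3))) \<le> - 1" for x2
    using V_Liminf[of x2] by (simp add: amp one_ereal_def)
  show ?case
  proof (intro exI[of _ V] conjI allI notI V_solution V_bounded)
    fix x2
    have "(0 :: ereal) < 1 - (- 1)" by (simp add: one_ereal_def)
    also have "\<dots> \<le> Limsup at_bot (\<lambda>x3. ereal (V (x2, x3))) - Liminf at_bot (\<lambda>x3. ereal (V (x2, x3)))"
      by (rule ereal_minus_mono[OF sup inf])
    finally show "0 < Limsup at_bot (\<lambda>x3. ereal (V (x2, x3))) - Liminf at_bot (\<lambda>x3. ereal (V (x2, x3)))" .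
  next
    fix x2
    assume "\<exists>L :: ereal. ((\<lambda>x3. ereal (V (x2, x3))) \<longlongrightarrow> L) at_bot"
    then obtain L :: ereal where L: "((\<lambda>x3. ereal (V (x2, x3))) \<longlongrightarrow> L) at_bot" by blast
    have "1 \<le> L" "L \<le> - 1"
      using sup[of x2] inf[of x2] lim_imp_Limsup[OF _ L] lim_imp_Liminf[OF _ L] by auto
    then have "(1 :: ereal) \<le> - 1" by (rule order_trans)
    then show False by (simp add: one_ereal_def)
  qed
next
  case (2 \<alpha> \<beta>)
  \<comment> \<open>The solution is only controlled up to an error \<open>1\<close>, so the amplitude exceeds the interval by \<open>1\<close>.\<close>
  define A where "A = \<bar>\<alpha>\<bar> + \<bar>\<beta>\<bar> + 1"
  have A: "1 \<le> A" by (simp add: A_def)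
  interpret oscillation "1 / (5000 * A)" by (rule oscillation_exists[OF A])
  have amp: "amp = A" by (rule oscillation_exists(2)[OF A])
  have "- (amp - 1) \<le> \<gamma>" "\<gamma> \<le> amp - 1" if "\<gamma> \<in> {\<alpha><..<\<beta>}" for \<gamma>
  proof -
    have "\<beta> \<le> A - 1" "- (A - 1) \<le> \<alpha>" by (auto simp: A_def)
    then show "- (amp - 1) \<le> \<gamma>" "\<gamma> \<le> amp - 1" unfolding amp using that by auto
  qed
  then show ?case
    using V_subsequence by (intro exI[of _ V] conjI ballI V_solution V_bounded) blast
qed

end
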